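(* Let $n\in\mathbb Z$, let $q,a,b,c,d,e,f$ be non-zero complex numbers with $|q|<1$ and $|q^2a^2|<|bcdef|$, and assume there are no vanishing denominator factors. Then $${}_8W_7\!\left(a;b,c,d,e,f;q,\frac{q^2a^2}{bcdef}\right)=\frac{(qa,\frac{qa}{bc};q)_\infty}{\vartheta(\frac{q^{n-1}bc}a,\frac{q^{n-2}bcdef}{a^2};q)\,(\frac{qa}b,\frac{qa}c,\frac{qa}d,\frac{qa}e,\frac{qa}f;q)_\infty}\Big(F(d;e,f)+F(e;d,f)+F(f;e,d)\Big),$$ where $$F(d;e,f):=\frac{\vartheta(\frac{q^{n-1}bcd}a,\frac{q^{n-2}bcef}{a^2};q)(\frac{qa}{bd},\frac{qa}{cd},\frac{qa}{de},\frac{qa}{df},e,f;q)_\infty}{(\frac{qa}{bcd},\frac ed,\frac fd;q)_\infty}\,{}_4\phi_3\!\left(\tfrac{qa}{ef},\tfrac{bd}a,\tfrac{cd}a,d;\tfrac{bcd}a,\tfrac{qd}e,\tfrac{qd}f;q,q\right).$$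
   Context: Notation. $(a;q)_k=\prod_{j=0}^{k-1}(1-aq^j)$, $(a;q)_\infty=\prod_{j\ge0}(1-aq^j)$, $(a_1,\dots,a_r;q)_k=\prod_j(a_j;q)_k$ for $k\in\mathbb N_0\cup\{\infty\}$. In a list, $\pm x$ stands for the two entries $x,-x$. The symbol $e$ is a parameter, not Euler's number. $\vartheta(x;q)=(x,q/x;q)_\infty$ for $x\ne0$, $\vartheta(x_1,\dots,x_k;q)=\prod_j\vartheta(x_j;q)$. ${}_{r+1}\phi_r(a_1,\dots,a_{r+1};b_1,\dots,b_r;q,z)=\sum_{k\ge0}\frac{(a_1,\dots,a_{r+1};q)_k}{(q,b_1,\dots,b_r;q)_k}z^k$ for $|z|<1$, and $${}_8W_7(a;b,c,d,e,f;q,z)={}_8\phi_7\!\left(a,\pm q\sqrt a,b,c,d,e,f;\pm\sqrt a,\tfrac{qa}b,\tfrac{qa}c,\tfrac{qa}d,\tfrac{qa}e,\tfrac{qa}f;q,z\right).$$ $F(e;d,f)$ and $F(f;e,d)$ are obtained from $F(d;e,f)$ by interchanging $d$ with $e$, respectively $d$ with $f$. Convention "no vanishing denominator factors": every infinite $q$-shifted factorial and every theta function appearing in a denominator is non-zero, and no denominator parameter of any series lies in $\{q^{-k}:k\in\mathbb N_0\}$. *)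

theory Defs
  imports "HOL-Analysis.Analysis"
begin

definition qpoch :: "complex \<Rightarrow> complex \<Rightarrow> nat \<Rightarrow> complex" where
  "qpoch a q k = (\<Prod>j<k. 1 - a * q ^ j)"

definition qpoch_inf :: "complex \<Rightarrow> complex \<Rightarrow> complex" where
  "qpoch_inf a q = (\<Prod>j. 1 - a * q ^ j)"

definition qpochs :: "complex list \<Rightarrow> complex \<Rightarrow> nat \<Rightarrow> complex" where
  "qpochs as q k = (\<Prod>a\<leftarrow>as. qpoch a q k)"

definition qpochs_inf :: "complex list \<Rightarrow> complex \<Rightarrow> complex" where
  "qpochs_inf as q = (\<Prod>a\<leftarrow>as. qpoch_inf a q)"

definition qtheta :: "complex \<Rightarrow> complex \<Rightarrow> complex" where
  "qtheta x q = qpochs_inf [x, q / x] q"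

definition qthetas :: "complex list \<Rightarrow> complex \<Rightarrow> complex" where
  "qthetas xs q = (\<Prod>x\<leftarrow>xs. qtheta x q)"

text \<open>The basic hypergeometric series with upper parameters \<open>as\<close> and lower parameters \<open>bs\<close>,
  where \<open>length as = length bs + 1\<close>. The factor \<open>(q;q)\<^sub>k\<close> of the denominator is supplied here
  and is not listed in \<open>bs\<close>.\<close>
definition qhyp :: "complex list \<Rightarrow> complex list \<Rightarrow> complex \<Rightarrow> complex \<Rightarrow> complex" where
  "qhyp as bs q z = (\<Sum>k. qpochs as q k / qpochs (q # bs) q k * z ^ k)"

definition qhyp_lower_ok :: "complex list \<Rightarrow> complex \<Rightarrow> bool" where
  "qhyp_lower_ok bs q \<longleftrightarrow> (\<forall>b\<in>set bs. \<forall>k::nat. b \<noteq> q powi (- int k))"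

text \<open>The choice of square root is immaterial, since both roots occur in each parameter list.\<close>
definition W87_lower ::
  "complex \<Rightarrow> complex \<Rightarrow> complex \<Rightarrow> complex \<Rightarrow> complex \<Rightarrow> complex \<Rightarrow> complex \<Rightarrow> complex list" where
  "W87_lower a b c d e f q =
     [csqrt a, - csqrt a, q * a / b, q * a / c, q * a / d, q * a / e, q * a / f]"

definition W87 ::
  "complex \<Rightarrow> complex \<Rightarrow> complex \<Rightarrow> complex \<Rightarrow> complex \<Rightarrow> complex \<Rightarrow> complex \<Rightarrow> complex \<Rightarrow> complex" where
  "W87 a b c d e f q z =
     qhyp [a, q * csqrt a, - (q * csqrt a), b, c, d, e, f] (W87_lower a b c d e f q) q z"

text \<open>The term \<open>F(d;e,f)\<close>, with the parameters \<open>n, q, a, b, c\<close> made explicit.\<close>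
definition F_term ::
  "int \<Rightarrow> complex \<Rightarrow> complex \<Rightarrow> complex \<Rightarrow> complex \<Rightarrow> complex \<Rightarrow> complex \<Rightarrow> complex \<Rightarrow> complex" where
  "F_term n q a b c d e f =
     qthetas [q powi (n - 1) * b * c * d / a, q powi (n - 2) * b * c * e * f / a ^ 2] q
     * qpochs_inf [q * a / (b * d), q * a / (c * d), q * a / (d * e), q * a / (d * f), e, f] q
     / qpochs_inf [q * a / (b * c * d), e / d, f / d] q
     * qhyp [q * a / (e * f), b * d / a, c * d / a, d] [b * c * d / a, q * d / e, q * d / f] q q"

text \<open>No vanishing denominator factors in \<open>F(d;e,f)\<close>.\<close>
definition F_denom_ok ::
  "complex \<Rightarrow> complex \<Rightarrow> complex \<Rightarrow> complex \<Rightarrow> complex \<Rightarrow> complex \<Rightarrow> complex \<Rightarrow> bool" where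
  "F_denom_ok q a b c d e f \<longleftrightarrow>
     (\<forall>x\<in>set [q * a / (b * c * d), e / d, f / d]. qpoch_inf x q \<noteq> 0) \<and>
     qhyp_lower_ok [b * c * d / a, q * d / e, q * d / f] q"

end

theory Submission
  imports Defs "HOL-Computational_Algebra.Polynomial"
begin

text \<open>
Write \<open>(x)\<close> for \<open>(x;q)\<^sub>\<infinity>\<close> and put \<open>v = qa/(def)\<close>, \<open>\<kappa> = bc/a\<close>, \<open>y = \<kappa>/v\<close>. By the
quasi-periodicity of theta functions both sides are independent of \<open>n\<close> (lemma
\<open>qtheta_pair_shift\<close>), so let \<open>n = 1\<close>; then the denominator is \<open>\<theta>(\<kappa>) \<theta>(y)\<close>. The identity says
that two families of residues of one function balance. Let

  \<open>G(x) = (qax/b) (qax/c) (yx) (\<kappa>/x) (q/(yx)) / ((dx) (ex) (fx) (1/x) (v/x))\<close>.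

Its poles are the points \<open>q\<^sup>m\<close> and \<open>v q\<^sup>m\<close>, which tend to \<open>0\<close>, and the points \<open>q\<^sup>-\<^sup>m/d\<close>,
\<open>q\<^sup>-\<^sup>m/e\<close>, \<open>q\<^sup>-\<^sup>m/f\<close>, which tend to infinity. The sum of all residues of \<open>G(x) dx/x\<close> vanishes
(\<open>residue_series_balance\<close>): truncating every infinite product after \<open>N\<close> factors gives a rational
function with residues of size \<open>|q|\<^sup>N\<close> at \<open>0\<close> and infinity, for which the residue sum is
Lagrange interpolation, and Tannery's theorem justifies the limit \<open>N \<rightarrow> \<infinity>\<close>.

The residues at \<open>q\<^sup>-\<^sup>m/d\<close> form the series in \<open>F(d;e,f)\<close>, and likewise for \<open>e\<close> and \<open>f\<close>. The
residues at \<open>q\<^sup>m\<close> and \<open>v q\<^sup>m\<close> have the common factor \<open>\<theta>(\<kappa>) \<theta>(y) / \<theta>(v)\<close>, and what remains is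
Jackson's \<open>q\<close>-integral between \<open>v\<close> and \<open>1\<close> of the weight

  \<open>w(x) = (qx) (qx/v) (qax/b) (qax/c) / ((dx) (ex) (fx) (qax/(bc)))\<close>.

This \<open>q\<close>-integral is a multiple of the very-well-poised series (\<open>nonterminating_Watson\<close>).
Indeed, the quotient \<open>(qax/b) (qax/c) / (qax/(bc))\<close> is, as a function of \<open>x\<close>, the sum of a
very-well-poised \<open>\<^sub>6W\<^sub>5\<close> series (\<open>nonterminating_6W5\<close>). After interchanging summation and
integration each term is a \<open>q\<close>-integral that the nonterminating \<open>q\<close>-Saalschuetz formula
(\<open>nonterminating_q_Saalschuetz\<close>) evaluates as a product, and the products are exactly the terms
of the \<open>\<^sub>8W\<^sub>7\<close> series. On the points \<open>v q\<^sup>m\<close> the interchange requires \<open>|q\<^sup>2 a\<^sup>2| < |bcdef|\<close>,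
which is the convergence condition of the \<open>\<^sub>8W\<^sub>7\<close> series.

Both summation formulas have the same proof: a telescoping sum gives a first-order recurrence in
one parameter, and iterating the recurrence moves this parameter to \<open>0\<close>.

For special values of the parameters, such as \<open>d = q\<^sup>-\<^sup>m\<close> or \<open>v = q\<^sup>m\<close>, poles coincide. To
include them, \<open>d\<close>, \<open>e\<close>, \<open>f\<close> are multiplied by a real number \<open>s > 1\<close>; for \<open>s\<close> close to \<open>1\<close> the
poles are in general position, and both sides are continuous as \<open>s\<close> tends to \<open>1\<close>.
\<close>

section \<open>Series and sums of products\<close>

text \<open>Tannery's theorem in the form in which the domination holds for all indices at once.\<close>
lemma tannery:
  fixes a :: "nat \<Rightarrow> 'b \<Rightarrow> complex"
  assumes "\<And>k. (a k \<longlongrightarrow> b k) F" "eventually (\<lambda>n. \<forall>k. norm (a k n) \<le> M k) F"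
    and "summable M" "F \<noteq> bot"
  shows "((\<lambda>n. \<Sum>k. a k n) \<longlongrightarrow> (\<Sum>k. b k)) F"
proof -
  have "eventually (\<lambda>(k, n). norm (a k n) \<le> M k) (at_top \<times>\<^sub>F F)"
    unfolding eventually_prod_filter using assms(2)
    by (intro exI[of _ "\<lambda>_. True"] exI[of _ "\<lambda>n. \<forall>k. norm (a k n) \<le> M k"]) auto
  from tannerys_theorem[OF assms(1) this assms(3,4)] show ?thesis by blast
qed

text \<open>A double series dominated by a product of two convergent series. The interchange is
  Tannery's theorem for the partial sums over the second index.\<close>
lemma suminf_swap_dominated:
  fixes f :: "nat \<Rightarrow> nat \<Rightarrow> complex"
  assumes bound: "\<And>m k. norm (f m k) \<le> u m * v k" and "summable u" "summable v"
    and nonneg: "\<And>m. 0 \<le> u m" "\<And>k. 0 \<le> v k"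
  shows "(\<Sum>m. \<Sum>k. f m k) = (\<Sum>k. \<Sum>m. f m k)"
    and "summable (\<lambda>m. \<Sum>k. f m k)" and "summable (\<lambda>k. \<Sum>m. f m k)"
proof -
  have row: "summable (\<lambda>k. norm (f m k))" for m
    by (rule summable_comparison_test'[OF summable_mult[OF assms(3), of "u m"]]) (simp add: bound)
  have col: "summable (\<lambda>m. norm (f m k))" for k
    by (rule summable_comparison_test'[OF summable_mult2[OF assms(2), of "v k"]]) (simp add: bound)
  have nrow: "norm (\<Sum>k. f m k) \<le> u m * suminf v" for m
  proof -
    have "norm (\<Sum>k. f m k) \<le> (\<Sum>k. norm (f m k))" by (rule summable_norm[OF row])
    also have "\<dots> \<le> (\<Sum>k. u m * v k)"
      by (rule suminf_le[OF bound row]) (intro summable_mult assms)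
    finally show ?thesis by (simp add: suminf_mult[OF assms(3)])
  qed
  have ncol: "norm (\<Sum>m. f m k) \<le> suminf u * v k" for k
  proof -
    have "norm (\<Sum>m. f m k) \<le> (\<Sum>m. norm (f m k))" by (rule summable_norm[OF col])
    also have "\<dots> \<le> (\<Sum>m. u m * v k)"
      by (rule suminf_le[OF bound col]) (intro summable_mult2 assms)
    finally show ?thesis by (simp add: suminf_mult2[OF assms(2)])
  qed
  show "summable (\<lambda>m. \<Sum>k. f m k)"
    by (rule summable_comparison_test'[OF summable_mult2[OF assms(2), of "suminf v"]]) (rule nrow)
  show sc: "summable (\<lambda>k. \<Sum>m. f m k)"
    by (rule summable_comparison_test'[OF summable_mult[OF assms(3), of "suminf u"]]) (rule ncol)
  have "(\<lambda>K. \<Sum>m. \<Sum>k<K. f m k) \<longlonglongrightarrow> (\<Sum>m. \<Sum>k. f m k)"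
  proof (rule tannery[where M = "\<lambda>m. u m * suminf v"])
    show "(\<lambda>K. \<Sum>k<K. f m k) \<longlonglongrightarrow> (\<Sum>k. f m k)" for m
      by (rule summable_LIMSEQ[OF summable_norm_cancel[OF row]])
    have "norm (\<Sum>k<K. f m k) \<le> u m * suminf v" for m K
    proof -
      have "norm (\<Sum>k<K. f m k) \<le> (\<Sum>k<K. u m * v k)" by (rule sum_norm_le) (rule bound)
      also have "\<dots> = u m * (\<Sum>k<K. v k)" by (simp add: sum_distrib_left)
      also have "\<dots> \<le> u m * suminf v"
        by (intro mult_left_mono sum_le_suminf assms) (auto simp: nonneg)
      finally show ?thesis .
    qed
    then show "\<forall>\<^sub>F K in sequentially. \<forall>m. norm (\<Sum>k<K. f m k) \<le> u m * suminf v" by simp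
  qed (auto intro: summable_mult2 assms)
  moreover have "(\<Sum>m. \<Sum>k<K. f m k) = (\<Sum>k<K. \<Sum>m. f m k)" for K
    by (rule suminf_sum) (rule summable_norm_cancel[OF col])
  ultimately have "(\<lambda>K. \<Sum>k<K. \<Sum>m. f m k) \<longlonglongrightarrow> (\<Sum>m. \<Sum>k. f m k)" by simp
  with summable_LIMSEQ[OF sc] show "(\<Sum>m. \<Sum>k. f m k) = (\<Sum>k. \<Sum>m. f m k)"
    using LIMSEQ_unique by blast
qed

lemma norm_mult_le: "norm x \<le> X \<Longrightarrow> norm y \<le> Y \<Longrightarrow> norm (x * y) \<le> X * Y" for x y :: complex
  unfolding norm_mult by (intro mult_mono) (auto intro: order.trans[OF norm_ge_zero])

lemma norm_prod_mono: "(\<And>i. i \<in> S \<Longrightarrow> norm (f i) \<le> g i) \<Longrightarrow> norm (\<Prod>i\<in>S. f i) \<le> (\<Prod>i\<in>S. g i)"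
  for f :: "'i \<Rightarrow> complex"
  unfolding prod_norm[symmetric] by (intro prod_mono) auto

section \<open>Lagrange interpolation and partial fractions\<close>

text \<open>The factors may be constant, so the product need not have degree \<open>card S\<close>; the coefficient
  is still the product of the linear coefficients.\<close>
lemma coeff_prod_linear:
  fixes u v :: "'i \<Rightarrow> complex"
  assumes "finite S"
  shows "degree (\<Prod>i\<in>S. [:u i, v i:]) \<le> card S \<and> coeff (\<Prod>i\<in>S. [:u i, v i:]) (card S) = (\<Prod>i\<in>S. v i)"
  using assms
proof induction
  case (insert x S)
  let ?p = "\<Prod>i\<in>S. [:u i, v i:]"
  have "degree ([:u x, v x:] * ?p) \<le> 1 + card S"
    using insert.IH by (intro order.trans[OF degree_mult_le] add_mono) auto
  moreover have "coeff ([:u x, v x:] * ?p) (Suc (card S)) = v x * (\<Prod>i\<in>S. v i)"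
    using insert.IH by (simp add: coeff_eq_0)
  ultimately show ?case using insert.hyps by simp
qed simp

text \<open>The Lagrange interpolation formula, compared in the coefficient of degree \<open>card S - 1\<close>.\<close>
lemma lagrange_top_coefficient:
  fixes p :: "complex poly"
  assumes fin: "finite S" and deg: "degree p < card S"
  shows "(\<Sum>x\<in>S. poly p x / (\<Prod>y\<in>S - {x}. x - y)) = coeff p (card S - 1)"
proof -
  define L where "L x = (\<Prod>y\<in>S - {x}. [:- y, 1:])" for x
  define r where "r = (\<Sum>x\<in>S. smult (poly p x / (\<Prod>y\<in>S - {x}. x - y)) (L x))"
  have L: "degree (L x) \<le> card S - 1 \<and> coeff (L x) (card S - 1) = 1" if "x \<in> S" for x
    using coeff_prod_linear[of "S - {x}" uminus "\<lambda>_. 1"] fin that by (simp add: L_def)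
  have "poly r z = poly p z" if z: "z \<in> S" for z
  proof -
    have L0: "poly (L x) z = (if x = z then (\<Prod>y\<in>S - {z}. z - y) else 0)" if "x \<in> S" for x
      using fin z by (auto simp: L_def poly_prod prod_zero_iff)
    have "poly r z = (\<Sum>x\<in>S. poly p x / (\<Prod>y\<in>S - {x}. x - y) * poly (L x) z)"
      by (simp add: r_def poly_sum)
    also have "\<dots> = (\<Sum>x\<in>S. if x = z then poly p z else 0)"
      using fin by (intro sum.cong) (auto simp: L0 prod_zero_iff)
    also have "\<dots> = poly p z" using fin z by simp
    finally show ?thesis .
  qed
  moreover have "degree r \<le> card S - 1"
    unfolding r_def using L by (intro degree_sum_le fin) (auto intro: order.trans[OF
        degree_smult_le])
  ultimately have "r = p" using deg by (intro poly_eqI_degree[of S]) auto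
  then have "coeff p (card S - 1) = coeff r (card S - 1)" by simp
  also have "\<dots> = (\<Sum>x\<in>S. poly p x / (\<Prod>y\<in>S - {x}. x - y))"
    unfolding r_def coeff_sum using L by (intro sum.cong) auto
  finally show ?thesis ..
qed

text \<open>The sum of the residues of \<open>p(x) / (x \<Prod>\<^sub>i (\<alpha>\<^sub>i + \<beta>\<^sub>i x))\<close> at the zeros of the linear
  factors, in terms of the residues at infinity and at \<open>0\<close>. It is Lagrange interpolation with
  \<open>0\<close> as an additional node. Keeping the factors in the form \<open>\<alpha>\<^sub>i + \<beta>\<^sub>i x\<close> lets \<open>x - D q\<^sup>k\<close> and
  \<open>1 - C q\<^sup>k x\<close> be treated alike.\<close>
lemma residue_sum_linear_factors:
  fixes \<alpha> \<beta> :: "'i \<Rightarrow> complex"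
  assumes fin: "finite K" and nz: "\<And>i. i \<in> K \<Longrightarrow> \<alpha> i \<noteq> 0 \<and> \<beta> i \<noteq> 0"
    and distinct: "\<And>i j. i \<in> K \<Longrightarrow> j \<in> K \<Longrightarrow> i \<noteq> j \<Longrightarrow> \<alpha> i / \<beta> i \<noteq> \<alpha> j / \<beta> j"
    and deg: "degree p \<le> card K"
  defines "s \<equiv> \<lambda>i. - (\<alpha> i / \<beta> i)"
  shows "(\<Sum>i\<in>K. poly p (s i) / (s i * \<beta> i * (\<Prod>j\<in>K - {i}. \<alpha> j + \<beta> j * s i)))
    = coeff p (card K) / (\<Prod>i\<in>K. \<beta> i) - poly p 0 / (\<Prod>i\<in>K. \<alpha> i)"
proof -
  have inj: "inj_on s K" using distinct by (auto simp: inj_on_def s_def)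
  have s0: "0 \<notin> s ` K" using nz by (auto simp: s_def)
  have card: "card (insert 0 (s ` K)) = Suc (card K)"
    using fin s0 inj by (simp add: card_image)
  have B0: "(\<Prod>i\<in>K. \<beta> i) \<noteq> 0" using nz fin by simp
  have summand: "poly p (s i) / (\<Prod>y\<in>insert 0 (s ` K) - {s i}. s i - y)
     = (\<Prod>i\<in>K. \<beta> i) * (poly p (s i) / (s i * \<beta> i
         * (\<Prod>j\<in>K - {i}. \<alpha> j + \<beta> j * s i)))" if i: "i \<in> K" for i
  proof -
    have e: "insert 0 (s ` K) - {s i} = insert 0 (s ` (K - {i}))"
      using i s0 inj by (auto simp: inj_on_def)
    have "(\<Prod>y\<in>insert 0 (s ` K) - {s i}. s i - y) = s i * (\<Prod>y\<in>s ` (K - {i}). s i - y)"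
      unfolding e using fin s0 by (subst prod.insert) auto
    also have "(\<Prod>y\<in>s ` (K - {i}). s i - y) = (\<Prod>j\<in>K - {i}. s i - s j)"
      by (rule prod.reindex_cong[OF inj_on_subset[OF inj]]) auto
    also have "\<dots> = (\<Prod>j\<in>K - {i}. (\<alpha> j + \<beta> j * s i) / \<beta> j)"
      using nz by (intro prod.cong) (auto simp: s_def field_simps)
    also have "\<dots> = (\<Prod>j\<in>K - {i}. \<alpha> j + \<beta> j * s i) / (\<Prod>j\<in>K - {i}. \<beta> j)" by (rule prod_dividef)
    finally show ?thesis
      using prod.remove[OF fin i, of \<beta>] nz[OF i] by simp
  qed
  have zero: "(\<Prod>y\<in>insert 0 (s ` K) - {0}. 0 - y) = (\<Prod>i\<in>K. \<alpha> i) / (\<Prod>i\<in>K. \<beta> i)"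
  proof -
    have "(\<Prod>y\<in>insert 0 (s ` K) - {0}. 0 - y) = (\<Prod>y\<in>s ` K. - y)" using s0 by simp
    also have "\<dots> = (\<Prod>i\<in>K. \<alpha> i / \<beta> i)"
      by (rule prod.reindex_cong[OF inj]) (auto simp: s_def)
    finally show ?thesis by (simp add: prod_dividef)
  qed
  have "(\<Sum>x\<in>insert 0 (s ` K). poly p x / (\<Prod>y\<in>insert 0 (s ` K) - {x}. x - y)) = coeff p (card K)"
    using lagrange_top_coefficient[of "insert 0 (s ` K)" p] fin deg card by simp
  moreover have "(\<Sum>x\<in>insert 0 (s ` K). poly p x / (\<Prod>y\<in>insert 0 (s ` K) - {x}. x - y))
     = poly p 0 / ((\<Prod>i\<in>K. \<alpha> i) / (\<Prod>i\<in>K. \<beta> i))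
      + (\<Sum>x\<in>s ` K. poly p x / (\<Prod>y\<in>insert 0 (s ` K) - {x}. x - y))"
    using fin s0 by (subst sum.insert) (simp_all only: finite_imageI zero not_False_eq_True)
  moreover have "(\<Sum>x\<in>s ` K. poly p x / (\<Prod>y\<in>insert 0 (s ` K) - {x}. x - y))
     = (\<Prod>i\<in>K. \<beta> i) * (\<Sum>i\<in>K. poly p (s i) / (s i * \<beta> i * (\<Prod>j\<in>K - {i}. \<alpha> j + \<beta> j * s i)))"
    unfolding sum_distrib_left by (rule sum.reindex_cong[OF inj]) (auto simp: summand)
  ultimately show ?thesis using B0 by (simp add: field_simps)
qed

section \<open>The \<open>q\<close>-shifted factorials\<close>

locale q_base =
  fixes q :: complex
  assumes q_nonzero [simp]: "q \<noteq> 0" and norm_q_less_1: "norm q < 1"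
begin

abbreviation P :: "complex \<Rightarrow> complex" where "P x \<equiv> qpoch_inf x q"
abbreviation pf :: "complex \<Rightarrow> nat \<Rightarrow> complex" where "pf x k \<equiv> qpoch x q k"

lemma qpoch_0 [simp]: "pf x 0 = 1"
  and qpoch_Suc: "pf x (Suc k) = pf x k * (1 - x * q ^ k)"
  by (simp_all add: qpoch_def)

lemma qpoch_of_0 [simp]: "pf 0 k = 1" by (simp add: qpoch_def)

lemma qpoch_add: "pf x (k + l) = pf x k * pf (x * q ^ k) l"
  by (induction l) (simp_all add: qpoch_Suc power_add mult_ac)

lemma qpoch_Suc_left: "pf x (Suc k) = (1 - x) * pf (x * q) k"
  using qpoch_add[of x 1 k] by (simp add: qpoch_Suc)

lemma tendsto_q_power: "(\<lambda>n. q ^ n) \<longlonglongrightarrow> 0"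
  using norm_q_less_1 by (simp add: LIMSEQ_power_zero)

lemma q_power_neq_1: "q ^ Suc n \<noteq> 1"
proof
  assume "q ^ Suc n = 1"
  then have "norm q ^ Suc n = 1" by (metis norm_power norm_one)
  moreover have "norm q ^ Suc n < 1"
    using norm_q_less_1 by (simp add: power_less_one_iff del: power_Suc)
  ultimately show False by simp
qed

lemma q_powers_inj: "q ^ i = q ^ j \<Longrightarrow> i = j"
proof (induction i j rule: linorder_wlog)
  case (le i j)
  have "q ^ i * q ^ (j - i) = q ^ j" using le(1) by (simp flip: power_add)
  also have "\<dots> = q ^ i * 1" using le(2) by simp
  finally have "q ^ (j - i) = 1" by simp
  then show ?case using le(1) q_power_neq_1 by (metis diff_is_0_eq le_antisym not0_implies_Suc)
qed auto

text \<open>Bounds \<open>|(x;q)\<^sub>k|\<close> for all \<open>k\<close>. Together with \<open>(x;q)\<^sub>\<infinity> = (x;q)\<^sub>k (x q\<^sup>k;q)\<^sub>\<infinity>\<close> it yields,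
  as soon as \<open>(x;q)\<^sub>\<infinity> \<noteq> 0\<close>, a bound for all reciprocals \<open>1/(x;q)\<^sub>k\<close> as well. Every domination
  below is built from these two.\<close>
definition pbound :: "complex \<Rightarrow> real" where
  "pbound x = exp (norm x / (1 - norm q))"

lemma pbound_ge_1: "pbound x \<ge> 1" using norm_q_less_1 by (simp add: pbound_def)

lemma pbound_mono: "norm x \<le> norm y \<Longrightarrow> pbound x \<le> pbound y"
  using norm_q_less_1 by (simp add: pbound_def divide_right_mono)

lemma prod_one_plus_power_le: "(\<Prod>j<k. 1 + norm x * norm q ^ j) \<le> pbound x"
proof -
  have "(\<Prod>j<k. 1 + norm x * norm q ^ j) \<le> exp (\<Sum>j<k. norm x * norm q ^ j)"
    by (rule prod_le_exp_sum) simp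
  also have "(\<Sum>j<k. norm x * norm q ^ j) \<le> (\<Sum>j. norm x * norm q ^ j)"
    using norm_q_less_1 by (intro sum_le_suminf summable_mult summable_geometric) auto
  also have "\<dots> = norm x / (1 - norm q)"
    using norm_q_less_1 by (simp add: suminf_mult suminf_geometric summable_geometric)
  finally show ?thesis by (simp add: pbound_def)
qed

lemma norm_qpoch_le: "norm (pf x k) \<le> pbound x"
proof -
  have "norm (pf x k) \<le> (\<Prod>j<k. 1 + norm x * norm q ^ j)"
    unfolding qpoch_def prod_norm[symmetric]
  proof (intro prod_mono conjI norm_ge_zero)
    fix j show "norm (1 - x * q ^ j) \<le> 1 + norm x * norm q ^ j"
      using norm_triangle_ineq4[of 1 "x * q ^ j"] by (simp add: norm_mult norm_power)
  qed
  also have "\<dots> \<le> pbound x" by (rule prod_one_plus_power_le)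
  finally show ?thesis .
qed

lemma summable_q_power: "summable (\<lambda>n. norm q ^ n)"
  using norm_q_less_1 by (simp add: summable_geometric)

lemma convergent_prod_qpoch: "convergent_prod (\<lambda>j. 1 - x * q ^ j)"
proof (rule abs_convergent_prod_imp_convergent_prod)
  have "summable (\<lambda>j. norm x * norm q ^ j)" by (intro summable_mult summable_q_power)
  then show "abs_convergent_prod (\<lambda>j. 1 - x * q ^ j)"
    by (simp add: abs_convergent_prod_conv_summable norm_mult norm_power)
qed

lemma qpoch_tendsto: "pf x \<longlonglongrightarrow> P x"
proof -
  have "(\<lambda>n. pf x (Suc n)) \<longlonglongrightarrow> P x"
    using convergent_prod_LIMSEQ[OF convergent_prod_qpoch[of x]]
    by (simp add: qpoch_def qpoch_inf_def lessThan_Suc_atMost)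
  then show ?thesis by (simp add: filterlim_sequentially_Suc)
qed

lemma norm_qpoch_inf_le: "norm (P x) \<le> pbound x"
  by (rule tendsto_upperbound[OF tendsto_norm[OF qpoch_tendsto]]) (auto simp: norm_qpoch_le)

lemma qpoch_inf_split: "P x = pf x k * P (x * q ^ k)"
proof -
  have "(\<lambda>n. pf x (k + n)) \<longlonglongrightarrow> P x"
    using LIMSEQ_ignore_initial_segment[OF qpoch_tendsto[of x], of k] by (simp add: add.commute)
  moreover have "(\<lambda>n. pf x (k + n)) \<longlonglongrightarrow> pf x k * P (x * q ^ k)"
    unfolding qpoch_add by (intro tendsto_mult tendsto_const qpoch_tendsto)
  ultimately show ?thesis by (rule LIMSEQ_unique)
qed

lemma qpoch_inf_rec: "P x = (1 - x) * P (x * q)"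
  using qpoch_inf_split[of x 1] by (simp add: qpoch_Suc)

lemma qpoch_inf_0 [simp]: "P 0 = 1"
  using qpoch_tendsto[of 0] by (simp add: LIMSEQ_const_iff)

lemma qpoch_inf_eq_0_iff: "P x = 0 \<longleftrightarrow> (\<exists>j. x * q ^ j = 1)"
proof
  assume "P x = 0"
  then have "(\<lambda>j. 1 - x * q ^ j) has_prod 0"
    using convergent_prod_has_prod[OF convergent_prod_qpoch[of x]] by (simp add: qpoch_inf_def)
  then show "\<exists>j. x * q ^ j = 1" by (auto simp: has_prod_0_iff)
next
  assume "\<exists>j. x * q ^ j = 1"
  then obtain j where "x * q ^ j = 1" by blast
  then show "P x = 0" using qpoch_inf_split[of x "Suc j"] by (simp add: qpoch_Suc)
qed

lemma qpoch_inf_small: "norm x < 1 \<Longrightarrow> P x \<noteq> 0"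
proof
  assume "norm x < 1" "P x = 0"
  then obtain j where j: "x * q ^ j = 1" by (auto simp: qpoch_inf_eq_0_iff)
  have "norm (x * q ^ j) \<le> norm x * 1"
    unfolding norm_mult norm_power using norm_q_less_1
    by (intro mult_left_mono power_le_one) auto
  with j \<open>norm x < 1\<close> show False by simp
qed

lemma qpoch_inf_shift_nonzero: "P x \<noteq> 0 \<Longrightarrow> P (x * q ^ k) \<noteq> 0"
  using qpoch_inf_split[of x k] by auto

lemma qpoch_nonzero: "P x \<noteq> 0 \<Longrightarrow> pf x k \<noteq> 0"
  using qpoch_inf_split[of x k] by auto

lemma qpoch_q_nonzero [simp]: "pf q k \<noteq> 0" "P q \<noteq> 0"
  using qpoch_nonzero[OF qpoch_inf_small[OF norm_q_less_1]] qpoch_inf_small[OF norm_q_less_1] by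
      auto

lemma norm_inverse_qpoch_le: "P x \<noteq> 0 \<Longrightarrow> norm (inverse (pf x k)) \<le> pbound x / norm (P x)"
proof -
  assume nz: "P x \<noteq> 0"
  then have "inverse (pf x k) = P (x * q ^ k) / P x"
    using qpoch_inf_split[of x k] by (simp add: field_simps)
  moreover have "norm (P (x * q ^ k)) \<le> pbound x"
    using norm_q_less_1
    by (intro order.trans[OF norm_qpoch_inf_le pbound_mono])
       (simp add: norm_mult norm_power mult_left_le power_le_one)
  ultimately show ?thesis by (simp add: norm_divide divide_right_mono)
qed

lemma pbound_shift: "pbound (x * q ^ k) \<le> pbound x"
  using norm_q_less_1 by (intro pbound_mono) (simp add: norm_mult norm_power mult_left_le
      power_le_one)

lemma norm_inverse_qpoch_inf_le:
  "P x \<noteq> 0 \<Longrightarrow> norm (inverse (P (x * q ^ k))) \<le> pbound x / norm (P x)"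
proof -
  assume nz: "P x \<noteq> 0"
  then have "inverse (P (x * q ^ k)) = pf x k / P x"
    using qpoch_inf_split[of x k] by (auto simp: field_simps)
  then show ?thesis using norm_qpoch_le[of x k] by (simp add: norm_divide divide_right_mono)
qed

text \<open>Since \<open>(x;q)\<^sub>n\<^sub>+\<^sub>1 - (x;q)\<^sub>n = - x q\<^sup>n (x;q)\<^sub>n\<close>, the infinite product is also a series,
  dominated by a geometric one; its continuity is therefore another instance of Tannery's theorem.\<close>
lemma qpoch_inf_series: "P x = 1 - (\<Sum>n. x * q ^ n * pf x n)"
proof -
  have "(\<lambda>n. pf x (Suc n) - pf x n) sums (P x - pf x 0)"
    by (rule telescope_sums[OF qpoch_tendsto])
  then have "(\<lambda>n. - (x * q ^ n * pf x n)) sums (P x - 1)" by (simp add: qpoch_Suc algebra_simps)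
  from sums_minus[OF this] show ?thesis by (simp add: sums_iff)
qed

lemma tendsto_qpoch [tendsto_intros]:
  "(g \<longlongrightarrow> x) F \<Longrightarrow> ((\<lambda>s. pf (g s) k) \<longlongrightarrow> pf x k) F"
  unfolding qpoch_def by (intro tendsto_intros)

lemma tendsto_qpoch_inf [tendsto_intros]:
  assumes "(g \<longlongrightarrow> x) F"
  shows "((\<lambda>s. P (g s)) \<longlongrightarrow> P x) F"
proof (cases "F = bot")
  case False
  define B where "B = norm x + 1"
  have ev: "eventually (\<lambda>s. norm (g s) < B) F"
    using order_tendstoD(2)[OF tendsto_norm[OF assms], of B] by (simp add: B_def)
  have "((\<lambda>s. \<Sum>n. g s * q ^ n * pf (g s) n) \<longlongrightarrow> (\<Sum>n. x * q ^ n * pf x n)) F"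
  proof (rule tannery[where M = "\<lambda>n. B * norm q ^ n * pbound (of_real B)"])
    show "((\<lambda>s. g s * q ^ n * pf (g s) n) \<longlongrightarrow> x * q ^ n * pf x n) F" for n
      by (intro tendsto_intros assms)
    show "\<forall>\<^sub>F s in F. \<forall>n. norm (g s * q ^ n * pf (g s) n) \<le> B * norm q ^ n * pbound (of_real B)"
      using ev
    proof eventually_elim
      case (elim s)
      have "norm (pf (g s) n) \<le> pbound (of_real B)" for n
        using elim by (intro order.trans[OF norm_qpoch_le pbound_mono]) (simp add: B_def)
      then show ?case using elim by (auto simp: norm_mult norm_power B_def intro!: mult_mono)
    qed
    show "summable (\<lambda>n. B * norm q ^ n * pbound (complex_of_real B))"
      by (intro summable_mult summable_mult2 summable_q_power)
  qed (rule False)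
  then show ?thesis unfolding qpoch_inf_series by (intro tendsto_intros)
qed simp

lemma qpoch_as_quotient: "P x \<noteq> 0 \<Longrightarrow> pf x m = P x / P (x * q ^ m)"
  using qpoch_inf_split[of x m] qpoch_inf_shift_nonzero[of x m] by (simp add: field_simps)

lemma qpoch_inf_tail: "P x \<noteq> 0 \<Longrightarrow> P (x * q ^ m) = P x / pf x m"
  using qpoch_inf_split[of x m] qpoch_nonzero[of x m] by (simp add: field_simps)

lemma norm_pow_q_le: "norm (x * q ^ k) \<le> norm x"
  using norm_q_less_1 by (simp add: norm_mult norm_power mult_left_le power_le_one)

lemma norm_qpoch_shift_le: "norm (P (x * q ^ k)) \<le> pbound x"
  using norm_qpoch_inf_le[of "x * q ^ k"] pbound_shift[of x k] by linarith

lemma norm_qpoch_of_shift_le: "norm (pf (x * q ^ m) N) \<le> pbound x"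
  using norm_qpoch_le[of "x * q ^ m" N] pbound_shift[of x m] by linarith

text \<open>Uniform in both indices, because \<open>(x q\<^sup>m;q)\<^sub>N\<close> is the quotient of \<open>(x;q)\<^sub>m\<^sub>+\<^sub>N\<close> by
  \<open>(x;q)\<^sub>m\<close>.\<close>
lemma norm_inverse_qpoch_shift_le:
  assumes "P x \<noteq> 0"
  shows "norm (inverse (pf (x * q ^ m) N)) \<le> pbound x * (pbound x / norm (P x))"
proof -
  have "inverse (pf (x * q ^ m) N) = pf x m * inverse (pf x (m + N))"
    using qpoch_nonzero[OF assms, of m] by (simp add: qpoch_add)
  then show ?thesis by (simp only:) (intro norm_mult_le norm_qpoch_le norm_inverse_qpoch_le assms)
qed

lemma qpoch_times_q: "(1 - x) * pf (q * x) k = pf x k * (1 - x * q ^ k)"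
  using qpoch_Suc[of x k] qpoch_Suc_left[of x k] by (simp add: mult.commute)

lemma qhyp_lower_ok_iff: "qhyp_lower_ok bs q \<longleftrightarrow> (\<forall>x\<in>set bs. P x \<noteq> 0)"
proof -
  have "(x = q powi (- int k)) \<longleftrightarrow> x * q ^ k = 1" for x k
    by (simp add: power_int_minus field_simps)
  then show ?thesis unfolding qhyp_lower_ok_def qpoch_inf_eq_0_iff by auto
qed

section \<open>The nonterminating very-well-poised sum\<close>

text \<open>For \<open>x \<noteq> 0\<close> this is \<open>x\<^sup>k (1/x;q)\<^sub>k\<close>; as a polynomial in \<open>x\<close> it vanishes at the nodes \<open>q\<^sup>m\<close>
  with \<open>m < k\<close>.\<close>
definition node_prod :: "complex \<Rightarrow> nat \<Rightarrow> complex" where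
  "node_prod x k = (\<Prod>j<k. x - q ^ j)"

lemma node_prod_0 [simp]: "node_prod x 0 = 1" and node_prod_Suc: "node_prod x (Suc k)
    = node_prod x k * (x - q ^ k)"
  by (simp_all add: node_prod_def)

text \<open>The terms of the \<open>\<^sub>6W\<^sub>5\<close> series with parameters \<open>a; b, c, 1/x\<close> and argument \<open>qax/(bc)\<close>,
  multiplied by \<open>(1 - a) (qa/b, qa/c, qax;q)\<^sub>\<infinity>\<close>. With this normalization the terms are entire in
  \<open>x\<close>, and \<open>q\<close> is the only lower parameter left in a denominator.\<close>
definition W65_term :: "complex \<Rightarrow> complex \<Rightarrow> complex \<Rightarrow> complex \<Rightarrow> nat \<Rightarrow> complex" where
  "W65_term a b c x k = pf a k * (1 - a * q ^ (2 * k)) / pf q k * pf b k * pf c k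
     * P (a / b * q ^ Suc k) * P (a / c * q ^ Suc k) * P (a * x * q ^ Suc k)
     * (node_prod x k * (a * q / (b * c)) ^ k)"

definition W65_bound :: "complex \<Rightarrow> complex \<Rightarrow> complex \<Rightarrow> complex \<Rightarrow> real" where
  "W65_bound a b c x = pbound a * (1 + norm a) * (pbound q / norm (P q)) * pbound b * pbound c
     * pbound (a / b) * pbound (a / c) * pbound (a * x)"

lemma W65_argument_shift:
  "node_prod x k * (a * q ^ N * q / (b * c)) ^ k = node_prod x k * (a * q / (b * c)) ^ k
      * q ^ (N * k)"
proof -
  have "a * q ^ N * q / (b * c) = (a * q / (b * c)) * q ^ N" by simp
  then show ?thesis by (simp add: power_mult_distrib power_mult del: times_divide_eq_left)
qed

text \<open>Uniform in \<open>N\<close>: this is the domination for the limit \<open>a q\<^sup>N \<rightarrow> 0\<close>.\<close>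
lemma norm_W65_le:
  "norm (W65_term (a * q ^ N) b c x k) \<le> W65_bound a b c x
      * norm (node_prod x k * (a * q / (b * c)) ^ k)"
proof -
  have 1: "norm (pf (a * q ^ N) k) \<le> pbound a"
    using norm_qpoch_le[of "a * q ^ N" k] pbound_shift[of a N] by linarith
  have 2: "norm (1 - a * q ^ N * q ^ (2 * k)) \<le> 1 + norm a"
    using norm_triangle_ineq4[of 1 "a * q ^ (N + 2 * k)"] norm_pow_q_le[of a "N + 2 * k"]
    by (simp add: power_add mult.assoc)
  have 3: "norm (P (a * q ^ N / b * q ^ Suc k)) \<le> pbound (a / b)" for b
    using norm_qpoch_shift_le[of "a / b" "N + Suc k"] by (simp add: power_add mult_ac)
  have 4: "norm (P (a * q ^ N * x * q ^ Suc k)) \<le> pbound (a * x)"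
    using norm_qpoch_shift_le[of "a * x" "N + Suc k"] by (simp add: power_add mult_ac)
  have 5: "norm (1 / pf q k) \<le> pbound q / norm (P q)"
    using norm_inverse_qpoch_le[of q k] by (simp add: divide_inverse)
  have 6: "norm (node_prod x k * (a * q ^ N * q / (b * c)) ^ k)
      \<le> norm (node_prod x k * (a * q / (b * c)) ^ k)"
    unfolding W65_argument_shift by (rule norm_pow_q_le)
  have e: "W65_term (a * q ^ N) b c x k = pf (a * q ^ N) k * (1 - a * q ^ N * q ^ (2 * k))
      * (1 / pf q k)
      * pf b k * pf c k
     * P (a * q ^ N / b * q ^ Suc k) * P (a * q ^ N / c * q ^ Suc k) * P (a * q ^ N * x * q ^ Suc k)
     * (node_prod x k * (a * q ^ N * q / (b * c)) ^ k)"
    by (simp add: W65_term_def)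
  show ?thesis
    unfolding e W65_bound_def by (intro norm_mult_le 1 2 3 4 5 6 norm_qpoch_le)
qed

lemma summable_W65:
  assumes "summable (\<lambda>k. norm (node_prod x k * (a * q / (b * c)) ^ k))"
  shows "summable (W65_term a b c x)"
  using norm_W65_le[of a 0 b c x]
  by (intro summable_comparison_test'[OF summable_mult[OF assms, of "W65_bound a b c x"]]) simp

text \<open>The polynomial identity behind the telescoping sum, with \<open>u = q\<^sup>k\<close>, \<open>B = 1/b\<close>, \<open>C = 1/c\<close>.
  The last factors on the right, linear in \<open>u\<close>, are determined by the constant and the leading
  coefficient in \<open>u\<close>.\<close>
lemma W65_certificate:
  fixes a B C x u A :: complex
  assumes "A = a * q * B * C * x"
  shows "(1 - A) * (1 - a * u\<^sup>2) * (1 - a * B * (q * u)) * (1 - a * C * (q * u))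
      * (1 - a * x * (q * u))
     - (1 - a * q * B * C) * (1 - a * q * x * B) * (1 - a * q * x * C) * (1 - a * u)
         * (1 - a * q * u\<^sup>2) * u
    = (1 - a * u) * (B - u) * (C - u) * (x - u) * (a * q) * (-1 + a * A * (q * u))
      - (1 - u) * (1 - a * B * (q * u)) * (1 - a * C * (q * u)) * (1 - a * x * (q * u))
          * (-1 + a * A * u)"
  unfolding assms by (simp add: algebra_simps power2_eq_square)

text \<open>The recurrence \<open>a \<mapsto> aq\<close>. The difference of the two weighted terms is \<open>G (k + 1) - G k\<close>,
  where \<open>G 0 = 0\<close> because of the factor \<open>1 - q\<^sup>k\<close> and \<open>G k\<close> tends to \<open>0\<close> with the terms.\<close>
lemma W65_step:
  assumes [simp]: "b \<noteq> 0" "c \<noteq> 0"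
    and summ: "summable (\<lambda>k. norm (node_prod x k * (a * q / (b * c)) ^ k))"
  shows "(1 - a * q * x / (b * c)) * (\<Sum>k. W65_term a b c x k)
    = (1 - a) * (1 - a * q / (b * c)) * (1 - a * q * x / b) * (1 - a * q * x / c)
        * (\<Sum>k. W65_term (a * q) b c x k)"
proof -
  define A where "A = a * q * x / (b * c)"
  define G where "G k = pf a k * pf b k * pf c k / pf q k * (1 - q ^ k)
     * P (a / b * q ^ Suc k) * P (a / c * q ^ Suc k) * P (a * x * q ^ Suc k)
     * (node_prod x k * (a * q / (b * c)) ^ k) * (-1 + a * A * q ^ k)" for k
  define K where "K = (1 - a * q / (b * c)) * (1 - a * q * x / b) * (1 - a * q * x / c)"
  have tele: "(1 - A) * W65_term a b c x k - (1 - a) * K * W65_term (a * q) b c x k = G (Suc k)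
      - G k" for k
  proof -
    define u where "u = q ^ k"
    define Z where "Z = pf a k * pf b k * pf c k / pf q k * (node_prod x k * (a * q / (b * c)) ^ k)
      * P (a / b * (q * q * u)) * P (a / c * (q * q * u)) * P (a * x * (q * q * u))"
    define B where "B = 1 / b" define C where "C = 1 / c"
    have nz: "1 - q * u \<noteq> 0" using q_power_neq_1[of k] by (simp add: u_def)
    have P: "P (y * (q * u)) = (1 - y * (q * u)) * P (y * (q * q * u))" for y
      using qpoch_inf_rec[of "y * (q * u)"] by (simp add: mult_ac)
    have a1: "(1 - a) * pf (a * q) k = pf a k * (1 - a * u)"
      using qpoch_Suc[of a k] qpoch_Suc_left[of a k] by (simp add: u_def)
    have t1: "W65_term a b c x k = Z * ((1 - a * u\<^sup>2) * (1 - a * B * (q * u))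
        * (1 - a * C * (q * u))
        * (1 - a * x * (q * u)))"
      unfolding W65_term_def Z_def power_Suc u_def[symmetric] P
      by (simp add: B_def C_def u_def power_mult[symmetric] mult_ac)
    have "(1 - a) * W65_term (a * q) b c x k
        = ((1 - a) * pf (a * q) k) * (1 - a * q * u\<^sup>2) / pf q k * pf b k * pf c k
     * P (a / b * (q * q * u)) * P (a / c * (q * q * u)) * P (a * x * (q * q * u))
     * (node_prod x k * ((a * q / (b * c)) ^ k * u))"
      unfolding W65_term_def by (simp add: u_def power_mult[symmetric] power_divide
          power_mult_distrib mult_ac)
    then have t2: "(1 - a) * W65_term (a * q) b c x k = Z * ((1 - a * u) * (1 - a * q * u\<^sup>2) * u)"
      unfolding a1 Z_def by (simp add: mult_ac)
    have g1: "G k = Z * ((1 - u) * (1 - a * B * (q * u)) * (1 - a * C * (q * u))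
        * (1 - a * x * (q * u)) * (-1 + a * A * u))"
      unfolding G_def Z_def power_Suc u_def[symmetric] P by (simp add: B_def C_def mult_ac)
    have "G (Suc k) = pf a k * (1 - a * u) * (pf b k * (1 - b * u)) * (pf c k * (1 - c * u))
        / (pf q k * (1 - q * u)) * (1 - q * u)
     * P (a / b * (q * q * u)) * P (a / c * (q * q * u)) * P (a * x * (q * q * u))
     * (node_prod x k * (x - u) * ((a * q / (b * c)) ^ k * (a * q * B * C)))
         * (-1 + a * A * (q * u))"
      unfolding G_def qpoch_Suc node_prod_Suc power_Suc u_def B_def C_def by (simp add: mult_ac)
    also have "\<dots> = Z * ((1 - a * u) * ((1 - b * u) * B) * ((1 - c * u) * C) * (x - u) * (a * q)
        * (-1 + a * A * (q * u)))"
      unfolding Z_def using nz by (simp add: mult_ac)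
    also have "(1 - b * u) * B = B - u" by (simp add: B_def field_simps)
    also have "(1 - c * u) * C = C - u" by (simp add: C_def field_simps)
    finally have g2: "G (Suc k) = Z * ((1 - a * u) * (B - u) * (C - u) * (x - u) * (a * q)
        * (-1 + a * A * (q * u)))" .
    have A: "A = a * q * B * C * x" by (simp add: A_def B_def C_def)
    have K: "K = (1 - a * q * B * C) * (1 - a * q * x * B) * (1 - a * q * x * C)"
      by (simp add: K_def B_def C_def)
    have "(1 - A) * W65_term a b c x k - (1 - a) * K * W65_term (a * q) b c x k
        = (1 - A) * W65_term a b c x k - K * ((1 - a)
            * W65_term (a * q) b c x k)" by (simp add: mult_ac)
    also have "\<dots> = Z * ((1 - A) * (1 - a * u\<^sup>2) * (1 - a * B * (q * u)) * (1 - a * C * (q * u))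
           * (1 - a * x * (q * u))
       - (1 - a * q * B * C) * (1 - a * q * x * B) * (1 - a * q * x * C) * (1 - a * u)
         * (1 - a * q * u\<^sup>2) * u)"
      unfolding t1 t2 K by (simp add: algebra_simps)
    also have "\<dots> = G (Suc k) - G k"
      unfolding W65_certificate[OF A] g1 g2 by (simp add: algebra_simps)
    finally show ?thesis .
  qed
  have "G \<longlonglongrightarrow> 0"
  proof (rule Lim_null_comparison)
    define c0 where "c0 = 2 * (1 + norm (a * A)) * W65_bound a b c x"
    have "norm (G k) \<le> c0 * norm (node_prod x k * (a * q / (b * c)) ^ k)" for k
    proof -
      have 3: "norm (P (y * q ^ Suc k)) \<le> pbound y" for y by (rule norm_qpoch_shift_le)
      have 5: "norm (1 / pf q k) \<le> pbound q / norm (P q)"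
        using norm_inverse_qpoch_le[of q k] by (simp add: divide_inverse)
      have 6: "norm (1 - q ^ k) \<le> 2"
        using norm_triangle_ineq4[of 1 "q ^ k"] norm_pow_q_le[of 1 k] by simp
      have 7: "norm (- 1 + a * A * q ^ k) \<le> 1 + norm (a * A)"
        using norm_triangle_ineq[of "-1" "a * A * q ^ k"] norm_pow_q_le[of "a * A" k] by simp
      have 8: "norm (1::complex) \<le> 1 + norm a" by simp
      have e: "G k = (1 - q ^ k) * (-1 + a * A * q ^ k)
          * (pf a k * 1 * (1 / pf q k) * pf b k * pf c k 
       * P (a / b * q ^ Suc k) * P (a / c * q ^ Suc k) * P (a * x * q ^ Suc k))
        * (node_prod x k * (a * q / (b * c)) ^ k)"
        by (simp add: G_def)
      show ?thesis
        unfolding e c0_def W65_bound_def by (intro norm_mult_le 3 5 6 7 8 norm_qpoch_le order.refl)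
    qed
    then show "\<forall>\<^sub>F k in sequentially. norm (G k) \<le> c0
        * norm (node_prod x k * (a * q / (b * c)) ^ k)"
      by simp
    show "(\<lambda>k. c0 * norm (node_prod x k * (a * q / (b * c)) ^ k)) \<longlonglongrightarrow> 0"
      by (rule tendsto_mult_right_zero, rule summable_LIMSEQ_zero[OF summ])
  qed
  from telescope_sums[OF this]
  have "(\<lambda>k. (1 - A) * W65_term a b c x k - (1 - a) * K * W65_term (a * q) b c x k) sums (0 - G 0)"
    unfolding tele .
  moreover have "G 0 = 0" by (simp add: G_def)
  moreover have s1: "summable (W65_term a b c x)" by (rule summable_W65[OF summ])
  moreover have s2: "summable (W65_term (a * q) b c x)"
    using norm_W65_le[of a 1 b c x]
    by (intro summable_comparison_test'[OF summable_mult[OF summ, of "W65_bound a b c x"]]) simp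
  moreover have "(\<lambda>k. (1 - A) * W65_term a b c x k - (1 - a) * K * W65_term (a * q) b c x k) sums
     ((1 - A) * (\<Sum>k. W65_term a b c x k) - (1 - a) * K * (\<Sum>k. W65_term (a * q) b c x k))"
    by (intro sums_diff sums_mult summable_sums s1 s2)
  ultimately have "(1 - A) * (\<Sum>k. W65_term a b c x k) - (1 - a) * K
      * (\<Sum>k. W65_term (a * q) b c x k) = 0"
    using sums_unique2 by fastforce
  then show ?thesis by (simp add: A_def K_def mult.assoc)
qed

text \<open>Iterating the recurrence replaces \<open>a\<close> by \<open>a q\<^sup>N\<close>, and in the limit only the term \<open>k = 0\<close>
  of the series survives. The hypothesis is absolute convergence, not a bound on the argument,
  so the formula also covers \<open>x = q\<^sup>m\<close>, where the series terminates.\<close>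
theorem nonterminating_6W5:
  assumes [simp]: "b \<noteq> 0" "c \<noteq> 0"
    and summ: "summable (\<lambda>k. norm (node_prod x k * (a * q / (b * c)) ^ k))"
  shows "P (a * q * x / (b * c)) * (\<Sum>k. W65_term a b c x k)
    = P a * P (a * q / (b * c)) * P (a * q * x / b) * P (a * q * x / c)"
proof -
  have summN: "summable (\<lambda>k. norm (node_prod x k * (a * q ^ N * q / (b * c)) ^ k))" for N
    unfolding W65_argument_shift
    by (rule summable_comparison_test'[OF summ]) (use norm_pow_q_le in auto)
  have iter: "pf (a * q * x / (b * c)) N * (\<Sum>k. W65_term a b c x k)
    = pf a N * pf (a * q / (b * c)) N * pf (a * q * x / b) N * pf (a * q * x / c) N
       * (\<Sum>k. W65_term (a * q ^ N) b c x k)" for N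
  proof (induction N)
    case (Suc N)
    have "pf (a * q * x / (b * c)) (Suc N) * (\<Sum>k. W65_term a b c x k)
      = (1 - a * q ^ N * q * x / (b * c)) * (pf (a * q * x / (b * c)) N * (\<Sum>k. W65_term a b c x k))"
      by (simp add: qpoch_Suc mult_ac)
    also have "\<dots> = pf a N * pf (a * q / (b * c)) N * pf (a * q * x / b) N * pf (a * q * x / c) N
       * ((1 - a * q ^ N * q * x / (b * c)) * (\<Sum>k. W65_term (a * q ^ N) b c x k))"
      unfolding Suc.IH by (simp add: mult_ac)
    also have "(1 - a * q ^ N * q * x / (b * c)) * (\<Sum>k. W65_term (a * q ^ N) b c x k)
      = (1 - a * q ^ N) * (1 - a * q ^ N * q / (b * c)) * (1 - a * q ^ N * q * x / b)
        * (1 - a * q ^ N * q * x / c) * (\<Sum>k. W65_term (a * q ^ N * q) b c x k)"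
      by (rule W65_step[OF _ _ summN]) simp_all
    finally show ?case by (simp add: qpoch_Suc mult_ac)
  qed simp
  \<comment> \<open>The factor \<open>(a q\<^sup>N)\<^sup>k\<close> removes all terms but the first, and the first one tends to \<open>1\<close>.\<close>
  have lim: "(\<lambda>N. \<Sum>k. W65_term (a * q ^ N) b c x k) \<longlonglongrightarrow> (\<Sum>k. if k = 0 then 1 else 0)"
  proof (rule tannery[where M = "\<lambda>k. W65_bound a b c x
      * norm (node_prod x k * (a * q / (b * c)) ^ k)"])
    have z: "(\<lambda>N. a * q ^ N) \<longlonglongrightarrow> 0" by (rule tendsto_mult_right_zero[OF tendsto_q_power])
    have lim: "(\<lambda>N. W65_term (a * q ^ N) b c x k) \<longlonglongrightarrow> pf 0 k * (1 - 0 * q ^ (2 * k)) / pf q k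
        * pf b k * pf c k
     * P (0 / b * q ^ Suc k) * P (0 / c * q ^ Suc k) * P (0 * x * q ^ Suc k)
     * (node_prod x k * (0 * q / (b * c)) ^ k)" for k
      unfolding W65_term_def by (intro tendsto_intros z) auto
    show "(\<lambda>N. W65_term (a * q ^ N) b c x k) \<longlonglongrightarrow> (if k = 0 then 1 else 0)" for k
      using lim[of k] by (cases "k = 0") (simp_all add: power_0_left)
  qed (auto intro: summable_mult summ always_eventually simp: norm_W65_le)
  have "(\<Sum>k. if k = 0 then 1 else 0 :: complex) = 1"
    using sums_single[of 0 "\<lambda>_. 1::complex"] by (simp add: sums_iff)
  with lim have "(\<lambda>N. \<Sum>k. W65_term (a * q ^ N) b c x k) \<longlonglongrightarrow> 1" by simp
  then have "(\<lambda>N. pf a N * pf (a * q / (b * c)) N * pf (a * q * x / b) N * pf (a * q * x / c) N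
       * (\<Sum>k. W65_term (a * q ^ N) b c x k))
    \<longlonglongrightarrow> P a * P (a * q / (b * c)) * P (a * q * x / b) * P (a * q * x / c) * 1"
    by (intro tendsto_mult qpoch_tendsto)
  moreover have "(\<lambda>N. pf (a * q * x / (b * c)) N * (\<Sum>k. W65_term a b c x k))
    \<longlonglongrightarrow> P (a * q * x / (b * c)) * (\<Sum>k. W65_term a b c x k)"
    by (intro tendsto_mult qpoch_tendsto tendsto_const)
  ultimately show ?thesis unfolding iter using LIMSEQ_unique by fastforce
qed

section \<open>The nonterminating balanced sum as a \<open>q\<close>-integral\<close>

text \<open>Jackson's \<open>q\<close>-integral of \<open>h\<close> from \<open>0\<close> to \<open>x\<close>, divided by \<open>1 - q\<close>.\<close>
definition q_integral :: "(complex \<Rightarrow> complex) \<Rightarrow> complex \<Rightarrow> complex" where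
  "q_integral h x = (\<Sum>m. x * q ^ m * h (x * q ^ m))"

definition saal :: "complex \<Rightarrow> complex \<Rightarrow> complex \<Rightarrow> complex \<Rightarrow> complex \<Rightarrow> complex \<Rightarrow> complex" where
  "saal \<alpha> \<beta> d e f x = P (q * x / \<alpha>) * P (q * x / \<beta>) * P (\<alpha> * \<beta> * d * e * f * x)
     / (P (d * x) * P (e * x) * P (f * x))"

definition saal_bound :: "complex \<Rightarrow> complex \<Rightarrow> complex \<Rightarrow> complex \<Rightarrow> complex \<Rightarrow> complex \<Rightarrow> real" where
  "saal_bound \<alpha> \<beta> d e f x = pbound (q * x / \<alpha>) * pbound (q * x / \<beta>) * pbound (\<alpha> * \<beta> * d * e * f * x)
     * (pbound (d * x) / norm (P (d * x))) * (pbound (e * x) / norm (P (e * x)))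
     * (pbound (f * x) / norm (P (f * x)))"

lemma norm_saal_le:
  assumes "P (d * x) \<noteq> 0" "P (e * x) \<noteq> 0" "P (f * x) \<noteq> 0"
  shows "norm (saal \<alpha> \<beta> (d * q ^ N) e f (x * q ^ m)) \<le> saal_bound \<alpha> \<beta> d e f x"
proof -
  have e: "saal \<alpha> \<beta> (d * q ^ N) e f (x * q ^ m)
    = P (q * x / \<alpha> * q ^ m) * P (q * x / \<beta> * q ^ m) * P (\<alpha> * \<beta> * d * e * f * x * q ^ (N + m))
     * inverse (P (d * x * q ^ (N + m))) * inverse (P (e * x * q ^ m))
         * inverse (P (f * x * q ^ m))"
    unfolding saal_def by (simp add: divide_inverse power_add mult_ac)
  show ?thesis unfolding e saal_bound_def
    by (intro norm_mult_le norm_qpoch_shift_le norm_inverse_qpoch_inf_le assms)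
qed

lemma summable_q_integral:
  assumes "\<And>m. norm (h (x * q ^ m)) \<le> C"
  shows "summable (\<lambda>m. x * q ^ m * h (x * q ^ m))"
proof (rule summable_comparison_test')
  show "summable (\<lambda>m. norm x * norm q ^ m * C)"
    by (intro summable_mult summable_mult2 summable_q_power)
  show "norm (x * q ^ m * h (x * q ^ m)) \<le> norm x * norm q ^ m * C" for m
    using assms[of m] by (simp add: norm_mult norm_power mult_left_mono)
qed

lemma summable_saal:
  assumes "P (d * x) \<noteq> 0" "P (e * x) \<noteq> 0" "P (f * x) \<noteq> 0"
  shows "summable (\<lambda>m. x * q ^ m * saal \<alpha> \<beta> d e f (x * q ^ m))"
  using norm_saal_le[OF assms, of \<alpha> \<beta> 0] by (intro summable_q_integral[where C
      = "saal_bound \<alpha> \<beta> d e f x"]) simp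

definition saal_integral :: "complex \<Rightarrow> complex \<Rightarrow> complex \<Rightarrow> complex \<Rightarrow> complex \<Rightarrow> complex" where
  "saal_integral \<alpha> \<beta> d e f = q_integral (saal \<alpha> \<beta> d e f) \<alpha> - q_integral (saal \<alpha> \<beta> d e f) \<beta>"

lemma saal_integral_commute:
  "saal_integral \<alpha> \<beta> e d f = saal_integral \<alpha> \<beta> d e f" "saal_integral \<alpha> \<beta> d f e
      = saal_integral \<alpha> \<beta> d e f"
  unfolding saal_integral_def q_integral_def saal_def by (simp_all only: mult_ac)

text \<open>Both sides vanish at \<open>x = 0\<close>, and the cubic terms cancel, so the identity compares two
  coefficients only.\<close>
lemma saal_certificate:
  fixes d e f x A B \<alpha> \<beta> :: complex
  assumes "A * \<alpha> = 1" "B * \<beta> = 1"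
  shows "\<alpha> * \<beta> * d * ((1 - x * A) * (1 - x * B) * (1 - \<alpha> * \<beta> * d * e * f * x)
      - (1 - e * x) * (1 - f * x) * (1 - d * x))
   = x * ((1 - \<alpha> * d) * (1 - \<beta> * d) * (1 - \<alpha> * \<beta> * d * e * f * x)
          - (1 - \<alpha> * \<beta> * d * e) * (1 - \<alpha> * \<beta> * d * f) * (1 - d * x))"
  using assms by algebra

text \<open>The recurrence \<open>d \<mapsto> dq\<close>. The weighted difference of the integrands is a \<open>q\<close>-difference of
  a function \<open>\<Phi>\<close> with zeros at \<open>\<alpha>\<close> and \<open>\<beta>\<close>, so its integral from \<open>0\<close> to either endpoint is
  \<open>- \<Phi> 0\<close>, and the two contributions cancel.\<close>
lemma saal_step:
  assumes [simp]: "\<alpha> \<noteq> 0" "\<beta> \<noteq> 0"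
    and nz: "\<And>x. x \<in> {\<alpha>, \<beta>} \<Longrightarrow> P (d * x) \<noteq> 0 \<and> P (e * x) \<noteq> 0 \<and> P (f * x) \<noteq> 0"
  shows "(1 - d * \<alpha>) * (1 - d * \<beta>) * saal_integral \<alpha> \<beta> d e f
     = (1 - \<alpha> * \<beta> * d * e) * (1 - \<alpha> * \<beta> * d * f) * saal_integral \<alpha> \<beta> (d * q) e f"
proof -
  define c where "c = \<alpha> * \<beta> * d * e * f"
  define K where "K = (1 - d * \<alpha>) * (1 - d * \<beta>)"
  define L where "L = (1 - \<alpha> * \<beta> * d * e) * (1 - \<alpha> * \<beta> * d * f)"
  define \<Phi> where "\<Phi> x = \<alpha> * \<beta> * d * (P (x / \<alpha>) * P (x / \<beta>) * P (c * x)
      / (P (d * x) * P (e * x) * P (f * x)))"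
    for x
  have pointwise: "\<Phi> x - \<Phi> (x * q) = K * (x * saal \<alpha> \<beta> d e f x) - L * (x * saal \<alpha> \<beta> (d * q) e f x)"
    if nzx: "P (d * x) \<noteq> 0" "P (e * x) \<noteq> 0" "P (f * x) \<noteq> 0" for x
  proof -
    define U where "U = P (q * x / \<alpha>) * P (q * x / \<beta>) * P (c * (q * x))
        / (P (d * (q * x)) * P (e * x) * P (f * x))"
    define V where "V = U / (1 - d * x)"
    have r: "P (y * x) = (1 - y * x) * P (y * (q * x))" for y
      using qpoch_inf_rec[of "y * x"] by (simp add: mult_ac)
    have n: "1 - d * x \<noteq> 0" "1 - e * x \<noteq> 0" "1 - f * x \<noteq> 0"
      "P (d * (q * x)) \<noteq> 0" "P (e * (q * x)) \<noteq> 0" "P (f * (q * x)) \<noteq> 0"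
      using nzx r[of d] r[of e] r[of f] by auto
    have 1: "\<Phi> x = V * (\<alpha> * \<beta> * d * ((1 - x * (1 / \<alpha>)) * (1 - x * (1 / \<beta>)) * (1 - c * x)))"
      unfolding \<Phi>_def V_def U_def using r[of "1 / \<alpha>"] r[of "1 / \<beta>"] r[of c] r[of d]
      by (simp add: mult_ac)
    have 2: "\<Phi> (x * q) = V * (\<alpha> * \<beta> * d * ((1 - e * x) * (1 - f * x) * (1 - d * x)))"
      unfolding \<Phi>_def V_def U_def r[of e] r[of f] using n by (simp add: mult_ac)
    have 3: "saal \<alpha> \<beta> d e f x = V * (1 - c * x)"
      unfolding saal_def V_def U_def c_def[symmetric] r[of d] r[of c] by (simp add: mult_ac)
    have 4: "saal \<alpha> \<beta> (d * q) e f x = V * (1 - d * x)"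
      unfolding saal_def V_def U_def using n by (simp add: c_def mult_ac)
    have "\<Phi> x - \<Phi> (x * q) = V * (\<alpha> * \<beta> * d * ((1 - x * (1 / \<alpha>)) * (1 - x * (1 / \<beta>)) * (1 - c * x)
          - (1 - e * x) * (1 - f * x) * (1 - d * x)))"
      unfolding 1 2 by (simp only: right_diff_distrib)
    also have "\<dots> = V * (x * ((1 - \<alpha> * d) * (1 - \<beta> * d) * (1 - c * x) - L * (1 - d * x)))"
      unfolding c_def L_def by (subst saal_certificate) simp_all
    also have "\<dots> = K * (x * saal \<alpha> \<beta> d e f x) - L * (x * saal \<alpha> \<beta> (d * q) e f x)"
      unfolding 3 4 K_def by (simp add: algebra_simps)
    finally show ?thesis .
  qed
  have P1: "P 1 = 0" using qpoch_inf_rec[of 1] by simp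
  \<comment> \<open>The right-hand side, \<open>- \<Phi> 0\<close>, is the same for both endpoints.\<close>
  have one: "K * q_integral (saal \<alpha> \<beta> d e f) x - L * q_integral (saal \<alpha> \<beta> (d * q) e f) x
      = - (\<alpha> * \<beta> * d)"
    if x: "x \<in> {\<alpha>, \<beta>}" for x
  proof -
    have nzx: "P (d * x) \<noteq> 0" "P (e * x) \<noteq> 0" "P (f * x) \<noteq> 0" using nz[OF x] by auto
    have nzm: "P (d * (x * q ^ m)) \<noteq> 0" "P (e * (x * q ^ m)) \<noteq> 0" "P (f * (x * q ^ m)) \<noteq> 0" for m
      using nzx[THEN qpoch_inf_shift_nonzero, of m] by (simp_all add: mult.assoc)
    have z: "(\<lambda>m. x * q ^ m) \<longlonglongrightarrow> 0" by (rule tendsto_mult_right_zero[OF tendsto_q_power])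
    have "(\<lambda>m. \<Phi> (x * q ^ m)) \<longlonglongrightarrow> \<alpha> * \<beta> * d * (P (0 / \<alpha>) * P (0 / \<beta>) * P (c * 0)
        / (P (d * 0) * P (e * 0) * P (f * 0)))"
      unfolding \<Phi>_def by (intro tendsto_intros z) auto
    then have lim: "(\<lambda>m. \<Phi> (x * q ^ m)) \<longlonglongrightarrow> \<alpha> * \<beta> * d" by simp
    have "(\<lambda>m. \<Phi> (x * q ^ m) - \<Phi> (x * q ^ Suc m)) sums (\<Phi> (x * q ^ 0) - \<alpha> * \<beta> * d)"
      by (rule telescope_sums'[OF lim])
    moreover have "\<Phi> (x * q ^ 0) = 0" using x P1 by (auto simp: \<Phi>_def)
    moreover have "\<Phi> (x * q ^ m) - \<Phi> (x * q ^ Suc m)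
       = K * (x * q ^ m * saal \<alpha> \<beta> d e f (x * q ^ m)) - L
           * (x * q ^ m * saal \<alpha> \<beta> (d * q) e f (x * q ^ m))" for m
      using pointwise[OF nzm, of m] by (simp add: mult_ac)
    moreover have "summable (\<lambda>m. x * q ^ m * saal \<alpha> \<beta> (d * q) e f (x * q ^ m))"
      by (rule summable_saal) (use nzx(2,3) qpoch_inf_shift_nonzero[OF nzx(1), of 1] in \<open>simp_all
          add: mult_ac\<close>)
    then have "(\<lambda>m. K * (x * q ^ m * saal \<alpha> \<beta> d e f (x * q ^ m)) - L
        * (x * q ^ m * saal \<alpha> \<beta> (d * q) e f (x * q ^ m)))
       sums (K * q_integral (saal \<alpha> \<beta> d e f) x - L * q_integral (saal \<alpha> \<beta> (d * q) e f) x)"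
      unfolding q_integral_def by (intro sums_diff sums_mult summable_sums summable_saal[OF nzx])
    ultimately show ?thesis using sums_unique2 by fastforce
  qed
  have "K * saal_integral \<alpha> \<beta> d e f - L * saal_integral \<alpha> \<beta> (d * q) e f
    = (K * q_integral (saal \<alpha> \<beta> d e f) \<alpha> - L * q_integral (saal \<alpha> \<beta> (d * q) e f) \<alpha>)
      - (K * q_integral (saal \<alpha> \<beta> d e f) \<beta> - L * q_integral (saal \<alpha> \<beta> (d * q) e f) \<beta>)"
    unfolding saal_integral_def by (simp add: algebra_simps)
  also have "\<dots> = 0" by (simp add: one)
  finally show ?thesis by (simp add: K_def L_def)
qed

text \<open>Iterating the recurrence moves \<open>d\<close> to \<open>0\<close>.\<close>
lemma saal_integral_reduce:
  assumes [simp]: "\<alpha> \<noteq> 0" "\<beta> \<noteq> 0"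
    and nz: "\<And>x. x \<in> {\<alpha>, \<beta>} \<Longrightarrow> P (d * x) \<noteq> 0 \<and> P (e * x) \<noteq> 0 \<and> P (f * x) \<noteq> 0"
  shows "P (d * \<alpha>) * P (d * \<beta>) * saal_integral \<alpha> \<beta> d e f
     = P (\<alpha> * \<beta> * d * e) * P (\<alpha> * \<beta> * d * f) * saal_integral \<alpha> \<beta> 0 e f"
proof -
  have nzN: "P (d * q ^ N * x) \<noteq> 0" if "x \<in> {\<alpha>, \<beta>}" for x N
    using nz[OF that] qpoch_inf_shift_nonzero[of "d * x" N] by (simp add: mult_ac)
  have iter: "pf (d * \<alpha>) N * pf (d * \<beta>) N * saal_integral \<alpha> \<beta> d e f
     = pf (\<alpha> * \<beta> * d * e) N * pf (\<alpha> * \<beta> * d * f) N * saal_integral \<alpha> \<beta> (d * q ^ N) e f" for N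
  proof (induction N)
    case (Suc N)
    have "pf (d * \<alpha>) (Suc N) * pf (d * \<beta>) (Suc N) * saal_integral \<alpha> \<beta> d e f
      = (1 - d * q ^ N * \<alpha>) * (1 - d * q ^ N * \<beta>)
          * (pf (d * \<alpha>) N * pf (d * \<beta>) N * saal_integral \<alpha> \<beta> d e f)"
      by (simp add: qpoch_Suc mult_ac)
    also have "\<dots> = pf (\<alpha> * \<beta> * d * e) N * pf (\<alpha> * \<beta> * d * f) N *
        ((1 - d * q ^ N * \<alpha>) * (1 - d * q ^ N * \<beta>) * saal_integral \<alpha> \<beta> (d * q ^ N) e f)"
      unfolding Suc.IH by (simp add: mult_ac)
    also have "(1 - d * q ^ N * \<alpha>) * (1 - d * q ^ N * \<beta>) * saal_integral \<alpha> \<beta> (d * q ^ N) e f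
      = (1 - \<alpha> * \<beta> * (d * q ^ N) * e) * (1 - \<alpha> * \<beta> * (d * q ^ N) * f)
          * saal_integral \<alpha> \<beta> (d * q ^ N * q) e f"
      by (rule saal_step) (use nz nzN in auto)
    finally show ?case by (simp add: qpoch_Suc mult_ac)
  qed simp
  have lim: "(\<lambda>N. q_integral (saal \<alpha> \<beta> (d * q ^ N) e f) x) \<longlonglongrightarrow> q_integral (saal \<alpha> \<beta> 0 e f) x"
    if x: "x \<in> {\<alpha>, \<beta>}" for x
    unfolding q_integral_def
  proof (rule tannery[where M = "\<lambda>m. norm x * norm q ^ m * saal_bound \<alpha> \<beta> d e f x"])
    have nzx: "P (d * x) \<noteq> 0" "P (e * x) \<noteq> 0" "P (f * x) \<noteq> 0" using nz[OF x] by auto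
    have z: "(\<lambda>N. d * q ^ N) \<longlonglongrightarrow> 0" by (rule tendsto_mult_right_zero[OF tendsto_q_power])
    show "(\<lambda>N. x * q ^ m * saal \<alpha> \<beta> (d * q ^ N) e f (x * q ^ m)) \<longlonglongrightarrow> x * q ^ m
        * saal \<alpha> \<beta> 0 e f (x * q ^ m)" for m
      unfolding saal_def
      by (intro tendsto_intros z)
         (use nzx(2,3)[THEN qpoch_inf_shift_nonzero, of m] in \<open>auto simp: mult_ac\<close>)
    show "\<forall>\<^sub>F N in sequentially. \<forall>m. norm (x * q ^ m * saal \<alpha> \<beta> (d * q ^ N) e f (x * q ^ m))
        \<le> norm x * norm q ^ m * saal_bound \<alpha> \<beta> d e f x"
      using norm_saal_le[OF nzx] by (simp add: norm_mult norm_power mult_left_mono)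
    show "summable (\<lambda>m. norm x * norm q ^ m * saal_bound \<alpha> \<beta> d e f x)"
      by (intro summable_mult summable_mult2 summable_q_power)
  qed simp
  have "(\<lambda>N. pf (\<alpha> * \<beta> * d * e) N * pf (\<alpha> * \<beta> * d * f) N * saal_integral \<alpha> \<beta> (d * q ^ N) e f)
     \<longlonglongrightarrow> P (\<alpha> * \<beta> * d * e) * P (\<alpha> * \<beta> * d * f) * saal_integral \<alpha> \<beta> 0 e f"
    unfolding saal_integral_def by (intro tendsto_intros qpoch_tendsto lim) auto
  moreover have "(\<lambda>N. pf (d * \<alpha>) N * pf (d * \<beta>) N * saal_integral \<alpha> \<beta> d e f)
     \<longlonglongrightarrow> P (d * \<alpha>) * P (d * \<beta>) * saal_integral \<alpha> \<beta> d e f"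
    by (intro tendsto_intros qpoch_tendsto)
  ultimately show ?thesis unfolding iter using LIMSEQ_unique by blast
qed

text \<open>By symmetry all of \<open>d\<close>, \<open>e\<close>, \<open>f\<close> can be moved to \<open>0\<close>, so only the constant
  \<open>saal_integral \<alpha> \<beta> 0 0 0\<close> remains. It is read off from the same formula at \<open>d = q/\<alpha>\<close>,
  \<open>e = q/\<beta>\<close>, \<open>f = 0\<close>, where the integrand is \<open>1\<close> and the \<open>q\<close>-integrals are geometric series.\<close>
theorem nonterminating_q_Saalschuetz:
  assumes [simp]: "\<alpha> \<noteq> 0" "\<beta> \<noteq> 0"
    and generic: "P (q * (\<beta> / \<alpha>)) \<noteq> 0" "P (q * (\<alpha> / \<beta>)) \<noteq> 0"
    and nz: "\<And>x. x \<in> {\<alpha>, \<beta>} \<Longrightarrow> P (d * x) \<noteq> 0 \<and> P (e * x) \<noteq> 0 \<and> P (f * x) \<noteq> 0"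
  shows "P (d * \<alpha>) * P (d * \<beta>) * P (e * \<alpha>) * P (e * \<beta>) * P (f * \<alpha>) * P (f * \<beta>)
      * saal_integral \<alpha> \<beta> d e f
     = \<alpha> * P q * P (\<beta> / \<alpha>) * P (q * (\<alpha> / \<beta>)) * P (\<alpha> * \<beta> * d * e) * P (\<alpha> * \<beta> * d * f)
         * P (\<alpha> * \<beta> * e * f)"
proof -
  have chain: "P (d * \<alpha>) * P (d * \<beta>) * P (e * \<alpha>) * P (e * \<beta>) * P (f * \<alpha>) * P (f * \<beta>)
      * saal_integral \<alpha> \<beta> d e f
     = P (\<alpha> * \<beta> * d * e) * P (\<alpha> * \<beta> * d * f) * P (\<alpha> * \<beta> * e * f) * saal_integral \<alpha> \<beta> 0 0 0"
    if nz: "\<And>x. x \<in> {\<alpha>, \<beta>} \<Longrightarrow> P (d * x) \<noteq> 0 \<and> P (e * x) \<noteq> 0 \<and> P (f * x) \<noteq> 0" for d e f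
  proof -
    have 1: "P (d * \<alpha>) * P (d * \<beta>) * saal_integral \<alpha> \<beta> d e f
     = P (\<alpha> * \<beta> * d * e) * P (\<alpha> * \<beta> * d * f) * saal_integral \<alpha> \<beta> e 0 f"
      by (subst saal_integral_reduce) (use nz in \<open>auto simp: saal_integral_commute(1)[of _ _ e]\<close>)
    have 2: "P (e * \<alpha>) * P (e * \<beta>) * saal_integral \<alpha> \<beta> e 0 f = P (\<alpha> * \<beta> * e * f)
        * saal_integral \<alpha> \<beta> f 0 0"
      using saal_integral_reduce[of \<alpha> \<beta> e 0 f] nz saal_integral_commute[of \<alpha> \<beta>] by simp
    have 3: "P (f * \<alpha>) * P (f * \<beta>) * saal_integral \<alpha> \<beta> f 0 0 = saal_integral \<alpha> \<beta> 0 0 0"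
      using saal_integral_reduce[of \<alpha> \<beta> f 0 0] nz by simp
    have "P (d * \<alpha>) * P (d * \<beta>) * P (e * \<alpha>) * P (e * \<beta>) * P (f * \<alpha>) * P (f * \<beta>)
        * saal_integral \<alpha> \<beta> d e f
      = P (f * \<alpha>) * P (f * \<beta>) * (P (e * \<alpha>) * P (e * \<beta>)
          * (P (d * \<alpha>) * P (d * \<beta>) * saal_integral \<alpha> \<beta> d e f))"
      by (simp only: mult_ac)
    also have "\<dots> = P (\<alpha> * \<beta> * d * e) * P (\<alpha> * \<beta> * d * f) * (P (f * \<alpha>) * P (f * \<beta>)
        * (P (e * \<alpha>) * P (e * \<beta>) * saal_integral \<alpha> \<beta> e 0 f))" unfolding 1 by (simp only: mult_ac)
    also have "\<dots> = P (\<alpha> * \<beta> * d * e) * P (\<alpha> * \<beta> * d * f) * P (\<alpha> * \<beta> * e * f)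
        * (P (f * \<alpha>) * P (f * \<beta>) * saal_integral \<alpha> \<beta> f 0 0)" unfolding 2 by (simp only: mult_ac)
    finally show ?thesis unfolding 3 .
  qed
  have const: "saal_integral \<alpha> \<beta> 0 0 0 = (\<alpha> - \<beta>) * P q * P (q * (\<beta> / \<alpha>)) * P (q * (\<alpha> / \<beta>))"
  proof -
    \<comment> \<open>For these parameters \<open>\<alpha> \<beta> d e f = 0\<close>, and the two denominator factors cancel the
      numerator of the integrand.\<close>
    have nz': "P (q / \<alpha> * x) \<noteq> 0 \<and> P (q / \<beta> * x) \<noteq> 0 \<and> P (0 * x) \<noteq> 0" if "x \<in> {\<alpha>, \<beta>}" for x
      using that generic by auto
    have j: "q_integral (saal \<alpha> \<beta> (q / \<alpha>) (q / \<beta>) 0) x = x / (1 - q)" if x: "x \<in> {\<alpha>, \<beta>}" for x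
    proof -
      have "saal \<alpha> \<beta> (q / \<alpha>) (q / \<beta>) 0 (x * q ^ m) = 1" for m
        using nz'[OF x] qpoch_inf_shift_nonzero[of "q / \<alpha> * x" m] qpoch_inf_shift_nonzero[of "q
            / \<beta> * x" m]
        by (simp add: saal_def mult_ac)
      then show ?thesis using norm_q_less_1
        by (simp add: q_integral_def suminf_mult suminf_geometric summable_geometric)
    qed
    have q1: "1 - q \<noteq> 0" using q_power_neq_1[of 0] by simp
    have Pq: "P q = (1 - q) * P (q * q)" by (rule qpoch_inf_rec)
    have "P (q * q) * saal_integral \<alpha> \<beta> 0 0 0
        = P q * P (q * (\<beta> / \<alpha>)) * P (q * (\<alpha> / \<beta>)) * (P q * ((\<alpha> - \<beta>) / (1 - q)))"
      using chain[OF nz'] by (simp add: saal_integral_def j mult_ac diff_divide_distrib)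
    also have "P q * ((\<alpha> - \<beta>) / (1 - q)) = P (q * q) * (\<alpha> - \<beta>)" using q1 Pq by simp
    finally have "P (q * q) * saal_integral \<alpha> \<beta> 0 0 0
        = P (q * q) * ((\<alpha> - \<beta>) * P q * P (q * (\<beta> / \<alpha>)) * P (q * (\<alpha> / \<beta>)))"
      by (simp only: mult_ac)
    moreover have "P (q * q) \<noteq> 0" using qpoch_q_nonzero(2) Pq by auto
    ultimately show ?thesis by simp
  qed
  have "(\<alpha> - \<beta>) * P (q * (\<beta> / \<alpha>)) = \<alpha> * P (\<beta> / \<alpha>)"
    using qpoch_inf_rec[of "\<beta> / \<alpha>"] by (simp add: field_simps)
  then have "saal_integral \<alpha> \<beta> 0 0 0 = \<alpha> * P q * P (\<beta> / \<alpha>) * P (q * (\<alpha> / \<beta>))"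
    unfolding const by (simp add: mult_ac)
  with chain[OF nz] show ?thesis by (simp add: mult_ac)
qed

section \<open>The very-well-poised series as a \<open>q\<close>-integral\<close>

definition node_sign :: "nat \<Rightarrow> complex" where "node_sign k = (\<Prod>j<k. - (q ^ j))"

lemma node_sign_0 [simp]: "node_sign 0 = 1" and node_sign_Suc: "node_sign (Suc k) = - (q ^ k)
    * node_sign k"
  by (simp_all add: node_sign_def)

text \<open>The polynomial adds the zeros \<open>1, q, \<dots>, q\<^sup>k\<^sup>-\<^sup>1\<close> to those of \<open>(qx;q)\<^sub>\<infinity>\<close>. Hence the \<open>k\<close>-th
  term of the expansion is an integrand of \<open>q\<close>-Saalschuetz type whose endpoint \<open>1\<close> has moved to
  \<open>\<alpha> = q\<^sup>k\<close>.\<close>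
lemma qpoch_inf_times_node_prod: "P (q * x) * node_prod x k = node_sign k * P (q * x / q ^ k)"
proof (induction k)
  case (Suc k)
  have "P (q * x) * node_prod x (Suc k) = (x - q ^ k) * (node_sign k * P (q * x / q ^ k))"
    unfolding Suc.IH[symmetric] by (simp add: node_prod_Suc mult_ac)
  also have "\<dots> = node_sign (Suc k) * ((1 - x / q ^ k) * P (q * x / q ^ k))"
    by (simp add: node_sign_Suc field_simps)
  also have "(1 - x / q ^ k) * P (q * x / q ^ k) = P (q * x / q ^ Suc k)"
    using qpoch_inf_rec[of "x / q ^ k"] by (simp add: mult_ac)
  finally show ?case .
qed simp

text \<open>The quasi-periodicity \<open>\<theta>(v q\<^sup>-\<^sup>k) = (-v)\<^sup>k q\<^sup>-\<^sup>k\<^sup>(\<^sup>k\<^sup>+\<^sup>1\<^sup>)\<^sup>/\<^sup>2 \<theta>(v)\<close>, written with the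
  sign and power of \<open>q\<close> that \<open>qpoch_inf_times_node_prod\<close> produces.\<close>
lemma theta_shift:
  assumes gen: "\<And>i j. v * q ^ i \<noteq> q ^ j" and [simp]: "v \<noteq> 0"
  shows "node_sign k * (q ^ k * (P (v / q ^ k) * P (q * q ^ k / v))) = v ^ k * (P v * P (q / v))"
proof (induction k)
  case (Suc k)
  have n: "1 - q ^ Suc k / v \<noteq> 0" using gen[of 0 "Suc k"] by (simp add: field_simps)
  have 1: "P (v / q ^ Suc k) = (1 - v / q ^ Suc k) * P (v / q ^ k)"
    using qpoch_inf_rec[of "v / q ^ Suc k"] by simp
  have 2: "P (q * q ^ k / v) = (1 - q ^ Suc k / v) * P (q * q ^ Suc k / v)"
    using qpoch_inf_rec[of "q * q ^ k / v"] by (simp add: mult_ac)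
  have 3: "1 - v / q ^ Suc k = - (v / q ^ Suc k) * (1 - q ^ Suc k / v)"
    by (simp add: field_simps)
  have "node_sign (Suc k) * (q ^ Suc k * (P (v / q ^ Suc k) * P (q * q ^ Suc k / v)))
     = - (q ^ k) * q ^ Suc k * (- (v / q ^ Suc k)) * node_sign k
         * (P (v / q ^ k) * ((1 - q ^ Suc k / v) * P (q * q ^ Suc k / v)))"
    unfolding 1 3 node_sign_Suc by (simp only: mult_ac)
  also have "\<dots> = v * (node_sign k * (q ^ k * (P (v / q ^ k) * P (q * q ^ k / v))))"
    unfolding 2[symmetric] by simp
  also have "\<dots> = v ^ Suc k * (P v * P (q / v))" unfolding Suc.IH by simp
  finally show ?case .
qed simp

text \<open>On the nodes \<open>q\<^sup>m\<close> the polynomial decays superexponentially in \<open>k\<close>, so there the expansion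
  converges for every argument.\<close>
lemma norm_node_prod_q_power_le: "norm (node_prod (q ^ m) k) \<le> (\<Prod>j<k. 2 * norm q ^ j)"
proof (cases "m < k")
  case True
  then have "node_prod (q ^ m) k = 0" unfolding node_prod_def by (intro prod_zero) auto
  then show ?thesis by (simp add: prod_nonneg)
next
  case False
  have "norm (q ^ m - q ^ j) \<le> 2 * norm q ^ j" if "j < k" for j
  proof -
    have "norm (q ^ j * q ^ (m - j)) \<le> norm (q ^ j)" by (rule norm_pow_q_le)
    then have "norm (q ^ m) \<le> norm q ^ j"
      using that False by (simp add: norm_power flip: power_add)
    then show ?thesis using norm_triangle_ineq4[of "q ^ m" "q ^ j"] by (simp add: norm_power)
  qed
  then show ?thesis unfolding node_prod_def prod_norm[symmetric] by (intro prod_mono) auto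
qed

text \<open>On the nodes \<open>v q\<^sup>m\<close> the growth is geometric with ratio \<open>|v|\<close>; this is where the
  convergence condition of the \<open>\<^sub>8W\<^sub>7\<close> series enters.\<close>
lemma norm_node_prod_le:
  assumes "v \<noteq> 0"
  shows "norm (node_prod (v * q ^ m) k) \<le> norm v ^ k * pbound (1 / v)"
proof -
  have "norm (node_prod (v * q ^ m) k) \<le> (\<Prod>j<k. norm v * (1 + norm (1 / v) * norm q ^ j))"
    unfolding node_prod_def prod_norm[symmetric]
  proof (intro prod_mono conjI norm_ge_zero)
    fix j
    have "norm (v * q ^ m - q ^ j) \<le> norm v + norm q ^ j"
      using norm_triangle_ineq4[of "v * q ^ m" "q ^ j"] norm_pow_q_le[of v m] by (simp add:
          norm_power)
    also have "\<dots> = norm v * (1 + norm (1 / v) * norm q ^ j)"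
      using assms by (simp add: norm_divide field_simps)
    finally show "norm (v * q ^ m - q ^ j) \<le> norm v * (1 + norm (1 / v) * norm q ^ j)" .
  qed
  also have "\<dots> \<le> norm v ^ k * pbound (1 / v)"
    unfolding prod.distrib by (simp add: mult_left_mono prod_one_plus_power_le)
  finally show ?thesis .
qed

lemma summable_superexponential: "summable (\<lambda>k. (\<Prod>j<k. 2 * norm q ^ j) * R ^ k)" for R :: real
proof (cases "R = 0")
  case True
  then show ?thesis by (intro summable_finite[of "{0}"]) (auto simp: power_0_left)
next
  case False
  have "(\<lambda>k. norm q ^ k) \<longlonglongrightarrow> 0" using norm_q_less_1 by (simp add: LIMSEQ_power_zero)
  then have "(\<lambda>k. 2 * \<bar>R\<bar> * norm q ^ k) \<longlonglongrightarrow> 0" by (rule tendsto_mult_right_zero)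
  then have "eventually (\<lambda>k. 2 * \<bar>R\<bar> * norm q ^ k < 1 / 2) sequentially"
    by (rule order_tendstoD) simp
  then obtain K where K: "\<And>k. k \<ge> K \<Longrightarrow> 2 * \<bar>R\<bar> * norm q ^ k < 1 / 2"
    by (auto simp: eventually_sequentially)
  show ?thesis
  proof (rule summable_ratio_test[of "1 / 2" K])
    fix k assume "k \<ge> K"
    from mult_left_mono[OF less_imp_le[OF K[OF this]] norm_ge_zero[of "(\<Prod>j<k. 2 * norm q ^ j)
        * R ^ k"]]
    show "norm ((\<Prod>j<Suc k. 2 * norm q ^ j) * R ^ Suc k) \<le> 1 / 2
        * norm ((\<Prod>j<k. 2 * norm q ^ j) * R ^ k)"
      by (simp add: abs_mult power_abs mult_ac)
  qed simp
qed

definition watson_weight ::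
  "complex \<Rightarrow> complex \<Rightarrow> complex \<Rightarrow> complex \<Rightarrow> complex \<Rightarrow> complex \<Rightarrow> complex \<Rightarrow> complex \<Rightarrow> complex" where
  "watson_weight a b c d e f v x = P (q * x) * P (q * x / v) * P (a * q * x / b) * P (a * q * x / c)
     / (P (d * x) * P (e * x) * P (f * x) * P (a * q * x / (b * c)))"

text \<open>The terms of the \<open>\<^sub>8W\<^sub>7\<close> series, multiplied by \<open>1 - a\<close>.\<close>
definition vwp_term ::
  "complex \<Rightarrow> complex \<Rightarrow> complex \<Rightarrow> complex \<Rightarrow> complex \<Rightarrow> complex \<Rightarrow> complex \<Rightarrow> nat \<Rightarrow> complex" where
  "vwp_term a b c d e f z k = pf a k * (1 - a * q ^ (2 * k)) / pf q k
     * pf b k * pf c k * pf d k * pf e k * pf f k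
     / (pf (q * a / b) k * pf (q * a / c) k * pf (q * a / d) k * pf (q * a / e) k
         * pf (q * a / f) k) * z ^ k"

lemma W65_bound_shift: "W65_bound a b c (x * q ^ m) \<le> W65_bound a b c x"
  unfolding W65_bound_def using pbound_shift[of "a * x" m] order.trans[OF zero_le_one pbound_ge_1]
  by (intro mult_left_mono) (auto simp: mult.assoc intro!: mult_nonneg_nonneg divide_nonneg_nonneg)

lemma W65_bound_nonneg: "0 \<le> W65_bound a b c x"
  unfolding W65_bound_def using order.trans[OF zero_le_one pbound_ge_1]
  by (auto intro!: mult_nonneg_nonneg divide_nonneg_nonneg)

lemma summable_watson_weight:
  assumes nz: "P (d * \<xi>) \<noteq> 0" "P (e * \<xi>) \<noteq> 0" "P (f * \<xi>) \<noteq> 0" "P (a * q * \<xi> / (b * c)) \<noteq> 0"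
  shows "summable (\<lambda>m. \<xi> * q ^ m * watson_weight a b c d e f v (\<xi> * q ^ m))"
proof (rule summable_q_integral)
    fix m
    have e: "watson_weight a b c d e f v (\<xi> * q ^ m) = P (q * \<xi> * q ^ m) * P (q * \<xi> / v * q ^ m)
       * P (a * q * \<xi> / b * q ^ m) * P (a * q * \<xi> / c * q ^ m)
       * inverse (P (d * \<xi> * q ^ m)) * inverse (P (e * \<xi> * q ^ m)) * inverse (P (f * \<xi> * q ^ m))
       * inverse (P (a * q * \<xi> / (b * c) * q ^ m))"
      by (simp add: watson_weight_def divide_inverse mult_ac)
    show "norm (watson_weight a b c d e f v (\<xi> * q ^ m)) \<le> pbound (q * \<xi>) * pbound (q * \<xi> / v)
       * pbound (a * q * \<xi> / b) * pbound (a * q * \<xi> / c) * (pbound (d * \<xi>) / norm (P (d * \<xi>)))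
     * (pbound (e * \<xi>) / norm (P (e * \<xi>))) * (pbound (f * \<xi>) / norm (P (f * \<xi>)))
     * (pbound (a * q * \<xi> / (b * c)) / norm (P (a * q * \<xi> / (b * c))))"
      unfolding e by (intro norm_mult_le norm_qpoch_shift_le norm_inverse_qpoch_inf_le nz)
qed

text \<open>The \<open>\<^sub>6W\<^sub>5\<close> expansion of the weight at the points \<open>\<xi> q\<^sup>m\<close>, followed by the interchange of
  the two summations. The bound \<open>D\<close> for the polynomials \<open>node_prod\<close> on these points is a
  parameter, since it differs for \<open>\<xi> = 1\<close> and \<open>\<xi> = v\<close>.\<close>
lemma watson_expand:
  fixes v :: complex
  assumes [simp]: "b \<noteq> 0" "c \<noteq> 0"
    and nz: "P (d * \<xi>) \<noteq> 0" "P (e * \<xi>) \<noteq> 0" "P (f * \<xi>) \<noteq> 0" "P (a * q * \<xi> / (b * c)) \<noteq> 0"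
    and D: "\<And>m k. norm (node_prod (\<xi> * q ^ m) k) \<le> D k"
    and summ: "summable (\<lambda>k. D k * norm (a * q / (b * c)) ^ k)"
  defines "g \<equiv> \<lambda>k x. P (q * x) * P (q * x / v) / (P (d * x) * P (e * x) * P (f * x))
      * W65_term a b c x k"
  shows "P a * P (a * q / (b * c)) * q_integral (watson_weight a b c d e f v) \<xi>
      = (\<Sum>k. q_integral (g k) \<xi>)"
    and "summable (\<lambda>k. q_integral (g k) \<xi>)"
proof -
  define C where "C = pbound (q * \<xi>) * pbound (q * \<xi> / v) * (pbound (d * \<xi>) / norm (P (d * \<xi>)))
     * (pbound (e * \<xi>) / norm (P (e * \<xi>))) * (pbound (f * \<xi>) / norm (P (f * \<xi>)))
         * W65_bound a b c \<xi>"
  have D0: "0 \<le> D k" for k using D[of 0 k] order.trans[OF norm_ge_zero] by blast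
  have C0: "0 \<le> C" unfolding C_def using order.trans[OF zero_le_one pbound_ge_1] W65_bound_nonneg
    by (auto intro!: mult_nonneg_nonneg divide_nonneg_nonneg)
  have W: "norm (W65_term a b c (\<xi> * q ^ m) k) \<le> W65_bound a b c \<xi>
      * (D k * norm (a * q / (b * c)) ^ k)" for m k
  proof -
    have "norm (W65_term a b c (\<xi> * q ^ m) k)
      \<le> W65_bound a b c (\<xi> * q ^ m) * norm (node_prod (\<xi> * q ^ m) k * (a * q / (b * c)) ^ k)"
      using norm_W65_le[of a 0] by simp
    also have "\<dots> \<le> W65_bound a b c \<xi> * (D k * norm (a * q / (b * c)) ^ k)"
      by (intro mult_mono W65_bound_shift W65_bound_nonneg norm_ge_zero norm_mult_le D) (simp add:
          norm_power)
    finally show ?thesis .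
  qed
  have bound: "norm (\<xi> * q ^ m * g k (\<xi> * q ^ m)) \<le> norm \<xi> * norm q ^ m
      * (C * (D k * norm (a * q / (b * c)) ^ k))" for m k
  proof -
    have e: "\<xi> * q ^ m * g k (\<xi> * q ^ m) = \<xi> * q ^ m * ((P (q * \<xi> * q ^ m) * P (q * \<xi> / v * q ^ m)
       * inverse (P (d * \<xi> * q ^ m)) * inverse (P (e * \<xi> * q ^ m)) * inverse (P (f * \<xi> * q ^ m)))
           * W65_term a b c (\<xi> * q ^ m) k)"
      by (simp add: g_def divide_inverse mult_ac)
    have r: "C * (D k * norm (a * q / (b * c)) ^ k)
        = (pbound (q * \<xi>) * pbound (q * \<xi> / v) * (pbound (d * \<xi>) / norm (P (d * \<xi>)))
     * (pbound (e * \<xi>) / norm (P (e * \<xi>))) * (pbound (f * \<xi>) / norm (P (f * \<xi>))))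
         * (W65_bound a b c \<xi> * (D k * norm (a * q / (b * c)) ^ k))"
      by (simp add: C_def mult_ac)
    show ?thesis unfolding e r
      by (intro norm_mult_le norm_qpoch_shift_le norm_inverse_qpoch_inf_le nz W) (simp_all add:
          norm_power)
  qed
  have s1: "summable (\<lambda>m. norm \<xi> * norm q ^ m)" by (intro summable_mult summable_q_power)
  have s2: "summable (\<lambda>k. C * (D k * norm (a * q / (b * c)) ^ k))" by (intro summable_mult summ)
  note swap = suminf_swap_dominated[where f = "\<lambda>m k. \<xi> * q ^ m * g k (\<xi> * q ^ m)", OF bound s1 s2]
  have row: "(\<Sum>k. \<xi> * q ^ m * g k (\<xi> * q ^ m))
      = P a * P (a * q / (b * c)) * (\<xi> * q ^ m * watson_weight a b c d e f v (\<xi> * q ^ m))" for m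
  proof -
    define x where "x = \<xi> * q ^ m"
    have Q: "P (a * q * x / (b * c)) \<noteq> 0"
      using qpoch_inf_shift_nonzero[OF nz(4), of m] by (simp add: x_def mult_ac)
    have sW: "summable (\<lambda>k. norm (node_prod x k * (a * q / (b * c)) ^ k))"
      by (rule summable_comparison_test'[OF summ])
         (use D[of m] in \<open>auto simp: x_def norm_mult norm_power norm_divide intro!:
             mult_right_mono divide_right_mono\<close>)
    define y where "y = P (q * x) * P (q * x / v) / (P (d * x) * P (e * x) * P (f * x))"
    have "(\<Sum>k. x * g k x) = (\<Sum>k. x * y * W65_term a b c x k)"
      unfolding g_def y_def by (simp only: mult_ac)
    also have "\<dots> = x * (P (q * x) * P (q * x / v) / (P (d * x) * P (e * x) * P (f * x))
        * (\<Sum>k. W65_term a b c x k))"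
      unfolding suminf_mult[OF summable_W65[OF sW]] y_def by (simp only: mult_ac)
    also have "(\<Sum>k. W65_term a b c x k) = P a * P (a * q / (b * c)) * P (a * q * x / b)
        * P (a * q * x / c) / P (a * q * x / (b * c))"
      using nonterminating_6W5[OF assms(1,2) sW] Q by (simp add: field_simps)
    also have "x * (P (q * x) * P (q * x / v) / (P (d * x) * P (e * x) * P (f * x)) * \<dots>)
       = P a * P (a * q / (b * c)) * (x * watson_weight a b c d e f v x)"
      by (simp add: watson_weight_def)
    finally show ?thesis by (simp add: x_def)
  qed
  show "P a * P (a * q / (b * c)) * q_integral (watson_weight a b c d e f v) \<xi>
      = (\<Sum>k. q_integral (g k) \<xi>)"
    using summable_watson_weight[OF nz, of v] swap(1) C0 D0 by (simp add: row q_integral_def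
        suminf_mult)
  show "summable (\<lambda>k. q_integral (g k) \<xi>)"
    using swap(3) C0 D0 by (simp add: q_integral_def)
qed

text \<open>The integrand vanishes at \<open>q\<^sup>m\<close> for \<open>m < k\<close>.\<close>
lemma q_integral_saal_q_power:
  assumes nz: "P d \<noteq> 0" "P e \<noteq> 0" "P f \<noteq> 0"
  shows "q_integral (saal (q ^ k) v d e f) 1 = q_integral (saal (q ^ k) v d e f) (q ^ k)"
proof -
  let ?h = "\<lambda>m. 1 * q ^ m * saal (q ^ k) v d e f (1 * q ^ m)"
  have "?h m = 0" if "m < k" for m
  proof -
    have "q * q ^ m / q ^ k * q ^ (k - Suc m) = q ^ (Suc m + (k - Suc m)) / q ^ k"
      by (simp only: power_add power_Suc times_divide_eq_left mult.assoc)
    also have "\<dots> = 1" using that by simp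
    finally have "P (q * q ^ m / q ^ k) = 0" unfolding qpoch_inf_eq_0_iff by blast
    then show ?thesis by (simp add: saal_def)
  qed
  then have "(\<Sum>m<k. ?h m) = 0" by (intro sum.neutral) auto
  moreover have "summable ?h" by (rule summable_saal) (use nz in auto)
  from suminf_split_initial_segment[OF this, of k]
  have "q_integral (saal (q ^ k) v d e f) 1 = (\<Sum>m. ?h (m + k))
      + (\<Sum>m<k. ?h m)" by (simp add: q_integral_def)
  ultimately show ?thesis by (simp add: q_integral_def power_add mult_ac)
qed

lemma summable_vwp_term:
  assumes z: "norm z < 1"
    and low: "P (q * a / b) \<noteq> 0" "P (q * a / c) \<noteq> 0" "P (q * a / d) \<noteq> 0" "P (q * a / e) \<noteq> 0"
       "P (q * a / f) \<noteq> 0"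
  shows "summable (vwp_term a b c d e f z)"
proof -
  let ?I = "\<lambda>x. pbound x / norm (P x)"
  define C where "C = pbound a * (1 + norm a) * ?I q * pbound b * pbound c * pbound d * pbound e
      * pbound f
    * ?I (q * a / b) * ?I (q * a / c) * ?I (q * a / d) * ?I (q * a / e) * ?I (q * a / f)"
  have 1: "norm (1 - a * q ^ n) \<le> 1 + norm a" for n
    using norm_triangle_ineq4[of 1 "a * q ^ n"] norm_pow_q_le[of a n] by simp
  have e: "vwp_term a b c d e f z k = pf a k * (1 - a * q ^ (2 * k)) * inverse (pf q k)
     * pf b k * pf c k * pf d k * pf e k * pf f k
     * inverse (pf (q * a / b) k) * inverse (pf (q * a / c) k) * inverse (pf (q * a / d) k)
     * inverse (pf (q * a / e) k) * inverse (pf (q * a / f) k) * z ^ k" for k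
    by (simp add: vwp_term_def divide_inverse mult_ac)
  have "norm (vwp_term a b c d e f z k) \<le> C * norm z ^ k" for k
    unfolding e C_def
    by (intro norm_mult_le 1 norm_qpoch_le norm_inverse_qpoch_le low qpoch_q_nonzero) (simp add:
        norm_power)
  then show ?thesis
    by (rule summable_comparison_test'[rotated]) (use z in \<open>intro summable_mult
        summable_geometric, simp\<close>)
qed

text \<open>The \<open>q\<close>-integral of the weight is expanded by \<open>watson_expand\<close>; the \<open>k\<close>-th integral has the
  limits \<open>q\<^sup>k\<close> and \<open>v\<close>, and the product that evaluates it is the \<open>k\<close>-th term of the \<open>\<^sub>8W\<^sub>7\<close>
  series. The choice \<open>def = qa/v\<close> is what balances the integrands. Written with two \<open>\<^sub>4\<phi>\<^sub>3\<close>
  series in place of the \<open>q\<close>-integral, this is the nonterminating form of Watson's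
  transformation.\<close>
theorem nonterminating_Watson:
  fixes a b c d e f :: complex
  assumes nonzero [simp]: "a \<noteq> 0" "b \<noteq> 0" "c \<noteq> 0" "d \<noteq> 0" "e \<noteq> 0" "f \<noteq> 0"
    and conv: "norm (q ^ 2 * a ^ 2) < norm (b * c * d * e * f)"
  defines "v \<equiv> q * a / (d * e * f)"
  assumes gen: "\<And>i j. v * q ^ i \<noteq> q ^ j"
    and nz: "\<And>x. x \<in> {1, v} \<Longrightarrow> P (d * x) \<noteq> 0 \<and> P (e * x) \<noteq> 0 \<and> P (f * x) \<noteq> 0"
    and bc: "P (a * q / (b * c)) \<noteq> 0"
    and low: "P (q * a / b) \<noteq> 0" "P (q * a / c) \<noteq> 0" "P (q * a / d) \<noteq> 0" "P (q * a / e) \<noteq> 0"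
       "P (q * a / f) \<noteq> 0"
  shows "P d * P e * P f * P (d * v) * P (e * v) * P (f * v) * (P a * P (a * q / (b * c)))
     * (q_integral (watson_weight a b c d e f v) 1 - q_integral (watson_weight a b c d e f v) v)
   = P q * (P v * P (q / v)) * P (q * a / b) * P (q * a / c) * P (q * a / d) * P (q * a / e)
       * P (q * a / f)
      * (\<Sum>k. vwp_term a b c d e f (q ^ 2 * a ^ 2 / (b * c * d * e * f)) k)"
proof -
  have v0 [simp]: "v \<noteq> 0" by (simp add: v_def)
  define \<Lambda> where "\<Lambda> = P d * P e * P f * P (d * v) * P (e * v) * P (f * v)"
  define g where "g k x = P (q * x) * P (q * x / v) / (P (d * x) * P (e * x) * P (f * x))
      * W65_term a b c x k" for k x
  have z: "a * q * v / (b * c) = q ^ 2 * a ^ 2 / (b * c * d * e * f)"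
    by (simp add: v_def power2_eq_square field_simps)
  have z1: "norm (a * q * v / (b * c)) < 1"
    using conv by (simp add: z norm_divide norm_mult norm_power)
  have e1: "P a * P (a * q / (b * c)) * q_integral (watson_weight a b c d e f v) 1
      = (\<Sum>k. q_integral (g k) 1)"
    and s1: "summable (\<lambda>k. q_integral (g k) 1)"
    unfolding g_def
    by (rule watson_expand[where D = "\<lambda>k. \<Prod>j<k. 2 * norm q ^ j"];
        use nz[of 1] bc norm_node_prod_q_power_le summable_superexponential in simp)+
  have e2: "P a * P (a * q / (b * c)) * q_integral (watson_weight a b c d e f v) v
      = (\<Sum>k. q_integral (g k) v)"
    and s2: "summable (\<lambda>k. q_integral (g k) v)"
  proof -
    have 1: "summable (\<lambda>k. norm v ^ k * pbound (1 / v) * norm (a * q / (b * c)) ^ k)"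
    proof -
      have eq: "norm v ^ k * pbound (1 / v) * norm (a * q / (b * c)) ^ k = pbound (1 / v)
          * norm (a * q * v / (b * c)) ^ k" for k
        by (simp add: norm_mult norm_divide power_mult_distrib power_divide mult_ac)
      show ?thesis unfolding eq using z1 by (intro summable_mult summable_geometric) simp
    qed
    note * = watson_expand[where D = "\<lambda>k. norm v ^ k * pbound (1 / v)" and \<xi> = v and v = v
        and a = a and b = b and c = c and d = d and e = e and f = f, folded g_def]
    show "P a * P (a * q / (b * c)) * q_integral (watson_weight a b c d e f v) v
        = (\<Sum>k. q_integral (g k) v)"
      by (rule *(1)) (use nz[of v] 1 qpoch_inf_small[OF z1] norm_node_prod_le in auto)
    show "summable (\<lambda>k. q_integral (g k) v)"
      by (rule *(2)) (use nz[of v] 1 qpoch_inf_small[OF z1] norm_node_prod_le in auto)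
  qed
  have main: "\<Lambda> * (q_integral (g k) 1 - q_integral (g k) v) = P q * (P v * P (q / v))
      * P (q * a / b) * P (q * a / c) * P (q * a / d) * P (q * a / e) * P (q * a / f)
          * vwp_term a b c d e f (a * q * v / (b * c)) k" for k
  proof -
    define ck where "ck = pf a k * (1 - a * q ^ (2 * k)) / pf q k * pf b k * pf c k
     * P (a / b * q ^ Suc k) * P (a / c * q ^ Suc k) * (a * q / (b * c)) ^ k"
    have g: "g k x = ck * node_sign k * saal (q ^ k) v d e f x" for x
    proof -
      have eq: "q ^ k * v * d * e * f * x = a * x * q ^ Suc k" by (simp add: v_def)
      have "ck * node_sign k * saal (q ^ k) v d e f x = ck * (node_sign k * P (q * x / q ^ k))
          * P (q * x / v)
          * P (a * x * q ^ Suc k) / (P (d * x) * P (e * x) * P (f * x))"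
        unfolding saal_def eq by simp
      also have "\<dots> = g k x"
        unfolding qpoch_inf_times_node_prod[symmetric] g_def ck_def W65_term_def by (simp add:
            mult_ac)
      finally show ?thesis ..
    qed
    have jg: "q_integral (g k) x = ck * node_sign k
        * q_integral (saal (q ^ k) v d e f) x" if "x \<in> {1, v}" for x
    proof -
      have "summable (\<lambda>m. x * q ^ m * saal (q ^ k) v d e f (x * q ^ m))"
        by (rule summable_saal) (use nz[OF that] in auto)
      from suminf_mult[OF this, of "ck * node_sign k"] show ?thesis
        unfolding q_integral_def g by (simp add: mult_ac)
    qed
    have shift: "P (y * q ^ k) \<noteq> 0 \<and> P y = pf y k * P (y * q ^ k)" if "P y \<noteq> 0" for y
      using qpoch_inf_shift_nonzero[OF that] qpoch_inf_split by blast
    have aux: "P (a / y * q ^ Suc k) = P (q * a / y)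
        / pf (q * a / y) k" if "P (q * a / y) \<noteq> 0" for y
      using qpoch_inf_split[of "q * a / y" k] qpoch_nonzero[OF that, of k] by (simp add:
          field_simps)
    have vd: "q ^ k * v * d * e = a / f * q ^ Suc k" "q ^ k * v * d * f = a / e * q ^ Suc k"
      "q ^ k * v * e * f = a / d * q ^ Suc k" by (simp_all add: v_def)
    have nzd: "P d \<noteq> 0" "P e \<noteq> 0" "P f \<noteq> 0" "P (d * v) \<noteq> 0" "P (e * v) \<noteq> 0" "P (f * v) \<noteq> 0"
      using nz[of 1] nz[of v] by auto
    have saal: "P (d * q ^ k) * P (d * v) * P (e * q ^ k) * P (e * v) * P (f * q ^ k) * P (f * v)
        * saal_integral (q ^ k) v d e f
     = q ^ k * P q * P (v / q ^ k) * P (q * (q ^ k / v)) * P (a / f * q ^ Suc k)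
         * P (a / e * q ^ Suc k) * P (a / d * q ^ Suc k)"
      unfolding vd[symmetric]
    proof (rule nonterminating_q_Saalschuetz)
      show "P (q * (v / q ^ k)) \<noteq> 0"
      proof
        assume "P (q * (v / q ^ k)) = 0"
        then obtain j where "q * (v / q ^ k) * q ^ j = 1" by (auto simp: qpoch_inf_eq_0_iff)
        then have "v * q ^ Suc j = q ^ k" by (simp add: field_simps)
        with gen show False by blast
      qed
      show "P (q * (q ^ k / v)) \<noteq> 0"
      proof
        assume "P (q * (q ^ k / v)) = 0"
        then obtain j where "q * (q ^ k / v) * q ^ j = 1" by (auto simp: qpoch_inf_eq_0_iff)
        then have "v * q ^ 0 = q ^ (Suc k + j)" by (simp add: field_simps power_add)
        with gen show False by blast
      qed
      show "P (d * x) \<noteq> 0 \<and> P (e * x) \<noteq> 0 \<and> P (f * x) \<noteq> 0" if "x \<in> {q ^ k, v}" for x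
        using that nzd shift by auto
    qed auto
    have "\<Lambda> * (q_integral (g k) 1 - q_integral (g k) v) = \<Lambda>
        * (ck * node_sign k * saal_integral (q ^ k) v d e f)"
      using jg[of 1] jg[of v] q_integral_saal_q_power[OF nzd(1,2,3), of k v]
      by (simp add: saal_integral_def algebra_simps)
    also have "\<dots> = ck * node_sign k * (pf d k * pf e k * pf f k)
        * (P (d * q ^ k) * P (d * v) * P (e * q ^ k) * P (e * v) * P (f * q ^ k) * P (f * v)
        * saal_integral (q ^ k) v d e f)"
      unfolding \<Lambda>_def qpoch_inf_split[of d k] qpoch_inf_split[of e k] qpoch_inf_split[of f k] by
          (simp only: mult_ac)
    also have "\<dots> = ck * (pf d k * pf e k * pf f k) * P q
        * (P (a / f * q ^ Suc k) * P (a / e * q ^ Suc k) * P (a / d * q ^ Suc k))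
        * (node_sign k * (q ^ k * (P (v / q ^ k) * P (q * q ^ k / v))))"
      unfolding saal by (simp only: mult_ac times_divide_eq_right)
    also have "\<dots> = ck * (pf d k * pf e k * pf f k) * P q
        * (P (a / f * q ^ Suc k) * P (a / e * q ^ Suc k) * P (a / d * q ^ Suc k))
        * (v ^ k * (P v * P (q / v)))"
      unfolding theta_shift[OF gen v0] ..
    also have "\<dots> = P q * (P v * P (q / v)) * P (q * a / b) * P (q * a / c) * P (q * a / d)
        * P (q * a / e) * P (q * a / f)
       * (pf a k * (1 - a * q ^ (2 * k)) / pf q k * pf b k * pf c k * (pf d k * pf e k * pf f k)
         / (pf (q * a / b) k * pf (q * a / c) k * pf (q * a / d) k * pf (q * a / e) k
             * pf (q * a / f) k)
         * ((a * q / (b * c)) ^ k * v ^ k))"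
      unfolding ck_def aux[OF low(1)] aux[OF low(2)] aux[OF low(3)] aux[OF low(4)] aux[OF low(5)]
      by (simp add: mult_ac)
    also have "(a * q / (b * c)) ^ k * v ^ k = (a * q * v / (b * c)) ^ k"
      by (simp add: power_mult_distrib power_divide)
    finally show ?thesis unfolding vwp_term_def by (simp add: mult_ac)
  qed
  have "\<Lambda> * (P a * P (a * q / (b * c))) * (q_integral (watson_weight a b c d e f v) 1
      - q_integral (watson_weight a b c d e f v) v)
    = \<Lambda> * ((\<Sum>k. q_integral (g k) 1) - (\<Sum>k. q_integral (g k) v))"
    unfolding e1[symmetric] e2[symmetric] by (simp add: algebra_simps)
  also have "\<dots> = (\<Sum>k. \<Lambda> * (q_integral (g k) 1 - q_integral (g k) v))"
    using s1 s2 by (simp add: suminf_diff suminf_mult summable_diff)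
  also have "\<dots> = P q * (P v * P (q / v)) * P (q * a / b) * P (q * a / c) * P (q * a / d)
      * P (q * a / e) * P (q * a / f)
     * (\<Sum>k. vwp_term a b c d e f (a * q * v / (b * c)) k)"
  proof -
    let ?K = "P q * (P v * P (q / v)) * P (q * a / b) * P (q * a / c) * P (q * a / d)
        * P (q * a / e) * P (q * a / f)"
    have "summable (vwp_term a b c d e f (a * q * v / (b * c)))"
      by (rule summable_vwp_term[OF z1 low])
    then show ?thesis unfolding main by (rule suminf_mult)
  qed
  finally show ?thesis unfolding \<Lambda>_def z by (simp only: mult_ac)
qed

text \<open>The four parameters that involve the square root combine to \<open>(1 - a q\<^sup>2\<^sup>k) / (1 - a)\<close>.\<close>
lemma W87_eq_vwp:
  assumes nzs: "P (csqrt a) \<noteq> 0" "P (- csqrt a) \<noteq> 0"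
    and summ: "summable (vwp_term a b c d e f z)"
  shows "(1 - a) * W87 a b c d e f q z = (\<Sum>k. vwp_term a b c d e f z k)"
proof -
  define s where "s = csqrt a"
  have s2: "s * s = a" by (simp add: s_def flip: power2_eq_square)
  have n: "1 - s \<noteq> 0" "1 + s \<noteq> 0" using nzs qpoch_inf_rec[of s] qpoch_inf_rec[of "- s"] by (auto
      simp: s_def)
  have ns: "pf s k \<noteq> 0" "pf (- s) k \<noteq> 0" for k using nzs qpoch_nonzero by (auto simp: s_def)
  have a1: "1 - a = (1 - s) * (1 + s)" unfolding s2[symmetric] by (simp add: algebra_simps)
  have "(1 - a) \<noteq> 0" using n a1 by simp
  have t: "qpochs [a, q * s, - (q * s), b, c, d, e, f] q k
     / qpochs (q # [s, - s, q * a / b, q * a / c, q * a / d, q * a / e, q * a / f]) q k * z ^ k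
     = vwp_term a b c d e f z k / (1 - a)" for k
  proof -
    have q2: "q ^ (2 * k) = q ^ k * q ^ k" by (simp add: mult_2 power_add)
    have 1: "pf (q * s) k = pf s k * (1 - s * q ^ k) / (1 - s)"
      using qpoch_times_q[of s k] n by (simp add: field_simps)
    have 2: "pf (- (q * s)) k = pf (- s) k * (1 + s * q ^ k) / (1 + s)"
      using qpoch_times_q[of "- s" k] n by (simp add: field_simps)
    have "pf (q * s) k * pf (- (q * s)) k / (pf s k * pf (- s) k) = (1 - s * q ^ k)
        * (1 + s * q ^ k) / ((1 - s) * (1 + s))"
      unfolding 1 2 using ns by simp
    also have "(1 - s * q ^ k) * (1 + s * q ^ k) = 1 - a * q ^ (2 * k)"
      unfolding s2[symmetric] q2 by (simp add: algebra_simps)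
    finally have 3: "pf (q * s) k * pf (- (q * s)) k / (pf s k * pf (- s) k)
        = (1 - a * q ^ (2 * k)) / (1 - a)"
      unfolding a1 .
    have "qpochs [a, q * s, - (q * s), b, c, d, e, f] q k
     / qpochs (q # [s, - s, q * a / b, q * a / c, q * a / d, q * a / e, q * a / f]) q k * z ^ k
     = (pf (q * s) k * pf (- (q * s)) k / (pf s k * pf (- s) k)) * (pf a k / pf q k
     * pf b k * pf c k * pf d k * pf e k * pf f k
     / (pf (q * a / b) k * pf (q * a / c) k * pf (q * a / d) k * pf (q * a / e) k
         * pf (q * a / f) k) * z ^ k)"
      by (simp add: qpochs_def mult_ac)
    also have "\<dots> = vwp_term a b c d e f z k / (1 - a)"
      unfolding 3 vwp_term_def by (simp add: mult_ac)
    finally show ?thesis .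
  qed
  have "W87 a b c d e f q z = (\<Sum>k. vwp_term a b c d e f z k / (1 - a))"
    unfolding W87_def W87_lower_def qhyp_def s_def[symmetric] t ..
  also have "\<dots> = (\<Sum>k. vwp_term a b c d e f z k) / (1 - a)"
    by (rule suminf_divide[OF summ])
  finally show ?thesis using \<open>1 - a \<noteq> 0\<close> by simp
qed

section \<open>Vanishing of the sum of all residues\<close>

text \<open>The residue at \<open>x = D\<^sub>j q\<^sup>m\<close> of
  \<open>\<Prod>\<^sub>i (A\<^sub>i x;q)\<^sub>N / (C\<^sub>i x;q)\<^sub>N \<cdot> \<Prod>\<^sub>l (B\<^sub>l/x;q)\<^sub>N / (D\<^sub>l/x;q)\<^sub>N \<cdot> dx/x\<close>. The substitution
  \<open>x \<mapsto> 1/x\<close> exchanges \<open>A\<close> with \<open>B\<close> and \<open>C\<close> with \<open>D\<close>, so the same definition, with the roles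
  exchanged, describes up to sign the residues at the points \<open>1 / (C\<^sub>i q\<^sup>m)\<close>.\<close>
definition truncated_residue where
  "truncated_residue I J A B C D N j m = (let x = D j * q ^ m in
     (\<Prod>i\<in>I. pf (A i * x) N / pf (C i * x) N)
     * (pf (B j / x) N / (\<Prod>k\<in>{..<N} - {m}. 1 - D j * q ^ k / x))
     * (\<Prod>l\<in>J - {j}. pf (B l / x) N / pf (D l / x) N))"

lemma geometric_nodes_neq:
  assumes nz: "\<And>i. i \<in> S \<Longrightarrow> E i \<noteq> 0"
    and ratio: "\<And>i j. i \<in> S \<Longrightarrow> j \<in> S \<Longrightarrow> i \<noteq> j \<Longrightarrow> P (E i / E j) \<noteq> 0"
    and mem: "i \<in> S" "j \<in> S" "(i, m) \<noteq> (j, n)"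
  shows "E i * q ^ m \<noteq> E j * q ^ n"
proof
  assume eq: "E i * q ^ m = E j * q ^ n"
  have aux: False if "x \<in> S" "y \<in> S" "x \<noteq> y" "E x * q ^ k = E y * q ^ l" "k \<le> l" for x y k l
  proof -
    have "E x * q ^ k = E y * (q ^ (l - k) * q ^ k)" using that(4,5) by (simp flip: power_add)
    then have "E y / E x * q ^ (l - k) = 1" using nz[OF that(1)] by (simp add: field_simps)
    with ratio[of y x] that show False by (auto simp: qpoch_inf_eq_0_iff)
  qed
  show False
  proof (cases "i = j")
    case True
    then have "m = n" using eq nz[OF mem(1)] q_powers_inj by auto
    with True mem(3) show False by simp
  next
    case False
    then show False
      using aux[of i j m n] aux[of j i n m] mem eq by (cases "m \<le> n") auto
  qed
qed

text \<open>Each node \<open>(Inr j, k)\<close> stands for the factor \<open>x - D\<^sub>j q\<^sup>k\<close> and each \<open>(Inl i, k)\<close> for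
  \<open>1 - C\<^sub>i q\<^sup>k x\<close>; the right-hand side consists of the residues at infinity and at \<open>0\<close>. The
  family \<open>A\<close> is indexed like \<open>C\<close> and \<open>B\<close> like \<open>D\<close>, so that the numerator and the denominator
  have the same degree.\<close>
lemma partial_fraction_identity:
  fixes A B C D :: "nat \<Rightarrow> complex" and I J :: "nat set"
  assumes fin: "finite I" "finite J"
    and nzC: "\<And>i. i \<in> I \<Longrightarrow> C i \<noteq> 0" and nzD: "\<And>j. j \<in> J \<Longrightarrow> D j \<noteq> 0"
    and CD: "\<And>i j. i \<in> I \<Longrightarrow> j \<in> J \<Longrightarrow> P (C i * D j) \<noteq> 0"
    and CC: "\<And>i j. i \<in> I \<Longrightarrow> j \<in> I \<Longrightarrow> i \<noteq> j \<Longrightarrow> P (C i / C j) \<noteq> 0"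
    and DD: "\<And>i j. i \<in> J \<Longrightarrow> j \<in> J \<Longrightarrow> i \<noteq> j \<Longrightarrow> P (D i / D j) \<noteq> 0"
  shows "(\<Sum>j\<in>J. \<Sum>m<N. truncated_residue I J A B C D N j m)
      - (\<Sum>i\<in>I. \<Sum>m<N. truncated_residue J I B A D C N i m)
    = (\<Prod>i\<in>I. A i / C i) ^ N - (\<Prod>j\<in>J. B j / D j) ^ N"
proof -
  define K where "K = (I <+> J) \<times> {..<N}"
  define \<alpha> :: "(nat + nat) \<times> nat \<Rightarrow> complex"
    where "\<alpha> = (\<lambda>(t, k). case t of Inl i \<Rightarrow> 1 | Inr j \<Rightarrow> - (D j * q ^ k))"
  define \<beta> :: "(nat + nat) \<times> nat \<Rightarrow> complex"
    where "\<beta> = (\<lambda>(t, k). case t of Inl i \<Rightarrow> - (C i * q ^ k) | Inr j \<Rightarrow> 1)"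
  define \<gamma> :: "(nat + nat) \<times> nat \<Rightarrow> complex"
    where "\<gamma> = (\<lambda>(t, k). case t of Inl i \<Rightarrow> 1 | Inr j \<Rightarrow> - (B j * q ^ k))"
  define \<delta> :: "(nat + nat) \<times> nat \<Rightarrow> complex"
    where "\<delta> = (\<lambda>(t, k). case t of Inl i \<Rightarrow> - (A i * q ^ k) | Inr j \<Rightarrow> 1)"
  note coeffs = \<alpha>_def \<beta>_def \<gamma>_def \<delta>_def
  define p where "p = (\<Prod>t\<in>K. [:\<gamma> t, \<delta> t:])"
  define s where "s = (\<lambda>t. - (\<alpha> t / \<beta> t))"
  have finK: "finite K" using fin by (simp add: K_def)
  have prodK: "(\<Prod>t\<in>K. h t) = (\<Prod>i\<in>I. \<Prod>k<N. h (Inl i, k)) * (\<Prod>j\<in>J. \<Prod>k<N. h (Inr j, k))"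
    for h :: "(nat + nat) \<times> nat \<Rightarrow> complex"
  proof -
    have "(\<Prod>t\<in>K. h t) = (\<Prod>t\<in>I <+> J. \<Prod>k<N. h (t, k))"
      unfolding K_def by (simp add: prod.cartesian_product)
    then show ?thesis using fin by (simp add: prod.Plus)
  qed
  have sumK: "(\<Sum>t\<in>K. h t) = (\<Sum>i\<in>I. \<Sum>k<N. h (Inl i, k)) + (\<Sum>j\<in>J. \<Sum>k<N. h (Inr j, k))"
    for h :: "(nat + nat) \<times> nat \<Rightarrow> complex"
  proof -
    have "(\<Sum>t\<in>K. h t) = (\<Sum>t\<in>I <+> J. \<Sum>k<N. h (t, k))"
      unfolding K_def by (simp add: sum.cartesian_product)
    then show ?thesis using fin by (simp add: sum.Plus)
  qed
  \<comment> \<open>Deleting an index amounts to replacing its factor by \<open>1\<close>, which preserves the product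
    structure of \<open>K\<close>.\<close>
  have removeK: "(\<Prod>t\<in>K - {t0}. h t) = (\<Prod>t\<in>K. (h(t0 := 1)) t)" if "t0 \<in> K"
    for h :: "(nat + nat) \<times> nat \<Rightarrow> complex" and t0
    using prod.remove[OF finK that, of "h(t0 := 1)"] by simp
  have remove_Inr: "(\<Prod>t\<in>K - {(Inr j, m)}. h t) = (\<Prod>i\<in>I. \<Prod>k<N. h (Inl i, k))
      * (\<Prod>l\<in>J - {j}. \<Prod>k<N. h (Inr l, k)) * (\<Prod>k\<in>{..<N} - {m}. h (Inr j, k))"
    if "j \<in> J" "m < N" for h :: "(nat + nat) \<times> nat \<Rightarrow> complex" and j m
  proof -
    have "(\<Prod>l\<in>J. \<Prod>k<N. (h((Inr j, m) := 1)) (Inr l, k))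
      = (\<Prod>k<N. (h((Inr j, m) := 1)) (Inr j, k))
          * (\<Prod>l\<in>J - {j}. \<Prod>k<N. (h((Inr j, m) := 1)) (Inr l, k))"
      by (rule prod.remove[OF fin(2) that(1)])
    also have "(\<Prod>k<N. (h((Inr j, m) := 1)) (Inr j, k)) = (\<Prod>k\<in>{..<N} - {m}. h (Inr j, k))"
      using that by (subst prod.remove[of _ m]) auto
    also have "(\<Prod>l\<in>J - {j}. \<Prod>k<N. (h((Inr j, m) := 1)) (Inr l, k))
        = (\<Prod>l\<in>J - {j}. \<Prod>k<N. h (Inr l, k))"
      by (intro prod.cong) auto
    finally have split: "(\<Prod>l\<in>J. \<Prod>k<N. (h((Inr j, m) := 1)) (Inr l, k))
        = (\<Prod>k\<in>{..<N} - {m}. h (Inr j, k)) * (\<Prod>l\<in>J - {j}. \<Prod>k<N. h (Inr l, k))" .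
    have mem: "(Inr j, m) \<in> K" using that by (simp add: K_def InrI)
    show ?thesis unfolding removeK[OF mem] prodK split by (simp add: mult_ac)
  qed
  have remove_Inl: "(\<Prod>t\<in>K - {(Inl i, m)}. h t) = (\<Prod>l\<in>I - {i}. \<Prod>k<N. h (Inl l, k))
      * (\<Prod>k\<in>{..<N} - {m}. h (Inl i, k)) * (\<Prod>j\<in>J. \<Prod>k<N. h (Inr j, k))"
    if "i \<in> I" "m < N" for h :: "(nat + nat) \<times> nat \<Rightarrow> complex" and i m
  proof -
    have "(\<Prod>l\<in>I. \<Prod>k<N. (h((Inl i, m) := 1)) (Inl l, k))
      = (\<Prod>k<N. (h((Inl i, m) := 1)) (Inl i, k))
          * (\<Prod>l\<in>I - {i}. \<Prod>k<N. (h((Inl i, m) := 1)) (Inl l, k))"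
      by (rule prod.remove[OF fin(1) that(1)])
    also have "(\<Prod>k<N. (h((Inl i, m) := 1)) (Inl i, k)) = (\<Prod>k\<in>{..<N} - {m}. h (Inl i, k))"
      using that by (subst prod.remove[of _ m]) auto
    also have "(\<Prod>l\<in>I - {i}. \<Prod>k<N. (h((Inl i, m) := 1)) (Inl l, k))
        = (\<Prod>l\<in>I - {i}. \<Prod>k<N. h (Inl l, k))"
      by (intro prod.cong) auto
    finally have split: "(\<Prod>l\<in>I. \<Prod>k<N. (h((Inl i, m) := 1)) (Inl l, k))
        = (\<Prod>k\<in>{..<N} - {m}. h (Inl i, k)) * (\<Prod>l\<in>I - {i}. \<Prod>k<N. h (Inl l, k))" .
    have mem: "(Inl i, m) \<in> K" using that by (simp add: K_def InlI)
    show ?thesis unfolding removeK[OF mem] prodK split by (simp add: mult_ac)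
  qed
  have small: "(\<Prod>k<N. 1 + - (X * q ^ k) * x) = pf (X * x) N" for X x
    unfolding qpoch_def by (intro prod.cong) (auto simp: mult_ac)
  have large: "(\<Prod>k<N. - (X * q ^ k) + 1 * x) = x ^ N * pf (X / x) N" if "x \<noteq> 0" for X x
  proof -
    have "(\<Prod>k<N. - (X * q ^ k) + 1 * x) = (\<Prod>k<N. x * (1 - X / x * q ^ k))"
      using that by (intro prod.cong) (auto simp: field_simps)
    then show ?thesis by (simp add: prod.distrib qpoch_def)
  qed
  have poly_p: "poly p x = (\<Prod>i\<in>I. pf (A i * x) N) * (\<Prod>j\<in>J. x ^ N * pf (B j / x) N)" if "x \<noteq> 0" for x
    unfolding p_def poly_prod using prodK[of "\<lambda>t. \<gamma> t + \<delta> t * x"] small large[OF that]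
    by (simp add: coeffs mult.commute[of x])
  have at_D: "poly p (s t) / (s t * \<beta> t * (\<Prod>u\<in>K - {t}. \<alpha> u + \<beta> u * s t))
      = truncated_residue I J A B C D N j m"
    if t: "t = (Inr j, m)" and j: "j \<in> J" and m: "m < N" for t j m
  proof -
    define x where "x = D j * q ^ m"
    have x: "x \<noteq> 0" "s t = x" "\<beta> t = 1" using nzD[OF j] by (auto simp: x_def s_def coeffs t)
    have "(\<Prod>k\<in>{..<N} - {m}. - (D j * q ^ k) + 1 * x) = (\<Prod>k\<in>{..<N} - {m}. x * (1 - D j * q ^ k / x))"
      using x by (intro prod.cong) (auto simp: field_simps)
    also have "\<dots> = x ^ (N - 1) * (\<Prod>k\<in>{..<N} - {m}. 1 - D j * q ^ k / x)"
      using m by (simp add: prod.distrib card_Diff_singleton)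
    finally have "x * (\<Prod>k\<in>{..<N} - {m}. - (D j * q ^ k) + 1 * x)
        = x ^ N * (\<Prod>k\<in>{..<N} - {m}. 1 - D j * q ^ k / x)"
      using m by (cases N) auto
    then have "x * (\<Prod>u\<in>K - {t}. \<alpha> u + \<beta> u * x) = (\<Prod>i\<in>I. pf (C i * x) N)
        * (\<Prod>l\<in>J - {j}. x ^ N * pf (D l / x) N) * (x ^ N * (\<Prod>k\<in>{..<N} - {m}. 1 - D j * q ^ k / x))"
      unfolding t remove_Inr[OF j m] using small large[OF x(1)] by (simp add: coeffs mult_ac)
    then have den: "s t * \<beta> t * (\<Prod>u\<in>K - {t}. \<alpha> u + \<beta> u * s t) = (\<Prod>i\<in>I. pf (C i * x) N)
        * ((\<Prod>l\<in>J - {j}. x ^ N) * (\<Prod>l\<in>J - {j}. pf (D l / x) N))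
        * (x ^ N * (\<Prod>k\<in>{..<N} - {m}. 1 - D j * q ^ k / x))"
      by (simp only: x mult_1_right prod.distrib)
    have num: "poly p (s t) = (\<Prod>i\<in>I. pf (A i * x) N) * ((x ^ N * pf (B j / x) N)
        * ((\<Prod>l\<in>J - {j}. x ^ N) * (\<Prod>l\<in>J - {j}. pf (B l / x) N)))"
      unfolding x(2) poly_p[OF x(1)] prod.remove[OF fin(2) j, of "\<lambda>l. x ^ N * pf (B l / x) N"]
      by (simp only: prod.distrib)
    have res: "truncated_residue I J A B C D N j m = (\<Prod>i\<in>I. pf (A i * x) N) / (\<Prod>i\<in>I. pf (C i * x) N)
        * (pf (B j / x) N / (\<Prod>k\<in>{..<N} - {m}. 1 - D j * q ^ k / x))
        * ((\<Prod>l\<in>J - {j}. pf (B l / x) N) / (\<Prod>l\<in>J - {j}. pf (D l / x) N))"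
      unfolding truncated_residue_def Let_def x_def[symmetric] prod_dividef ..
    have cancel: "a * ((u * b) * (w * c)) / (a' * (w * c') * (u * b')) = a / a' * (b / b')
        * (c / c')"
      if "u \<noteq> 0" "w \<noteq> 0" for a a' b b' c c' u w :: complex
      using that by (simp add: mult_ac)
    show ?thesis unfolding num den res by (rule cancel) (use x(1) in auto)
  qed
  have at_C: "poly p (s t) / (s t * \<beta> t * (\<Prod>u\<in>K - {t}. \<alpha> u + \<beta> u * s t))
      = - truncated_residue J I B A D C N i m"
    if t: "t = (Inl i, m)" and i: "i \<in> I" and m: "m < N" for t i m
  proof -
    define y where "y = C i * q ^ m"
    define x where "x = 1 / y"
    have y: "y \<noteq> 0" using nzC[OF i] by (auto simp: y_def)
    have x: "x \<noteq> 0" "s t = x" "s t * \<beta> t = - 1" using y by (auto simp: x_def y_def s_def coeffs t)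
    have xy: "X * x = X / y" "X / x = X * y" for X using y by (auto simp: x_def)
    have here: "(\<Prod>k\<in>{..<N} - {m}. 1 + - (C i * q ^ k) * x) = (\<Prod>k\<in>{..<N} - {m}. 1 - C i * q ^ k / y)"
      by (simp add: xy(1))
    have den: "(\<Prod>u\<in>K - {t}. \<alpha> u + \<beta> u * s t) = (\<Prod>l\<in>I - {i}. pf (C l / y) N)
        * (\<Prod>k\<in>{..<N} - {m}. 1 - C i * q ^ k / y) * ((\<Prod>j\<in>J. x ^ N) * (\<Prod>j\<in>J. pf (D j * y) N))"
      unfolding t remove_Inl[OF i m] prod.distrib[symmetric] x(2)[unfolded t]
      by (simp only: coeffs prod.case sum.case small large[OF x(1)] here) (simp only: xy)
    have num: "poly p (s t) = ((pf (A i / y) N) * (\<Prod>l\<in>I - {i}. pf (A l / y) N))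
        * ((\<Prod>j\<in>J. x ^ N) * (\<Prod>j\<in>J. pf (B j * y) N))"
      unfolding x(2) poly_p[OF x(1)] xy prod.remove[OF fin(1) i, of "\<lambda>l. pf (A l / y) N"]
      by (simp only: prod.distrib)
    have res: "truncated_residue J I B A D C N i m = (\<Prod>j\<in>J. pf (B j * y) N) / (\<Prod>j\<in>J. pf (D j * y) N)
        * (pf (A i / y) N / (\<Prod>k\<in>{..<N} - {m}. 1 - C i * q ^ k / y))
        * ((\<Prod>l\<in>I - {i}. pf (A l / y) N) / (\<Prod>l\<in>I - {i}. pf (C l / y) N))"
      unfolding truncated_residue_def Let_def y_def[symmetric] prod_dividef ..
    have cancel: "(b * c) * (w * a) / (- 1 * (c' * b' * (w * a')))
        = - (a / a' * (b / b') * (c / c'))"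
      if "w \<noteq> 0" for a a' b b' c c' w :: complex
      using that by (simp add: mult_ac)
    show ?thesis unfolding num den res x(3) by (rule cancel) (use x(1) in auto)
  qed
  have nodes: "(\<Sum>t\<in>K. poly p (s t) / (s t * \<beta> t * (\<Prod>u\<in>K - {t}. \<alpha> u + \<beta> u * s t)))
    = coeff p (card K) / (\<Prod>t\<in>K. \<beta> t) - poly p 0 / (\<Prod>t\<in>K. \<alpha> t)"
    unfolding s_def
  proof (rule residue_sum_linear_factors[OF finK])
    show "degree p \<le> card K" using coeff_prod_linear[OF finK] by (simp add: p_def)
    show "\<alpha> t \<noteq> 0 \<and> \<beta> t \<noteq> 0" if "t \<in> K" for t
      using that nzC nzD by (auto simp: K_def coeffs)
    show "\<alpha> t / \<beta> t \<noteq> \<alpha> u / \<beta> u" if "t \<in> K" "u \<in> K" "t \<noteq> u" for t u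
    proof -
      obtain x m y n where tu: "t = (x, m)" "u = (y, n)" by (cases t; cases u) auto
      have mixed: "C i * q ^ k * (D j * q ^ l) \<noteq> 1" if "i \<in> I" "j \<in> J" for i j k l
      proof
        assume "C i * q ^ k * (D j * q ^ l) = 1"
        then have "C i * D j * q ^ (k + l) = 1" by (simp add: power_add mult_ac)
        with CD[OF that] show False by (auto simp: qpoch_inf_eq_0_iff)
      qed
      show ?thesis
      proof (cases x; cases y)
        fix i j assume xy: "x = Inl i" "y = Inl j"
        then have "C i * q ^ m \<noteq> C j * q ^ n"
          using that tu by (intro geometric_nodes_neq[of I C] nzC CC) (auto simp: K_def)
        then show ?thesis using xy by (auto simp: tu coeffs field_simps)
      next
        fix i j assume xy: "x = Inr i" "y = Inr j"
        then have "D i * q ^ m \<noteq> D j * q ^ n"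
          using that tu by (intro geometric_nodes_neq[of J D] nzD DD) (auto simp: K_def)
        then show ?thesis using xy by (auto simp: tu coeffs)
      next
        fix i j assume xy: "x = Inl i" "y = Inr j"
        then show ?thesis using mixed[of i j m n] that nzC[of i] nzD[of j]
          by (auto simp: tu coeffs K_def field_simps)
      next
        fix i j assume xy: "x = Inr j" "y = Inl i"
        then show ?thesis using mixed[of i j n m] that nzC[of i] nzD[of j]
          by (auto simp: tu coeffs K_def field_simps)
      qed
    qed
  qed
  have "coeff p (card K) / (\<Prod>t\<in>K. \<beta> t) = (\<Prod>t\<in>K. \<delta> t / \<beta> t)"
    using coeff_prod_linear[OF finK] by (simp add: p_def prod_dividef)
  also have "\<dots> = (\<Prod>i\<in>I. A i / C i) ^ N"
    unfolding prodK by (simp add: coeffs prod_power_distrib)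
  finally have top: "coeff p (card K) / (\<Prod>t\<in>K. \<beta> t) = (\<Prod>i\<in>I. A i / C i) ^ N" .
  have "poly p 0 / (\<Prod>t\<in>K. \<alpha> t) = (\<Prod>t\<in>K. \<gamma> t / \<alpha> t)"
    by (simp add: p_def poly_prod prod_dividef)
  also have "\<dots> = (\<Prod>j\<in>J. B j / D j) ^ N"
    unfolding prodK by (simp add: coeffs prod_power_distrib)
  finally have bottom: "poly p 0 / (\<Prod>t\<in>K. \<alpha> t) = (\<Prod>j\<in>J. B j / D j) ^ N" .
  show ?thesis using nodes unfolding top bottom sumK by (simp add: at_C at_D sum_negf)
qed

text \<open>The factor \<open>(-1)\<^sup>m q\<^sup>-\<^sup>m\<^sup>(\<^sup>m\<^sup>+\<^sup>1\<^sup>)\<^sup>/\<^sup>2\<close>, which is the same for every \<open>y\<close> in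
  \<open>qpoch_descend\<close> and therefore cancels from the residues.\<close>
definition descent_factor :: "nat \<Rightarrow> complex" where "descent_factor m = (\<Prod>i<m. - (1 / q ^ Suc i))"

lemma descent_factor_nonzero [simp]: "descent_factor m \<noteq> 0" by (simp add: descent_factor_def
    prod_zero_iff)

lemma qpoch_descend:
  assumes "y \<noteq> 0"
  shows "pf (y / q ^ m) (m + n) = descent_factor m * (y ^ m * pf (q / y) m * pf y n)"
proof (induction m)
  case 0 then show ?case by (simp add: descent_factor_def)
next
  case (Suc m)
  have "pf (y / q ^ Suc m) (Suc m + n) = (1 - y / q ^ Suc m) * pf (y / q ^ m) (m + n)"
    using qpoch_Suc_left[of "y / q ^ Suc m" "m + n"] by simp
  also have "1 - y / q ^ Suc m = - (1 / q ^ Suc m) * (y * (1 - q / y * q ^ m))"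
    using assms by (simp add: field_simps)
  finally show ?case unfolding Suc.IH by (simp add: descent_factor_def qpoch_Suc mult_ac)
qed

lemma prod_remove_split:
  fixes f :: "nat \<Rightarrow> complex"
  shows "(\<Prod>k\<in>{..<m + Suc n} - {m}. f k) = (\<Prod>k<m. f k) * (\<Prod>k<n. f (m + Suc k))"
proof (induction n)
  case 0
  have "{..<m + Suc 0} - {m} = {..<m}" by auto
  then show ?case by simp
next
  case (Suc n)
  have "{..<m + Suc (Suc n)} - {m} = insert (m + Suc n) ({..<m + Suc n} - {m})" by auto
  then show ?case using Suc.IH by (simp add: mult_ac)
qed

lemma qpoch_descend_punctured:
  assumes "d \<noteq> 0"
  shows "(\<Prod>k\<in>{..<m + Suc n} - {m}. 1 - d * q ^ k / (d * q ^ m)) = descent_factor m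
      * (pf q m * pf q n)"
proof -
  have "(\<Prod>k<m. 1 - d * q ^ k / (d * q ^ m)) = pf (1 / q ^ m) m"
    using assms by (simp add: qpoch_def)
  moreover have "(\<Prod>k<n. 1 - d * q ^ (m + Suc k) / (d * q ^ m)) = pf q n"
    using assms by (simp add: qpoch_def power_add)
  ultimately show ?thesis unfolding prod_remove_split using qpoch_descend[of 1 m 0] by simp
qed

text \<open>The limit of \<open>truncated_residue\<close> for \<open>N \<rightarrow> \<infinity>\<close>. In the variable \<open>m\<close> this is, up to a
  constant factor, the general term of a basic hypergeometric series with argument
  \<open>\<Prod>\<^sub>l B\<^sub>l / D\<^sub>l\<close>.\<close>
definition residue_term where
  "residue_term I J A B C D j m = (\<Prod>i\<in>I. P (A i * D j * q ^ m) / P (C i * D j * q ^ m))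
     * (pf (q * D j / B j) m * P (B j / D j) / (pf q m * P q))
     * (\<Prod>l\<in>J - {j}. pf (q * D j / B l) m * P (B l / D j) / (pf (q * D j / D l) m * P (D l / D j)))
     * (\<Prod>l\<in>J. B l / D l) ^ m"

text \<open>The truncated residue after the negative powers of \<open>q\<close> have been removed from its factors.
  In this form every factor is bounded uniformly in \<open>N\<close> and \<open>m\<close>, apart from the geometric one.\<close>
definition residue_approx where
  "residue_approx I J A B C D N j m =
     (\<Prod>i\<in>I. pf (A i * D j * q ^ m) N * inverse (pf (C i * D j * q ^ m) N))
     * (pf (q * D j / B j) m * pf (B j / D j) (N - m) * inverse (pf q m)
         * inverse (pf q (N - Suc m)))
     * (\<Prod>l\<in>J - {j}. pf (q * D j / B l) m * pf (B l / D j) (N - m)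
         * inverse (pf (q * D j / D l) m) * inverse (pf (D l / D j) (N - m)))
     * (\<Prod>l\<in>J. B l / D l) ^ m"

lemma truncated_residue_eq_approx:
  assumes fin: "finite J" and j: "j \<in> J" and nz: "\<And>l. l \<in> J \<Longrightarrow> D l \<noteq> 0 \<and> B l \<noteq> 0" and m: "m < N"
  shows "truncated_residue I J A B C D N j m = residue_approx I J A B C D N j m"
proof -
  obtain n where N: "N = m + Suc n" using m less_iff_Suc_add by auto
  have Dj: "D j \<noteq> 0" using nz[OF j] by simp
  have desc: "pf (X / (D j * q ^ m)) N = descent_factor m
      * ((X / D j) ^ m * pf (q * D j / X) m * pf (X / D j) (N - m))"
    if "X \<noteq> 0" for X
    using qpoch_descend[of "X / D j" m "Suc n"] that Dj by (simp add: N)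
  have 1: "pf (B j / (D j * q ^ m)) N / (\<Prod>k\<in>{..<N} - {m}. 1 - D j * q ^ k / (D j * q ^ m))
    = (pf (q * D j / B j) m * pf (B j / D j) (N - m) * inverse (pf q m)
        * inverse (pf q (N - Suc m))) * (B j / D j) ^ m"
  proof -
    have p: "(\<Prod>k\<in>{..<N} - {m}. 1 - D j * q ^ k / (D j * q ^ m)) = descent_factor m
        * (pf q m * pf q (N - Suc m))"
      using qpoch_descend_punctured[OF Dj, of m n] by (simp add: N)
    have "B j \<noteq> 0" using nz[OF j] by simp
    from desc[OF this] show ?thesis unfolding p by (simp add: field_simps)
  qed
  have 2: "(\<Prod>l\<in>J - {j}. pf (B l / (D j * q ^ m)) N / pf (D l / (D j * q ^ m)) N)
    = (\<Prod>l\<in>J - {j}. pf (q * D j / B l) m * pf (B l / D j) (N - m)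
         * inverse (pf (q * D j / D l) m) * inverse (pf (D l / D j) (N - m)))
             * (\<Prod>l\<in>J - {j}. B l / D l) ^ m"
    unfolding prod_power_distrib prod.distrib[symmetric]
  proof (intro prod.cong refl)
    fix l assume l: "l \<in> J - {j}"
    with nz have "B l \<noteq> 0" "D l \<noteq> 0" by auto
    note d = desc[OF this(1)] desc[OF this(2)]
    have r: "(B l / D j) ^ m = (B l / D l) ^ m * (D l / D j) ^ m"
      using \<open>D l \<noteq> 0\<close> by (simp add: power_mult_distrib[symmetric])
    show "pf (B l / (D j * q ^ m)) N / pf (D l / (D j * q ^ m)) N = pf (q * D j / B l) m
        * pf (B l / D j) (N - m)
         * inverse (pf (q * D j / D l) m) * inverse (pf (D l / D j) (N - m)) * (B l / D l) ^ m"
      unfolding d r using \<open>D l \<noteq> 0\<close> Dj by (simp add: divide_inverse mult_ac)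
  qed
  have "(\<Prod>l\<in>J. B l / D l) ^ m = (B j / D j) ^ m * (\<Prod>l\<in>J - {j}. B l / D l) ^ m"
    unfolding prod.remove[OF fin j, of "\<lambda>l. B l / D l"] by (rule power_mult_distrib)
  then show ?thesis
    unfolding truncated_residue_def Let_def residue_approx_def 1 2
    by (simp add: divide_inverse mult_ac)
qed

lemma residue_approx_limit:
  fixes A B C D :: "nat \<Rightarrow> complex"
  assumes fin: "finite I" "finite J" and j: "j \<in> J"
    and nz: "\<And>l. l \<in> J \<Longrightarrow> D l \<noteq> 0 \<and> B l \<noteq> 0"
    and CD: "\<And>i. i \<in> I \<Longrightarrow> P (C i * D j) \<noteq> 0"
    and DD: "\<And>i j. i \<in> J \<Longrightarrow> j \<in> J \<Longrightarrow> i \<noteq> j \<Longrightarrow> P (D i / D j) \<noteq> 0"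
    and z: "norm (\<Prod>l\<in>J. B l / D l) < 1"
  shows "(\<lambda>N. \<Sum>m<N. truncated_residue I J A B C D N j m) \<longlonglongrightarrow> (\<Sum>m. residue_term I J A B C D j m)"
proof -
  let ?I = "\<lambda>x. pbound x / norm (P x)"
  define M where "M = (\<Prod>i\<in>I. pbound (A i * D j) * (pbound (C i * D j) * ?I (C i * D j)))
     * (pbound (q * D j / B j) * pbound (B j / D j) * ?I q * ?I q)
     * (\<Prod>l\<in>J - {j}. pbound (q * D j / B l) * pbound (B l / D j) * ?I (q * D j / D l)
         * ?I (D l / D j))"
  define a where "a m N = (if m < N then residue_approx I J A B C D N j m else 0)" for m N
  have DD': "P (D l / D j) \<noteq> 0" "P (q * D j / D l) \<noteq> 0" if "l \<in> J - {j}" for l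
    using DD[of l j] DD[of j l] qpoch_inf_shift_nonzero[of "D j
        / D l" 1] that j by (auto simp: mult_ac)
  have bound: "norm (residue_approx I J A B C D N j m) \<le> M * norm (\<Prod>l\<in>J. B l / D l) ^ m" for N m
    unfolding residue_approx_def M_def
    by (intro norm_mult_le norm_prod_mono norm_qpoch_of_shift_le norm_qpoch_le
        norm_inverse_qpoch_shift_le
         norm_inverse_qpoch_le CD DD' qpoch_q_nonzero(2)) (simp_all add: norm_power)
  have M0: "0 \<le> M" unfolding M_def using order.trans[OF zero_le_one pbound_ge_1]
    by (intro mult_nonneg_nonneg prod_nonneg divide_nonneg_nonneg) (auto intro!:
        mult_nonneg_nonneg divide_nonneg_nonneg)
  have lim: "(\<lambda>N. a m N) \<longlonglongrightarrow> residue_term I J A B C D j m" for m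
  proof -
    have sub: "(\<lambda>N. pf x (N - k)) \<longlonglongrightarrow> P x" for x k
      using LIMSEQ_offset[of "\<lambda>N. pf x (N - k)" k] qpoch_tendsto[of x] by simp
    have nz1: "P (C i * D j * q ^ m) \<noteq> 0" if "i \<in> I" for i
      using CD[OF that] by (rule qpoch_inf_shift_nonzero)
    have "(\<lambda>N. residue_approx I J A B C D N j m) \<longlonglongrightarrow>
      ((\<Prod>i\<in>I. P (A i * D j * q ^ m) * inverse (P (C i * D j * q ^ m)))
     * (pf (q * D j / B j) m * P (B j / D j) * inverse (pf q m) * inverse (P q))
     * (\<Prod>l\<in>J - {j}. pf (q * D j / B l) m * P (B l / D j)
         * inverse (pf (q * D j / D l) m) * inverse (P (D l / D j)))
     * (\<Prod>l\<in>J. B l / D l) ^ m)" (is "_ \<longlonglongrightarrow> ?L")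
      unfolding residue_approx_def
      by (intro tendsto_mult tendsto_prod tendsto_inverse tendsto_const qpoch_tendsto sub nz1 DD'
          qpoch_q_nonzero(2))
    also have "?L = residue_term I J A B C D j m"
      unfolding residue_term_def by (simp add: divide_inverse mult_ac)
    finally show ?thesis
      by (rule Lim_transform_eventually) (use eventually_gt_at_top[of m] in eventually_elim, simp
          add: a_def)
  qed
  have "(\<lambda>N. \<Sum>m. a m N) \<longlonglongrightarrow> (\<Sum>m. residue_term I J A B C D j m)"
  proof (rule tannery[OF lim])
    show "\<forall>\<^sub>F N in sequentially. \<forall>m. norm (a m N) \<le> M * norm (\<Prod>l\<in>J. B l / D l) ^ m"
      using bound M0 by (simp add: a_def)
    show "summable (\<lambda>m. M * norm (\<Prod>l\<in>J. B l / D l) ^ m)"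
      using z by (intro summable_mult summable_geometric) simp
  qed simp
  moreover have "(\<Sum>m. a m N) = (\<Sum>m<N. truncated_residue I J A B C D N j m)" for N
  proof -
    have "(\<Sum>m. a m N) = (\<Sum>m<N. a m N)" by (rule suminf_finite) (auto simp: a_def)
    also have "\<dots> = (\<Sum>m<N. truncated_residue I J A B C D N j m)"
    proof (rule sum.cong)
      fix m assume "m \<in> {..<N}"
      then show "a m N = truncated_residue I J A B C D N j m"
        using truncated_residue_eq_approx[where I = I and D = D and B
            = B, OF fin(2) j nz] by (simp add: a_def)
    qed simp
    finally show ?thesis .
  qed
  ultimately show ?thesis by simp
qed

text \<open>The sum of all residues vanishes: by the two conditions on the products, the contributions
  of \<open>0\<close> and of infinity tend to \<open>0\<close> as \<open>N\<close> grows, and the same conditions make the limiting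
  series converge.\<close>
theorem residue_series_balance:
  fixes A B C D :: "nat \<Rightarrow> complex"
  assumes fin: "finite I" "finite J"
    and AC: "\<And>i. i \<in> I \<Longrightarrow> A i \<noteq> 0 \<and> C i \<noteq> 0" and BD: "\<And>j. j \<in> J \<Longrightarrow> B j \<noteq> 0 \<and> D j \<noteq> 0"
    and CD: "\<And>i j. i \<in> I \<Longrightarrow> j \<in> J \<Longrightarrow> P (C i * D j) \<noteq> 0"
    and CC: "\<And>i j. i \<in> I \<Longrightarrow> j \<in> I \<Longrightarrow> i \<noteq> j \<Longrightarrow> P (C i / C j) \<noteq> 0"
    and DD: "\<And>i j. i \<in> J \<Longrightarrow> j \<in> J \<Longrightarrow> i \<noteq> j \<Longrightarrow> P (D i / D j) \<noteq> 0"
    and z: "norm (\<Prod>i\<in>I. A i / C i) < 1" "norm (\<Prod>j\<in>J. B j / D j) < 1"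
  shows "(\<Sum>j\<in>J. \<Sum>m. residue_term I J A B C D j m) = (\<Sum>i\<in>I. \<Sum>m. residue_term J I B A D C i m)"
proof -
  have "(\<lambda>N. (\<Sum>j\<in>J. \<Sum>m<N. truncated_residue I J A B C D N j m)
      - (\<Sum>i\<in>I. \<Sum>m<N. truncated_residue J I B A D C N i m))
    \<longlonglongrightarrow> (\<Sum>j\<in>J. \<Sum>m. residue_term I J A B C D j m) - (\<Sum>i\<in>I. \<Sum>m. residue_term J I B A D C i m)"
  proof (intro tendsto_diff tendsto_sum)
    fix j assume j: "j \<in> J"
    show "(\<lambda>N. \<Sum>m<N. truncated_residue I J A B C D N j m) \<longlonglongrightarrow> (\<Sum>m. residue_term I J A B C D j m)"
      using assms j by (intro residue_approx_limit) auto
  next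
    fix i assume i: "i \<in> I"
    have "P (D j * C i) \<noteq> 0" if "j \<in> J" for j using CD[OF i that] by (simp add: mult.commute)
    then show "(\<lambda>N. \<Sum>m<N. truncated_residue J I B A D C N i m) \<longlonglongrightarrow> (\<Sum>m. residue_term J I B A D C i m)"
      using assms i by (intro residue_approx_limit) auto
  qed
  moreover have "(\<Sum>j\<in>J. \<Sum>m<N. truncated_residue I J A B C D N j m)
      - (\<Sum>i\<in>I. \<Sum>m<N. truncated_residue J I B A D C N i m)
     = (\<Prod>i\<in>I. A i / C i) ^ N - (\<Prod>j\<in>J. B j / D j) ^ N" for N
    using AC BD by (intro partial_fraction_identity[OF fin _ _ CD CC DD]) auto
  moreover have "(\<lambda>N. (\<Prod>i\<in>I. A i / C i) ^ N - (\<Prod>j\<in>J. B j / D j) ^ N) \<longlonglongrightarrow> 0 - 0"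
    by (intro tendsto_diff LIMSEQ_power_zero z)
  ultimately show ?thesis using LIMSEQ_unique by fastforce
qed

section \<open>Continuity of basic hypergeometric series\<close>

definition qhyp_bound :: "complex list \<Rightarrow> complex list \<Rightarrow> real" where
  "qhyp_bound as bs = (\<Prod>x\<leftarrow>as. pbound x) * (\<Prod>x\<leftarrow>q # bs. pbound x / norm (P x))"

lemma norm_qhyp_term_le:
  assumes "\<forall>x\<in>set bs. P x \<noteq> 0"
  shows "norm (qpochs as q k / qpochs (q # bs) q k * z ^ k) \<le> qhyp_bound as bs * norm z ^ k"
proof -
  have 1: "norm (qpochs as q k) \<le> (\<Prod>x\<leftarrow>as. pbound x)" for as
    unfolding qpochs_def by (induction as) (auto intro!: norm_mult_le norm_qpoch_le)
  have 2: "norm (inverse (qpochs bs q k)) \<le> (\<Prod>x\<leftarrow>bs. pbound x / norm (P x))"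
    if "\<forall>x\<in>set bs. P x \<noteq> 0" for bs
    using that
  proof (induction bs)
    case (Cons x bs)
    have "norm (inverse (pf x k) * inverse (qpochs bs q k))
        \<le> pbound x / norm (P x) * (\<Prod>x\<leftarrow>bs. pbound x / norm (P x))"
      using Cons by (intro norm_mult_le norm_inverse_qpoch_le) auto
    then show ?case by (simp add: qpochs_def)
  qed (simp add: qpochs_def)
  have 3: "norm (inverse (qpochs (q # bs) q k)) \<le> (\<Prod>x\<leftarrow>q # bs. pbound x / norm (P x))"
    by (rule 2) (use assms in simp)
  show ?thesis unfolding divide_inverse [of "qpochs as q k"] qhyp_bound_def
    by (intro norm_mult_le 1 3) (simp add: norm_power)
qed

lemma summable_qhyp:
  assumes "\<forall>x\<in>set bs. P x \<noteq> 0" and z: "norm z < 1"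
  shows "summable (\<lambda>k. qpochs as q k / qpochs (q # bs) q k * z ^ k)"
  by (rule summable_comparison_test'[OF _ norm_qhyp_term_le[OF assms(1)]])
     (use z in \<open>intro summable_mult summable_geometric, simp\<close>)

lemma tendsto_pbound: "(g \<longlongrightarrow> x) F \<Longrightarrow> ((\<lambda>s. pbound (g s)) \<longlongrightarrow> pbound x) F"
  unfolding pbound_def using norm_q_less_1 by (intro tendsto_intros) auto

lemma tendsto_prod_list_map:
  fixes h :: "'a \<Rightarrow> 'b :: real_normed_field"
  assumes "list_all2 (\<lambda>g x. ((\<lambda>s. h (g s)) \<longlongrightarrow> h x) F) gs xs"
  shows "((\<lambda>s. \<Prod>x\<leftarrow>map (\<lambda>g. g s) gs. h x) \<longlongrightarrow> (\<Prod>x\<leftarrow>xs. h x)) F"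
  using assms by induction (auto intro!: tendsto_mult)

text \<open>Joint continuity in all parameters, at points where no lower parameter is excluded. The
  constant in the domination is itself continuous in the parameters, so near the limit it can be
  replaced by its limit plus \<open>1\<close>.\<close>
lemma tendsto_qhyp:
  fixes gs hs :: "('s \<Rightarrow> complex) list"
  assumes gs: "list_all2 (\<lambda>g x. (g \<longlongrightarrow> x) F) gs as"
    and hs: "list_all2 (\<lambda>h x. (h \<longlongrightarrow> x) F) hs bs"
    and w: "(w \<longlongrightarrow> z) F" and nz: "\<forall>x\<in>set bs. P x \<noteq> 0" and z: "norm z < 1" and F: "F \<noteq> bot"
  shows "((\<lambda>s. qhyp (map (\<lambda>g. g s) gs) (map (\<lambda>h. h s) hs) q (w s)) \<longlongrightarrow> qhyp as bs q z) F"
proof -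
  let ?gs = "\<lambda>s. map (\<lambda>g. g s) gs" and ?hs = "\<lambda>s. map (\<lambda>h. h s) hs"
  have qp: "((\<lambda>s. qpochs (map (\<lambda>g. g s) gs) q k) \<longlongrightarrow> qpochs as q k) F"
    if "list_all2 (\<lambda>g x. (g \<longlongrightarrow> x) F) gs as" for gs :: "('s \<Rightarrow> complex) list" and as k
    unfolding qpochs_def using that
    by (intro tendsto_prod_list_map) (auto elim!: list_all2_mono intro: tendsto_qpoch)
  have hs_nz: "\<forall>\<^sub>F s in F. \<forall>x\<in>set (?hs s). P x \<noteq> 0"
    using hs nz
  proof induction
    case (Cons h hs x bs)
    have "\<forall>\<^sub>F s in F. P (h s) \<noteq> 0"
      using tendsto_imp_eventually_ne[OF tendsto_qpoch_inf[OF Cons.hyps(1)], of 0] Cons.prems by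
          auto
    then show ?case using Cons.IH Cons.prems by (auto elim: eventually_elim2)
  qed simp
  have qb: "((\<lambda>s. qhyp_bound (?gs s) (?hs s)) \<longlongrightarrow> qhyp_bound as bs) F"
  proof -
    have "list_all2 (\<lambda>h x. ((\<lambda>s. pbound (h s) / norm (P (h s))) \<longlongrightarrow> pbound x
        / norm (P x)) F) ((\<lambda>_. q) # hs) (q # bs)"
      using hs nz
    proof induction
      case (Cons h hs x bs)
      then have "((\<lambda>s. pbound (h s) / norm (P (h s))) \<longlongrightarrow> pbound x / norm (P x)) F"
        by (intro tendsto_divide tendsto_pbound tendsto_norm tendsto_qpoch_inf) auto
      then show ?case using Cons by simp
    qed simp
    from tendsto_prod_list_map[OF this] have
      "((\<lambda>s. \<Prod>x\<leftarrow>q # ?hs s. pbound x / norm (P x)) \<longlongrightarrow> (\<Prod>x\<leftarrow>q # bs. pbound x / norm (P x))) F" by simp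
    moreover have "((\<lambda>s. \<Prod>x\<leftarrow>?gs s. pbound x) \<longlongrightarrow> (\<Prod>x\<leftarrow>as. pbound x)) F"
      using gs by (intro tendsto_prod_list_map) (auto elim!: list_all2_mono intro: tendsto_pbound)
    ultimately show ?thesis unfolding qhyp_bound_def by (rule tendsto_mult[rotated])
  qed
  \<comment> \<open>Any number strictly between \<open>|z|\<close> and \<open>1\<close> serves as the ratio of the dominating geometric
    series.\<close>
  define r where "r = (norm z + 1) / 2"
  have r: "norm z < r" "r < 1" "0 \<le> r" using z by (auto simp: r_def)
  show ?thesis unfolding qhyp_def
  proof (rule tannery[where M = "\<lambda>k. (qhyp_bound as bs + 1) * r ^ k"])
    have "qpochs (q # bs) q k \<noteq> 0" for k
      using nz qpoch_nonzero by (auto simp: qpochs_def prod_list_zero_iff)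
    moreover have "list_all2 (\<lambda>h x. (h \<longlongrightarrow> x) F) ((\<lambda>_. q) # hs) (q # bs)" using hs by simp
    from qp[OF this] have "((\<lambda>s. qpochs (q # ?hs s) q k) \<longlongrightarrow> qpochs (q # bs) q k) F" for k by simp
    ultimately show "((\<lambda>s. qpochs (?gs s) q k / qpochs (q # ?hs s) q k * w s ^ k)
        \<longlongrightarrow> qpochs as q k / qpochs (q # bs) q k * z ^ k) F" for k
      by (intro tendsto_intros qp gs w)
    have "\<forall>\<^sub>F s in F. qhyp_bound (?gs s) (?hs s) < qhyp_bound as bs + 1"
      by (rule order_tendstoD(2)[OF qb]) simp
    moreover have "\<forall>\<^sub>F s in F. norm (w s) < r"
      by (rule order_tendstoD(2)[OF tendsto_norm[OF w]]) (rule r)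
    ultimately show "\<forall>\<^sub>F s in F. \<forall>k. norm (qpochs (?gs s) q k / qpochs (q # ?hs s) q k * w s ^ k)
        \<le> (qhyp_bound as bs + 1) * r ^ k"
      using hs_nz
    proof eventually_elim
      case (elim s)
      have "0 \<le> qhyp_bound (?gs s) (?hs s)"
        unfolding qhyp_bound_def using order.trans[OF zero_le_one pbound_ge_1]
        by (intro mult_nonneg_nonneg prod_list_nonneg) auto
      then have "qhyp_bound (?gs s) (?hs s) * norm (w s) ^ k \<le> (qhyp_bound as bs + 1) * r ^ k" for k
        using elim by (intro mult_mono power_mono) auto
      then show ?case using norm_qhyp_term_le[OF elim(3)] order.trans by blast
    qed
    show "summable (\<lambda>k. (qhyp_bound as bs + 1) * r ^ k)"
      using r by (intro summable_mult summable_geometric) simp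
  qed (rule F)
qed

section \<open>The expansion for generic parameters\<close>

text \<open>The residues of \<open>G(x) dx/x\<close> at \<open>x = q\<^sup>-\<^sup>m/d\<close>, up to sign, where \<open>G\<close> is the function of the
  introduction.\<close>
definition F_summand where
  "F_summand \<kappa> y v a b c d e f m = P (\<kappa> * d * q ^ m) / P (d * q ^ m)
      * (P (q / y * d * q ^ m) / P (v * d * q ^ m))
     * (pf (b * d / a) m * P (q * a / (b * d))) * (pf (c * d / a) m * P (q * a / (c * d)))
     * (pf (q * d / y) m * P (y / d))
     / (pf q m * P q * (pf (q * d / e) m * P (e / d)) * (pf (q * d / f) m * P (f / d))) * q ^ m"

text \<open>The parameter \<open>qd/y\<close> occurs in the numerator and the denominator and leaves \<open>\<theta>(y/d)\<close>, so
  five upper parameters become the four of the series in \<open>F(d;e,f)\<close>. The factor on the left is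
  symmetric in \<open>d\<close>, \<open>e\<close>, \<open>f\<close> and is therefore common to the three terms.\<close>
lemma F_term_series:
  assumes nonzero [simp]: "a \<noteq> 0" "b \<noteq> 0" "c \<noteq> 0" "d \<noteq> 0" "e \<noteq> 0" "f \<noteq> 0"
    and v: "v = q * a / (d * e * f)" and y: "y = b * c * d * e * f / (q * a ^ 2)"
    and \<kappa>: "\<kappa> = b * c / a"
    and nz: "P d \<noteq> 0" "P e \<noteq> 0" "P f \<noteq> 0" "P (v * d) \<noteq> 0" "P (v * e) \<noteq> 0" "P (v * f) \<noteq> 0"
      "P (\<kappa> * d) \<noteq> 0" "P (q / (\<kappa> * d)) \<noteq> 0" "P (e / d) \<noteq> 0" "P (f / d) \<noteq> 0" "P (d / e) \<noteq> 0" "P (d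
          / f) \<noteq> 0"
  shows "P q * (P d * P e * P f) * (P (v * d) * P (v * e) * P (v * f))
      * (\<Sum>m. F_summand \<kappa> y v a b c d e f m)
     = F_term 1 q a b c d e f"
proof -
  define Q where "Q = P (\<kappa> * d) * (P (y / d) * P (q * d / y)) * P (q * a / (b * d))
      * P (q * a / (c * d))
     / (P d * P (v * d) * P q * P (e / d) * P (f / d))"
  let ?as = "[q * a / (e * f), b * d / a, c * d / a, d]" and ?bs
      = "[b * c * d / a, q * d / e, q * d / f]"
  have vd: "v * d = q * a / (e * f)" "v * e = q * a / (d * f)" "v * f = q * a
      / (d * e)" by (simp_all add: v)
  have low: "P (q * d / e) \<noteq> 0" "P (q * d / f) \<noteq> 0"
    using nz(11,12)[THEN qpoch_inf_shift_nonzero, of 1] by (simp_all add: mult_ac)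
  have summand: "F_summand \<kappa> y v a b c d e f m = Q
      * (qpochs ?as q m / qpochs (q # ?bs) q m * q ^ m)" for m
  proof -
    have 1: "P (\<kappa> * d * q ^ m) = P (\<kappa> * d) / pf (\<kappa> * d) m" "P (d * q ^ m) = P d / pf d m"
      "P (v * d * q ^ m) = P (v * d) / pf (v * d) m"
      by (rule qpoch_inf_tail nz)+
    have 2: "P (q * d / y) = pf (q * d / y) m * P (q / y * d * q ^ m)"
      using qpoch_inf_split[of "q * d / y" m] by simp
    have 3: "\<kappa> * d = b * c * d / a" by (simp add: \<kappa>)
    show ?thesis unfolding F_summand_def Q_def 1 2 qpochs_def vd(1)[symmetric] 3[symmetric]
      by (simp add: mult_ac)
  qed
  have "summable (\<lambda>m. qpochs ?as q m / qpochs (q # ?bs) q m * q ^ m)"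
    by (rule summable_qhyp) (use nz(7) low norm_q_less_1 in \<open>simp_all add: \<kappa>\<close>)
  then have "(\<Sum>m. F_summand \<kappa> y v a b c d e f m) = Q * qhyp ?as ?bs q q"
    unfolding summand qhyp_def by (rule suminf_mult)
  moreover have "F_term 1 q a b c d e f = P q * (P d * P e * P f)
      * (P (v * d) * P (v * e) * P (v * f)) * Q * qhyp ?as ?bs q q"
  proof -
    have p: "q powi (1 - 2) = 1 / q" by (simp add: power_int_minus field_simps)
    have t: "q powi (1 - 1) * b * c * d / a = \<kappa> * d" "q powi (1 - 2) * b * c * e * f / a ^ 2 = y
        / d"
      by (simp_all add: \<kappa> y p field_simps power2_eq_square)
    have "q / (y / d) = q * d / y" "q * a / (b * c * d) = q / (\<kappa> * d)" by (simp_all add: \<kappa>)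
    then show ?thesis
      unfolding F_term_def t Q_def vd using nz[unfolded vd]
      by (simp add: qthetas_def qtheta_def qpochs_inf_def mult_ac)
  qed
  ultimately show ?thesis by (simp only: mult.assoc)
qed

text \<open>The balance of residues for the two families \<open>{1, v}\<close> and \<open>{d, e, f}\<close>: the first family is
  evaluated by \<open>nonterminating_Watson\<close>, the second one by \<open>F_term_series\<close>. The hypotheses \<open>gen\<close>,
  \<open>nz\<close> and \<open>ratios\<close> say that all poles are simple.\<close>
lemma three_term_generic:
  fixes a b c d e f :: complex
  assumes nonzero [simp]: "a \<noteq> 0" "b \<noteq> 0" "c \<noteq> 0" "d \<noteq> 0" "e \<noteq> 0" "f \<noteq> 0"
    and conv: "norm (q ^ 2 * a ^ 2) < norm (b * c * d * e * f)"
  defines "v \<equiv> q * a / (d * e * f)" and "\<kappa> \<equiv> b * c / a" and "y \<equiv> b * c * d * e * f / (q * a ^ 2)"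
  assumes gen: "\<And>i j. v * q ^ i \<noteq> q ^ j"
    and nz: "\<And>x. x \<in> {1, v} \<Longrightarrow> P (d * x) \<noteq> 0 \<and> P (e * x) \<noteq> 0 \<and> P (f * x) \<noteq> 0"
    and \<kappa>: "P \<kappa> \<noteq> 0" "P (q / \<kappa>) \<noteq> 0" and y: "P y \<noteq> 0" "P (q / y) \<noteq> 0"
    and low: "P (csqrt a) \<noteq> 0" "P (- csqrt a) \<noteq> 0"
      "P (q * a / b) \<noteq> 0" "P (q * a / c) \<noteq> 0" "P (q * a / d) \<noteq> 0" "P (q * a / e) \<noteq> 0"
      "P (q * a / f) \<noteq> 0"
    and ratios: "P (d / e) \<noteq> 0" "P (d / f) \<noteq> 0" "P (e / d) \<noteq> 0" "P (e / f) \<noteq> 0"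
      "P (f / d) \<noteq> 0" "P (f / e) \<noteq> 0"
    and \<kappa>low: "\<And>x. x \<in> {d, e, f} \<Longrightarrow> P (\<kappa> * x) \<noteq> 0 \<and> P (q / (\<kappa> * x)) \<noteq> 0"
  shows "qtheta \<kappa> q * qtheta y q * (P (q * a / b) * P (q * a / c) * P (q * a / d) * P (q * a / e)
      * P (q * a / f))
     * W87 a b c d e f q (q ^ 2 * a ^ 2 / (b * c * d * e * f))
   = P (q * a) * P (q / \<kappa>) * (F_term 1 q a b c d e f + F_term 1 q a b c e d f
       + F_term 1 q a b c f e d)"
proof -
  have [simp]: "v \<noteq> 0" "\<kappa> \<noteq> 0" "y \<noteq> 0" by (simp_all add: v_def \<kappa>_def y_def)
  have yv: "y * v = \<kappa>" by (simp add: v_def \<kappa>_def y_def power2_eq_square)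
  have y': "y = \<kappa> / v" by (simp add: yv[symmetric])
  have th: "qtheta x q = P x * P (q / x)" for x by (simp add: qtheta_def qpochs_inf_def)
  define G where "G = P q * (P d * P e * P f) * (P (d * v) * P (e * v) * P (f * v))"
  define T where "T = P v * P (q / v)"
  define L where "L = P (q * a / b) * P (q * a / c) * P (q * a / d) * P (q * a / e) * P (q * a / f)"
  define w where "w = watson_weight a b c d e f v"
  define A where "A = (\<lambda>i. [q * a / b, q * a / c, y] ! i)"
  define C where "C = (\<lambda>i. [d, e, f] ! i)"
  define B where "B = (\<lambda>i. [\<kappa>, q / y] ! i)"
  define D where "D = (\<lambda>i. [1, v] ! i)"
  note fam = A_def B_def C_def D_def
  \<comment> \<open>Both products equal \<open>q\<close>: this is the argument of the \<open>\<^sub>4\<phi>\<^sub>3\<close> series and fixes the choice of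
    \<open>y\<close>.\<close>
  have z1: "(\<Prod>i\<in>{0,1,2}. A i / C i) = q"
    by (simp add: fam y_def power2_eq_square field_simps)
  have z2: "(\<Prod>j\<in>{0,1}. B j / D j) = q"
    by (simp add: fam y')
  have v1: "P v \<noteq> 0" "P (q / v) \<noteq> 0" "P (1 / v) \<noteq> 0" "1 - v \<noteq> 0"
  proof -
    show "P v \<noteq> 0" using gen[of _ 0] by (auto simp: qpoch_inf_eq_0_iff)
    show 1: "P (1 / v) \<noteq> 0" using gen[of 0] by (auto simp: qpoch_inf_eq_0_iff field_simps)
    show "P (q / v) \<noteq> 0" using qpoch_inf_shift_nonzero[OF 1, of 1] by simp
    show "1 - v \<noteq> 0" using gen[of 0 0] by auto
  qed
  define K where "K = P y * P (q / y) * (P \<kappa> * P (q / \<kappa>)) / (P q * P q * T)"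
  have r1: "residue_term {0,1,2} {0,1} A B C D 0 m = K * (1 * q ^ m * w (1 * q ^ m))" for m
  proof -
    have s1: "pf q m = P q / P (q * q ^ m)" "pf (q / v) m = P (q / v) / P (q / v * q ^ m)"
       "pf (q / \<kappa>) m = P (q / \<kappa>) / P (q / \<kappa> * q ^ m)" "P (y * q ^ m) = P y / pf y m"
      by (rule qpoch_as_quotient qpoch_inf_tail qpoch_q_nonzero v1 \<kappa> y)+
    have "pf y m \<noteq> 0" "P (q * q ^ m) \<noteq> 0" "P (q / v * q ^ m) \<noteq> 0" "P (q / \<kappa> * q ^ m) \<noteq> 0"
      by (rule qpoch_nonzero[OF y(1)] qpoch_inf_shift_nonzero qpoch_q_nonzero v1 \<kappa>)+
    moreover have "residue_term {0,1,2} {0,1} A B C D 0 m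
      = P (q * a / b * q ^ m) / P (d * q ^ m) * (P (q * a / c * q ^ m) / P (e * q ^ m))
          * (P (y * q ^ m) / P (f * q ^ m))
        * (pf (q / \<kappa>) m * P \<kappa> / (pf q m * P q)) * (pf y m * P (q / y) / (pf (q / v) m * P v))
            * q ^ m"
      unfolding residue_term_def z2 by (simp add: fam mult_ac)
    moreover have "w (1 * q ^ m) = P (q * q ^ m) * P (q / v * q ^ m) * P (q * a / b * q ^ m)
        * P (q * a / c * q ^ m)
     / (P (d * q ^ m) * P (e * q ^ m) * P (f * q ^ m) * P (q / \<kappa> * q ^ m))"
      unfolding w_def watson_weight_def by (simp add: \<kappa>_def mult_ac)
    ultimately show ?thesis
      unfolding s1 K_def T_def by (simp add: mult_ac)
  qed
  have r2: "residue_term {0,1,2} {0,1} A B C D 1 m = - K * (v * q ^ m * w (v * q ^ m))" for m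
  proof -
    have qv: "P (q * v) \<noteq> 0" using v1(1) qpoch_inf_rec[of v] by (auto simp: mult_ac)
    have s1: "pf q m = P q / P (q * q ^ m)" "pf (q * v) m = P (q * v) / P (q * v * q ^ m)"
       "pf (q / y) m = P (q / y) / P (q / y * q ^ m)" "P (\<kappa> * q ^ m) = P \<kappa> / pf \<kappa> m"
      by (rule qpoch_as_quotient qpoch_inf_tail qpoch_q_nonzero qv \<kappa> y)+
    have nzs: "pf \<kappa> m \<noteq> 0" "P (q * q ^ m) \<noteq> 0" "P (q * v * q ^ m) \<noteq> 0" "P (q / y * q ^ m) \<noteq> 0"
      by (rule qpoch_nonzero[OF \<kappa>(1)] qpoch_inf_shift_nonzero qpoch_q_nonzero qv y)+
    \<comment> \<open>The relation \<open>\<theta>(1/v) = - \<theta>(v)/v\<close>; it turns the sum of the two families of residues into a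
      difference of \<open>q\<close>-integrals.\<close>
    have T: "P (q * v) * P (1 / v) = - (1 / v) * T"
    proof -
      have "P v = (1 - v) * P (q * v)" using qpoch_inf_rec[of v] by (simp add: mult.commute)
      moreover have "P (1 / v) = - (1 / v) * (1 - v) * P (q / v)"
        using qpoch_inf_rec[of "1 / v"] by (simp add: field_simps)
      ultimately show ?thesis unfolding T_def by (simp add: mult_ac)
    qed
    have q': "q * v / (q / y) = \<kappa>" "q / y / v = q / \<kappa>" "\<kappa> / v = y" "q * v / \<kappa> = q / y"
      by (simp_all add: yv[symmetric])
    have "residue_term {0,1,2} {0,1} A B C D 1 m
      = P (q * a / b * v * q ^ m) / P (d * v * q ^ m)
          * (P (q * a / c * v * q ^ m) / P (e * v * q ^ m)) * (P (\<kappa> * q ^ m) / P (f * v * q ^ m))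
        * (pf \<kappa> m * P (q / \<kappa>) / (pf q m * P q))
            * (pf (q / y) m * P y / (pf (q * v) m * P (1 / v))) * q ^ m"
    proof -
      have "P (v * (y * q ^ m)) = P (\<kappa> * q ^ m)" by (simp add: yv[symmetric] mult_ac)
      then show ?thesis
        unfolding residue_term_def z2 by (simp add: fam insert_Diff_if q'[simplified] mult_ac)
    qed
    moreover have "w (v * q ^ m) = P (q * v * q ^ m) * P (q * q ^ m) * P (q * a / b * v * q ^ m)
        * P (q * a / c * v * q ^ m)
     / (P (d * v * q ^ m) * P (e * v * q ^ m) * P (f * v * q ^ m) * P (q / y * q ^ m))"
      unfolding w_def watson_weight_def using q'(4)[symmetric] by (simp add: \<kappa>_def mult_ac)
    ultimately show ?thesis
      using T nzs unfolding s1 K_def by (simp add: mult_ac)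
  qed
  have sw: "summable (\<lambda>m. x * q ^ m * w (x * q ^ m))" if "x \<in> {1, v}" for x
  proof -
    have "P (a * q * x / (b * c)) \<noteq> 0"
    proof (cases "x = 1")
      case True then show ?thesis using \<kappa>(2) by (simp add: \<kappa>_def mult_ac)
    next
      case False
      then have "x = v" using that by simp
      moreover have "a * q * v / (b * c) = q / y" unfolding y' by (simp add: \<kappa>_def mult_ac)
      ultimately show ?thesis using y(2) by simp
    qed
    then show ?thesis unfolding w_def using nz[OF that] by (intro summable_watson_weight) auto
  qed
  have SD: "(\<Sum>j\<in>{0,1}. \<Sum>m. residue_term {0,1,2} {0,1} A B C D j m) = K
      * (q_integral w 1 - q_integral w v)"
  proof -
    have "(\<Sum>m. residue_term {0,1,2} {0,1} A B C D 0 m) = K * q_integral w 1"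
      unfolding r1 q_integral_def by (rule suminf_mult) (rule sw, simp)
    moreover have "(\<Sum>m. residue_term {0,1,2} {0,1} A B C D 1 m) = - K * q_integral w v"
      unfolding r2 q_integral_def by (rule suminf_mult) (rule sw, simp)
    ultimately show ?thesis by (simp add: algebra_simps)
  qed
  have rC: "residue_term {0,1} {0,1,2} B A D C 0 m = F_summand \<kappa> y v a b c d e f m"
    "residue_term {0,1} {0,1,2} B A D C 1 m = F_summand \<kappa> y v a b c e d f m"
    "residue_term {0,1} {0,1,2} B A D C 2 m = F_summand \<kappa> y v a b c f d e m" for m
    unfolding residue_term_def z1 F_summand_def by (simp_all add: fam insert_Diff_if mult_ac)
  have vs: "v = q * a / (e * d * f)" "v = q * a / (f * d * e)"
    "y = b * c * e * d * f / (q * a ^ 2)" "y = b * c * f * d * e / (q * a ^ 2)"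
    "v = q * a / (d * e * f)" "y = b * c * d * e * f / (q * a ^ 2)" and \<kappa>_eq: "\<kappa> = b * c / a"
    by (simp_all add: v_def y_def \<kappa>_def mult_ac)
  have nzs: "P d \<noteq> 0" "P e \<noteq> 0" "P f \<noteq> 0" "P (v * d) \<noteq> 0" "P (v * e) \<noteq> 0" "P (v * f) \<noteq> 0"
    using nz[of 1] nz[of v] by (auto simp: mult.commute)
  have SC: "G * (\<Sum>i\<in>{0,1,2}. \<Sum>m. residue_term {0,1} {0,1,2} B A D C i m)
    = F_term 1 q a b c d e f + F_term 1 q a b c e d f + F_term 1 q a b c f e d"
  proof -
    have "F_term 1 q a b c f e d = F_term 1 q a b c f d e"
      by (simp add: F_term_def qpochs_inf_def qhyp_def qpochs_def mult_ac)
    moreover have "G * (\<Sum>m. F_summand \<kappa> y v a b c d e f m) = F_term 1 q a b c d e f"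
      using F_term_series[OF nonzero vs(5,6) \<kappa>_eq] nzs ratios \<kappa>low
      by (simp add: G_def mult_ac)
    moreover have "G * (\<Sum>m. F_summand \<kappa> y v a b c e d f m) = F_term 1 q a b c e d f"
      using F_term_series[OF nonzero(1-3) nonzero(5,4,6) vs(1,3) \<kappa>_eq] nzs ratios \<kappa>low
      by (simp add: G_def mult_ac)
    moreover have "G * (\<Sum>m. F_summand \<kappa> y v a b c f d e m) = F_term 1 q a b c f d e"
      using F_term_series[OF nonzero(1-3) nonzero(6,4,5) vs(2,4) \<kappa>_eq] nzs ratios \<kappa>low
      by (simp add: G_def mult_ac)
    ultimately show ?thesis unfolding rC[symmetric] by (simp add: distrib_left)
  qed
  have bal: "(\<Sum>j\<in>{0,1}. \<Sum>m. residue_term {0,1,2} {0,1} A B C D j m)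
      = (\<Sum>i\<in>{0,1,2}. \<Sum>m. residue_term {0,1} {0,1,2} B A D C i m)"
  proof (rule residue_series_balance)
    show "norm (\<Prod>i\<in>{0,1,2}. A i / C i) < 1" "norm (\<Prod>j\<in>{0,1}. B j / D j) < 1"
      unfolding z1 z2 by (rule norm_q_less_1)+
  qed (use nzs ratios v1 in \<open>auto simp: fam mult.commute\<close>)
  have a1: "1 - a \<noteq> 0"
  proof
    assume "1 - a = 0"
    then have "csqrt a = 1" by simp
    with low(1) show False using qpoch_inf_rec[of 1] by simp
  qed
  define W where "W = W87 a b c d e f q (q ^ 2 * a ^ 2 / (b * c * d * e * f))"
  have z: "norm (q ^ 2 * a ^ 2 / (b * c * d * e * f)) < 1"
    using conv by (simp add: norm_divide)
  have W: "(1 - a) * W = (\<Sum>k. vwp_term a b c d e f (q ^ 2 * a ^ 2 / (b * c * d * e * f)) k)"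
    unfolding W_def by (rule W87_eq_vwp[OF low(1,2) summable_vwp_term[OF z low(3-7)]])
  have aq: "a * q / (b * c) = q / \<kappa>" by (simp add: \<kappa>_def)
  have watson: "P d * P e * P f * P (d * v) * P (e * v) * P (f * v) * (P a * P (q / \<kappa>))
      * (q_integral w 1 - q_integral w v)
     = P q * T * L * ((1 - a) * W)"
    using nonterminating_Watson[OF nonzero conv, folded v_def, OF gen nz _ low(3-7)] \<kappa>(2)
    unfolding aq W[symmetric] w_def[symmetric] T_def L_def by (simp add: mult_ac)
  have "(1 - a) * (P (q * a) * P (q / \<kappa>) * (G * (K * (q_integral w 1 - q_integral w v))))
    = K * P q * (P d * P e * P f * P (d * v) * P (e * v) * P (f * v) * (P a * P (q / \<kappa>))
        * (q_integral w 1 - q_integral w v))"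
    using qpoch_inf_rec[of a] unfolding G_def by (simp add: mult_ac)
  also have "\<dots> = (1 - a) * (P y * P (q / y) * (P \<kappa> * P (q / \<kappa>)) * L * W)"
    unfolding watson K_def using v1 by (simp add: T_def mult_ac)
  finally have "P (q * a) * P (q / \<kappa>) * (G * (K * (q_integral w 1 - q_integral w v))) = P y
      * P (q / y) * (P \<kappa> * P (q / \<kappa>)) * L * W"
    using a1 by simp
  then show ?thesis
    unfolding SD[symmetric] bal SC th W_def L_def by (simp only: mult_ac)
qed

section \<open>Quasi-periodicity, coinciding poles and the final formula\<close>

lemma qtheta_eq: "qtheta x q = P x * P (q / x)"
  by (simp add: qtheta_def qpochs_inf_def)

lemma qtheta_q_shift:
  assumes "x \<noteq> 0"
  shows "x * qtheta (q * x) q = - qtheta x q"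
proof -
  have 1: "P x = (1 - x) * P (q * x)" using qpoch_inf_rec[of x] by (simp add: mult.commute)
  have 2: "P (1 / x) = (1 - 1 / x) * P (q / x)" using qpoch_inf_rec[of "1 / x"] by simp
  have "x * qtheta (q * x) q = x * (1 - 1 / x) * (P (q * x) * P (q / x))"
  proof -
    have "q / (q * x) = 1 / x" by simp
    then show ?thesis unfolding qtheta_eq by (simp only: 2 mult_ac)
  qed
  also have "x * (1 - 1 / x) = - (1 - x)" using assms by (simp add: algebra_simps)
  finally show ?thesis unfolding qtheta_eq[of x] 1 by (simp only: mult_ac mult_minus_left)
qed

text \<open>The factor \<open>C\<close> depends on \<open>x\<close> and \<open>y\<close> only through their product. All pairs of theta
  functions in the final formula, in the three numerators and in the denominator, have the same
  product of arguments, so the shift by \<open>n\<close> cancels.\<close>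
lemma qtheta_pair_shift:
  fixes n :: int
  assumes "p \<noteq> 0"
  shows "\<exists>C. C \<noteq> 0 \<and> (\<forall>x y. x * y = p \<longrightarrow> qtheta (q powi n * x) q * qtheta (q powi n * y) q = C
      * (qtheta x q * qtheta y q))"
proof -
  have step: "qtheta (q * x) q * qtheta (q * y) q * (x * y) = qtheta x q * qtheta y q"
    if "x \<noteq> 0" "y \<noteq> 0" for x y
  proof -
    have "qtheta (q * x) q * qtheta (q * y) q * (x * y) = (x * qtheta (q * x) q)
        * (y * qtheta (q * y) q)"
      by (simp only: mult_ac)
    then show ?thesis by (simp add: qtheta_q_shift that)
  qed
  have step': "qtheta (q powi (i + 1) * x) q * qtheta (q powi (i + 1) * y) q
      * (q powi i * q powi i * p)
      = qtheta (q powi i * x) q * qtheta (q powi i * y) q" if "x * y = p" for x y i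
    using step[of "q powi i * x" "q powi i * y"] that assms
    by (auto simp: power_int_add mult_ac)
  show ?thesis
  proof (induction n rule: int_induct[where k = 0])
    case base
    show ?case by (intro exI[of _ 1]) simp
  next
    case (step1 i)
    then obtain C where C: "C \<noteq> 0" "\<And>x y. x * y = p \<Longrightarrow> qtheta (q powi i * x) q
        * qtheta (q powi i * y) q = C * (qtheta x q * qtheta y q)"
      by blast
    show ?case
    proof (intro exI[of _ "C / (q powi i * q powi i * p)"] conjI allI impI)
      fix x y assume xy: "x * y = p"
      show "qtheta (q powi (i + 1) * x) q * qtheta (q powi (i + 1) * y) q
          = C / (q powi i * q powi i * p) * (qtheta x q * qtheta y q)"
        using step'[OF xy, of i] C(2)[OF xy] assms by (simp add: field_simps)
    qed (use C assms in auto)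
  next
    case (step2 i)
    then obtain C where C: "C \<noteq> 0" "\<And>x y. x * y = p \<Longrightarrow> qtheta (q powi i * x) q
        * qtheta (q powi i * y) q = C * (qtheta x q * qtheta y q)"
      by blast
    show ?case
    proof (intro exI[of _ "C * (q powi (i - 1) * q powi (i - 1) * p)"] conjI allI impI)
      fix x y assume xy: "x * y = p"
      show "qtheta (q powi (i - 1) * x) q * qtheta (q powi (i - 1) * y) q
          = C * (q powi (i - 1) * q powi (i - 1) * p) * (qtheta x q * qtheta y q)"
        using step'[OF xy, of "i - 1"] C(2)[OF xy] by (simp add: mult_ac)
    qed (use C assms in auto)
  qed
qed

text \<open>The zeros of \<open>(x;q)\<^sub>\<infinity>\<close> are isolated: near a given point only finitely many factors can
  vanish.\<close>
lemma eventually_qpoch_inf_nonzero: "eventually (\<lambda>x. P x \<noteq> 0) (at x0)"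
proof -
  define B where "B = norm x0 + 1"
  have "(\<lambda>J. B * norm q ^ J) \<longlonglongrightarrow> 0"
    using norm_q_less_1 by (intro tendsto_mult_right_zero LIMSEQ_power_zero) simp
  then have "eventually (\<lambda>J. B * norm q ^ J < 1) sequentially" by (rule order_tendstoD) simp
  then obtain J where J: "B * norm q ^ J < 1" by (auto simp: eventually_sequentially)
  have near: "eventually (\<lambda>x. norm x < B) (at x0)"
    by (rule order_tendstoD(2)[OF tendsto_norm[OF tendsto_ident_at]]) (simp add: B_def)
  have "eventually (\<lambda>x. 1 - x * q ^ j \<noteq> 0) (at x0)" for j
  proof (cases "1 - x0 * q ^ j = 0")
    case True
    then have x0: "x0 * q ^ j = 1" by simp
    have "x0 = x" if "1 - x * q ^ j = 0" for x
    proof -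
      have "x * q ^ j = x0 * q ^ j" using that x0 by simp
      then show ?thesis by simp
    qed
    then show ?thesis unfolding eventually_at_filter by (intro always_eventually) metis
  next
    case False
    then show ?thesis by (intro tendsto_imp_eventually_ne[where c = "1 - x0
        * q ^ j"]) (auto intro!: tendsto_intros)
  qed
  then have "eventually (\<lambda>x. \<forall>j\<in>{..<J}. 1 - x * q ^ j \<noteq> 0) (at x0)"
    by (intro eventually_ball_finite) auto
  with near show ?thesis
  proof eventually_elim
    case (elim x)
    have "norm (x * q ^ J) \<le> B * norm q ^ J"
      using elim(1) by (simp add: norm_mult norm_power mult_right_mono)
    then have "P (x * q ^ J) \<noteq> 0" using J by (intro qpoch_inf_small) simp
    moreover have "pf x J \<noteq> 0" using elim(2) by (simp add: qpoch_def)
    ultimately show ?case using qpoch_inf_split[of x J] by simp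
  qed
qed

lemma eventually_rescaled_nonzero:
  fixes u :: complex
  assumes "u \<noteq> 0" "k > 0"
  shows "eventually (\<lambda>s. P (u * complex_of_real s ^ k) \<noteq> 0) (at_right 1)"
    and "eventually (\<lambda>s. P (u / complex_of_real s ^ k) \<noteq> 0) (at_right 1)"
proof -
  have gt: "eventually (\<lambda>s::real. 1 < s) (at_right 1)" by (simp add: eventually_at_right_less)
  have ne: "complex_of_real s ^ k \<noteq> 1" if "1 < s" for s
  proof
    assume "complex_of_real s ^ k = 1"
    then have "s ^ k = 1" by (metis of_real_eq_1_iff of_real_power)
    with one_less_power[OF that assms(2)] show False by simp
  qed
  have s1: "((\<lambda>s. complex_of_real s) \<longlongrightarrow> complex_of_real 1) (at_right 1)"
    by (intro tendsto_of_real tendsto_ident_at)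
  have "((\<lambda>s. u * complex_of_real s ^ k) \<longlongrightarrow> u * complex_of_real 1 ^ k) (at_right 1)"
    by (intro tendsto_intros s1)
  then have "filterlim (\<lambda>s. u * complex_of_real s ^ k) (at u) (at_right 1)"
    using gt by (intro filterlim_atI) (auto elim!: eventually_mono simp: assms ne)
  from eventually_compose_filterlim[OF eventually_qpoch_inf_nonzero this]
  show "eventually (\<lambda>s. P (u * complex_of_real s ^ k) \<noteq> 0) (at_right 1)" .
  have "((\<lambda>s. u / complex_of_real s ^ k) \<longlongrightarrow> u / complex_of_real 1 ^ k) (at_right 1)"
    by (intro tendsto_intros s1) auto
  moreover have "u / complex_of_real s ^ k \<noteq> u" if "1 < s" for s
    using ne[OF that] assms(1) that by (auto simp: field_simps)
  ultimately have "filterlim (\<lambda>s. u / complex_of_real s ^ k) (at u) (at_right 1)"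
    using gt by (intro filterlim_atI) (auto elim!: eventually_mono)
  from eventually_compose_filterlim[OF eventually_qpoch_inf_nonzero this]
  show "eventually (\<lambda>s. P (u / complex_of_real s ^ k) \<noteq> 0) (at_right 1)" .
qed

lemma tendsto_F_term:
  fixes D E G :: "'s \<Rightarrow> complex"
  assumes lim: "(D \<longlongrightarrow> d) F" "(E \<longlongrightarrow> e) F" "(G \<longlongrightarrow> f) F" and F: "F \<noteq> bot"
    and nonzero: "a \<noteq> 0" "b \<noteq> 0" "c \<noteq> 0" "d \<noteq> 0" "e \<noteq> 0" "f \<noteq> 0"
    and ok: "F_denom_ok q a b c d e f"
  shows "((\<lambda>s. F_term 1 q a b c (D s) (E s) (G s)) \<longlongrightarrow> F_term 1 q a b c d e f) F"
proof -
  have nz: "P (q * a / (b * c * d)) \<noteq> 0" "P (e / d) \<noteq> 0" "P (f / d) \<noteq> 0"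
    "P (b * c * d / a) \<noteq> 0" "P (q * d / e) \<noteq> 0" "P (q * d / f) \<noteq> 0"
    using ok by (auto simp: F_denom_ok_def qhyp_lower_ok_iff)
  have series: "((\<lambda>s. qhyp [q * a / (E s * G s), b * D s / a, c * D s / a, D s]
       [b * c * D s / a, q * D s / E s, q * D s / G s] q q) \<longlongrightarrow>
     qhyp [q * a / (e * f), b * d / a, c * d / a, d] [b * c * d / a, q * d / e, q * d / f] q q) F"
  proof -
    have "((\<lambda>s. qhyp (map (\<lambda>g. g s) [\<lambda>s. q * a / (E s * G s), \<lambda>s. b * D s / a, \<lambda>s. c * D s / a, D])
       (map (\<lambda>g. g s) [\<lambda>s. b * c * D s / a, \<lambda>s. q * D s / E s, \<lambda>s. q * D s / G s]) q q) \<longlongrightarrow>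
     qhyp [q * a / (e * f), b * d / a, c * d / a, d] [b * c * d / a, q * d / e, q * d / f] q q) F"
      using nonzero nz norm_q_less_1 F
      by (intro tendsto_qhyp) (auto intro!: tendsto_intros lim)
    then show ?thesis by simp
  qed
  show ?thesis
    unfolding F_term_def qthetas_def qpochs_inf_def qtheta_def
    unfolding list.map prod_list.Cons prod_list.Nil mult_1_right
    by (intro tendsto_mult tendsto_divide tendsto_const tendsto_qpoch_inf lim series)
       (use nonzero nz in auto)
qed

lemma tendsto_W87:
  fixes D E G :: "'s \<Rightarrow> complex"
  assumes lim: "(D \<longlongrightarrow> d) F" "(E \<longlongrightarrow> e) F" "(G \<longlongrightarrow> f) F" and F: "F \<noteq> bot"
    and nonzero: "a \<noteq> 0" "b \<noteq> 0" "c \<noteq> 0" "d \<noteq> 0" "e \<noteq> 0" "f \<noteq> 0"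
    and ok: "qhyp_lower_ok (W87_lower a b c d e f q) q"
    and w: "(w \<longlongrightarrow> z) F" and z: "norm z < 1"
  shows "((\<lambda>s. W87 a b c (D s) (E s) (G s) q (w s)) \<longlongrightarrow> W87 a b c d e f q z) F"
proof -
  have "((\<lambda>s. qhyp (map (\<lambda>g. g s) [\<lambda>s. a, \<lambda>s. q * csqrt a, \<lambda>s.
      - (q * csqrt a), \<lambda>s. b, \<lambda>s. c, D, E, G])
     (map (\<lambda>g. g s) [\<lambda>s. csqrt a, \<lambda>s. - csqrt a, \<lambda>s. q * a / b, \<lambda>s. q * a / c, \<lambda>s. q * a
         / D s, \<lambda>s. q * a / E s, \<lambda>s. q * a / G s]) q (w s))
    \<longlongrightarrow> qhyp [a, q * csqrt a, - (q * csqrt a), b, c, d, e, f] (W87_lower a b c d e f q) q z) F"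
    using nonzero ok[unfolded qhyp_lower_ok_iff] F z
    by (intro tendsto_qhyp) (auto simp: W87_lower_def intro!: tendsto_intros lim w)
  then show ?thesis by (simp add: W87_def W87_lower_def)
qed

text \<open>Removes the genericity conditions by the rescaling \<open>(d, e, f) \<mapsto> (ds, es, fs)\<close>. It
  multiplies the quantities that have to avoid powers of \<open>q\<close> by nonzero powers of \<open>s\<close>, whereas
  \<open>a\<close>, \<open>b\<close>, \<open>c\<close> and the ratios of \<open>d\<close>, \<open>e\<close>, \<open>f\<close> stay fixed; the remaining conditions are open.\<close>
lemma three_term:
  fixes a b c d e f :: complex
  assumes nonzero [simp]: "a \<noteq> 0" "b \<noteq> 0" "c \<noteq> 0" "d \<noteq> 0" "e \<noteq> 0" "f \<noteq> 0"
    and conv: "norm (q ^ 2 * a ^ 2) < norm (b * c * d * e * f)"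
    and lower: "qhyp_lower_ok (W87_lower a b c d e f q) q"
    and theta: "qtheta (b * c / a) q \<noteq> 0" "qtheta (b * c * d * e * f / (q * a ^ 2)) q \<noteq> 0"
    and Fok: "F_denom_ok q a b c d e f" "F_denom_ok q a b c e d f" "F_denom_ok q a b c f e d"
  shows "qtheta (b * c / a) q * qtheta (b * c * d * e * f / (q * a ^ 2)) q
     * (P (q * a / b) * P (q * a / c) * P (q * a / d) * P (q * a / e) * P (q * a / f))
     * W87 a b c d e f q (q ^ 2 * a ^ 2 / (b * c * d * e * f))
   = P (q * a) * P (q / (b * c / a)) * (F_term 1 q a b c d e f + F_term 1 q a b c e d f
       + F_term 1 q a b c f e d)"
proof -
  define F where "F = at_right (1::real)"
  define D where "D s = d * complex_of_real s ^ 1" for s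
  define E where "E s = e * complex_of_real s ^ 1" for s
  define G where "G s = f * complex_of_real s ^ 1" for s
  define lhs where "lhs d e f = qtheta (b * c / a) q * qtheta (b * c * d * e * f / (q * a ^ 2)) q
     * (P (q * a / b) * P (q * a / c) * P (q * a / d) * P (q * a / e) * P (q * a / f))
     * W87 a b c d e f q (q ^ 2 * a ^ 2 / (b * c * d * e * f))" for d e f
  define rhs where "rhs d e f = P (q * a) * P (q / (b * c / a))
     * (F_term 1 q a b c d e f + F_term 1 q a b c e d f + F_term 1 q a b c f e d)" for d e f
  have F: "F \<noteq> bot" by (simp add: F_def)
  have s1: "((\<lambda>s. complex_of_real s) \<longlongrightarrow> complex_of_real 1) F"
    unfolding F_def by (intro tendsto_of_real tendsto_ident_at)
  have "(D \<longlongrightarrow> d * complex_of_real 1 ^ 1) F" "(E \<longlongrightarrow> e * complex_of_real 1 ^ 1) F"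
    "(G \<longlongrightarrow> f * complex_of_real 1 ^ 1) F"
    unfolding D_def E_def G_def by (intro tendsto_intros s1)+
  then have lim: "(D \<longlongrightarrow> d) F" "(E \<longlongrightarrow> e) F" "(G \<longlongrightarrow> f) F" by simp_all
  have z: "norm (q ^ 2 * a ^ 2 / (b * c * d * e * f)) < 1"
    using conv by (simp add: norm_divide)
  have low: "P (csqrt a) \<noteq> 0" "P (- csqrt a) \<noteq> 0" "P (q * a / b) \<noteq> 0" "P (q * a / c) \<noteq> 0"
    "P (q * a / d) \<noteq> 0" "P (q * a / e) \<noteq> 0" "P (q * a / f) \<noteq> 0"
    using lower by (auto simp: qhyp_lower_ok_iff W87_lower_def)
  have L1: "((\<lambda>s. lhs (D s) (E s) (G s)) \<longlongrightarrow> lhs d e f) F"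
    unfolding lhs_def qtheta_eq
    by (intro tendsto_mult tendsto_const tendsto_qpoch_inf tendsto_divide tendsto_W87 lim F lower z)
       auto
  have L2: "((\<lambda>s. rhs (D s) (E s) (G s)) \<longlongrightarrow> rhs d e f) F"
    unfolding rhs_def
    by (intro tendsto_mult tendsto_const tendsto_add tendsto_F_term lim F Fok) auto
  have "eventually (\<lambda>s. lhs (D s) (E s) (G s) = rhs (D s) (E s) (G s)) F"
  proof -
    have gt: "eventually (\<lambda>s. 1 < s) F" by (simp add: F_def eventually_at_right_less)
    have ev: "eventually (\<lambda>s. P (h s) \<noteq> 0) F" if "(h \<longlongrightarrow> x) F" "P x \<noteq> 0" for h x
      using tendsto_imp_eventually_ne[OF tendsto_qpoch_inf[OF that(1)] that(2)] .
    have conv': "eventually (\<lambda>s. norm (q ^ 2 * a ^ 2) < norm (b * c * D s * E s * G s)) F"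
      by (rule order_tendstoD(1)[OF _ conv]) (intro tendsto_intros lim)
    note Fnz = Fok[unfolded F_denom_ok_def qhyp_lower_ok_iff, simplified]
    have T: "((\<lambda>s. b * c * D s * E s * G s / (q * a ^ 2)) \<longlongrightarrow> b * c * d * e * f / (q * a ^ 2)) F"
      "((\<lambda>s. q / (b * c * D s * E s * G s / (q * a ^ 2))) \<longlongrightarrow> q
          / (b * c * d * e * f / (q * a ^ 2))) F"
      "((\<lambda>s. q * a / D s) \<longlongrightarrow> q * a / d) F"
      "((\<lambda>s. q * a / E s) \<longlongrightarrow> q * a / e) F"
      "((\<lambda>s. q * a / G s) \<longlongrightarrow> q * a / f) F"
      "((\<lambda>s. D s / E s) \<longlongrightarrow> d / e) F"
      "((\<lambda>s. D s / G s) \<longlongrightarrow> d / f) F"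
      "((\<lambda>s. E s / D s) \<longlongrightarrow> e / d) F"
      "((\<lambda>s. E s / G s) \<longlongrightarrow> e / f) F"
      "((\<lambda>s. G s / D s) \<longlongrightarrow> f / d) F"
      "((\<lambda>s. G s / E s) \<longlongrightarrow> f / e) F"
      "((\<lambda>s. b * c / a * D s) \<longlongrightarrow> b * c / a * d) F"
      "((\<lambda>s. b * c / a * E s) \<longlongrightarrow> b * c / a * e) F"
      "((\<lambda>s. b * c / a * G s) \<longlongrightarrow> b * c / a * f) F"
      "((\<lambda>s. q / (b * c / a * D s)) \<longlongrightarrow> q / (b * c / a * d)) F"
      "((\<lambda>s. q / (b * c / a * E s)) \<longlongrightarrow> q / (b * c / a * e)) F"
      "((\<lambda>s. q / (b * c / a * G s)) \<longlongrightarrow> q / (b * c / a * f)) F"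
      by (intro tendsto_intros lim; simp)+
    have N: "P (b * c * d * e * f / (q * a ^ 2)) \<noteq> 0"
      "P (q / (b * c * d * e * f / (q * a ^ 2))) \<noteq> 0"
      "P (q * a / d) \<noteq> 0"
      "P (q * a / e) \<noteq> 0"
      "P (q * a / f) \<noteq> 0"
      "P (d / e) \<noteq> 0"
      "P (d / f) \<noteq> 0"
      "P (e / d) \<noteq> 0"
      "P (e / f) \<noteq> 0"
      "P (f / d) \<noteq> 0"
      "P (f / e) \<noteq> 0"
      "P (b * c / a * d) \<noteq> 0"
      "P (b * c / a * e) \<noteq> 0"
      "P (b * c / a * f) \<noteq> 0"
      "P (q / (b * c / a * d)) \<noteq> 0"
      "P (q / (b * c / a * e)) \<noteq> 0"
      "P (q / (b * c / a * f)) \<noteq> 0"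
      using theta low Fnz by (simp_all add: qtheta_eq mult_ac)
    have open_conds: "eventually (\<lambda>s. P (b * c * D s * E s * G s / (q * a ^ 2)) \<noteq> 0
        \<and> P (q / (b * c * D s * E s * G s / (q * a ^ 2))) \<noteq> 0) F"
      "eventually (\<lambda>s. P (q * a / D s) \<noteq> 0 \<and> P (q * a / E s) \<noteq> 0 \<and> P (q * a / G s) \<noteq> 0) F"
      "eventually (\<lambda>s. P (D s / E s) \<noteq> 0 \<and> P (D s / G s) \<noteq> 0 \<and> P (E s / D s) \<noteq> 0
          \<and> P (E s / G s) \<noteq> 0 \<and> P (G s / D s) \<noteq> 0 \<and> P (G s / E s) \<noteq> 0) F"
      "eventually (\<lambda>s. P (b * c / a * D s) \<noteq> 0 \<and> P (b * c / a * E s) \<noteq> 0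
          \<and> P (b * c / a * G s) \<noteq> 0) F"
      "eventually (\<lambda>s. P (q / (b * c / a * D s)) \<noteq> 0 \<and> P (q / (b * c / a * E s)) \<noteq> 0
          \<and> P (q / (b * c / a * G s)) \<noteq> 0) F"
      by (intro eventually_conj ev[OF T(1) N(1)] ev[OF T(2) N(2)] ev[OF T(3) N(3)] ev[OF T(4)
          N(4)] ev[OF T(5) N(5)] ev[OF T(6) N(6)] ev[OF T(7) N(7)] ev[OF T(8) N(8)] ev[OF T(9)
              N(9)] ev[OF T(10) N(10)] ev[OF T(11) N(11)] ev[OF T(12) N(12)] ev[OF T(13) N(13)]
                  ev[OF T(14) N(14)] ev[OF T(15) N(15)] ev[OF T(16) N(16)] ev[OF T(17) N(17)])+
    have generic_conds: "eventually (\<lambda>s. P (d * complex_of_real s ^ 1) \<noteq> 0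
        \<and> P (e * complex_of_real s ^ 1) \<noteq> 0
        \<and> P (f * complex_of_real s ^ 1) \<noteq> 0) F"
      "eventually (\<lambda>s. P (q * a / (e * f) / complex_of_real s ^ 2) \<noteq> 0
        \<and> P (q * a / (d * f) / complex_of_real s ^ 2) \<noteq> 0
            \<and> P (q * a / (d * e) / complex_of_real s ^ 2) \<noteq> 0) F"
      "eventually (\<lambda>s. P (q * a / (d * e * f) / complex_of_real s ^ 3) \<noteq> 0
        \<and> P (d * e * f / (q * a) * complex_of_real s ^ 3) \<noteq> 0) F"
      unfolding F_def by (intro eventually_conj eventually_rescaled_nonzero; simp)+
    show ?thesis using gt conv' open_conds generic_conds
    proof eventually_elim
      case (elim s)
      define v where "v = q * a / (D s * E s * G s)"
      have s0: "complex_of_real s \<noteq> 0" using elim(1) by auto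
      have [simp]: "D s \<noteq> 0" "E s \<noteq> 0" "G s \<noteq> 0" "v \<noteq> 0"
        using s0 by (auto simp: D_def E_def G_def v_def)
      have vs: "v = q * a / (d * e * f) / complex_of_real s ^ 3" "1 / v = d * e * f / (q * a)
          * complex_of_real s ^ 3"
        "D s * v = q * a / (e * f) / complex_of_real s ^ 2" "E s * v = q * a / (d * f)
            / complex_of_real s ^ 2"
        "G s * v = q * a / (d * e) / complex_of_real s ^ 2"
        using s0 by (simp_all add: v_def D_def E_def G_def field_simps power2_eq_square
            power3_eq_cube)
      have Pv: "P v \<noteq> 0" "P (1 / v) \<noteq> 0" using elim(10) unfolding vs by auto
      have gen: "v * q ^ i \<noteq> q ^ j" for i j
      proof
        assume eq: "v * q ^ i = q ^ j"
        show False
        proof (cases "j \<le> i")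
          case True
          then have "q ^ i = q ^ (i - j) * q ^ j" by (simp flip: power_add)
          then have "v * q ^ (i - j) = 1" using eq by simp
          with Pv(1) show False by (auto simp: qpoch_inf_eq_0_iff)
        next
          case False
          then have "q ^ j = q ^ (j - i) * q ^ i" by (simp flip: power_add)
          then have "1 / v * q ^ (j - i) = 1" using eq by (auto simp: field_simps)
          with Pv(2) show False by (auto simp: qpoch_inf_eq_0_iff)
        qed
      qed
      show ?case unfolding lhs_def rhs_def
      proof (rule three_term_generic)
        show "P (D s * x) \<noteq> 0 \<and> P (E s * x) \<noteq> 0 \<and> P (G s * x) \<noteq> 0"
          if "x \<in> {1, q * a / (D s * E s * G s)}" for x
        proof (cases "x = 1")
          case True
          then show ?thesis using elim(8) by (simp add: D_def E_def G_def)
        next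
          case False
          then have "x = v" using that by (simp add: v_def)
          then show ?thesis using elim(9) by (simp only: vs(3-5) simp_thms)
        qed
        show "q * a / (D s * E s * G s) * q ^ i \<noteq> q ^ j" for i j
          using gen[of i j] by (simp add: v_def)
      qed (use elim low theta[unfolded qtheta_eq] in auto)
    qed
  qed
  from tendsto_cong[OF this] L2 have "((\<lambda>s. lhs (D s) (E s) (G s)) \<longlongrightarrow> rhs d e f) F"
    by blast
  with F L1 have "lhs d e f = rhs d e f" by (rule tendsto_unique)
  then show ?thesis by (simp add: lhs_def rhs_def)
qed

end

theorem theorem6p7:
  fixes n :: int and q a b c d e f :: complex
  assumes "q \<noteq> 0" "a \<noteq> 0" "b \<noteq> 0" "c \<noteq> 0" "d \<noteq> 0" "e \<noteq> 0" "f \<noteq> 0"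
    and "norm q < 1"
    and "norm (q ^ 2 * a ^ 2) < norm (b * c * d * e * f)"
    and "qhyp_lower_ok (W87_lower a b c d e f q) q"
    and "\<forall>x\<in>set [q powi (n - 1) * b * c / a, q powi (n - 2) * b * c * d * e * f / a ^ 2].
           qtheta x q \<noteq> 0"
    and "\<forall>x\<in>set [q * a / b, q * a / c, q * a / d, q * a / e, q * a / f]. qpoch_inf x q \<noteq> 0"
    and "F_denom_ok q a b c d e f"
    and "F_denom_ok q a b c e d f"
    and "F_denom_ok q a b c f e d"
  shows "W87 a b c d e f q (q ^ 2 * a ^ 2 / (b * c * d * e * f)) =
    qpochs_inf [q * a, q * a / (b * c)] q
    / (qthetas [q powi (n - 1) * b * c / a, q powi (n - 2) * b * c * d * e * f / a ^ 2] q
       * qpochs_inf [q * a / b, q * a / c, q * a / d, q * a / e, q * a / f] q)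
    * (F_term n q a b c d e f + F_term n q a b c e d f + F_term n q a b c f e d)"
proof -
  interpret q_base q using assms(1,8) by unfold_locales
  define \<kappa> where "\<kappa> = b * c / a"
  define y where "y = b * c * d * e * f / (q * a ^ 2)"
  define p where "p = \<kappa> * y"
  have nz: "a \<noteq> 0" "b \<noteq> 0" "c \<noteq> 0" "d \<noteq> 0" "e \<noteq> 0" "f \<noteq> 0" by fact+
  have "p \<noteq> 0" using nz by (simp add: p_def \<kappa>_def y_def)
  from qtheta_pair_shift[OF this, of "n - 1"] obtain C where C: "C \<noteq> 0"
    "\<And>u w. u * w = p \<Longrightarrow> qtheta (q powi (n - 1) * u) q * qtheta (q powi (n - 1) * w) q = C
        * (qtheta u q * qtheta w q)"
    by blast
  have pow: "q powi (n - 2) = q powi (n - 1) / q" "q powi (1 - 2) = 1 / q"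
    using power_int_diff[of q "n - 1" 1] by (simp_all add: power_int_minus field_simps)
  have args: "q powi (n - 1) * b * c / a = q powi (n - 1) * \<kappa>"
    "q powi (n - 2) * b * c * d * e * f / a ^ 2 = q powi (n - 1) * y"
    using nz by (simp_all add: \<kappa>_def y_def pow field_simps)
  have F: "F_term n q a b c x u w = C * F_term 1 q a b c x u w" if "x * u * w = d * e * f" for x u w
  proof -
    have "q powi (n - 1) * b * c * x / a = q powi (n - 1) * (\<kappa> * x)"
      "q powi (n - 2) * b * c * u * w / a ^ 2 = q powi (n - 1) * (b * c * u * w / (q * a ^ 2))"
      "q powi (1 - 1) * b * c * x / a = \<kappa> * x"
      "q powi (1 - 2) * b * c * u * w / a ^ 2 = b * c * u * w / (q * a ^ 2)"
      using nz by (simp_all add: \<kappa>_def pow field_simps)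
    moreover have "\<kappa> * x * (b * c * u * w / (q * a ^ 2)) = \<kappa> * (b * c * (x * u * w) / (q * a ^ 2))"
      by simp
    then have "\<kappa> * x * (b * c * u * w / (q * a ^ 2)) = p"
      unfolding that by (simp add: p_def y_def mult_ac)
    note C(2)[OF this]
    ultimately show ?thesis by (simp add: F_term_def qthetas_def mult_ac)
  qed
  have thetas: "qthetas [q powi (n - 1) * b * c / a, q powi (n - 2) * b * c * d * e * f / a ^ 2] q
      = C * (qtheta \<kappa> q * qtheta y q)"
    using C(2)[of \<kappa> y] by (simp add: qthetas_def args p_def)
  moreover have "qthetas [q powi (n - 1) * b * c / a, q powi (n - 2) * b * c * d * e * f
      / a ^ 2] q \<noteq> 0"
    using assms(11) by (simp add: qthetas_def)
  ultimately have th: "qtheta \<kappa> q \<noteq> 0" "qtheta y q \<noteq> 0" by auto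
  have main: "qtheta \<kappa> q * qtheta y q
     * (P (q * a / b) * P (q * a / c) * P (q * a / d) * P (q * a / e) * P (q * a / f))
     * W87 a b c d e f q (q ^ 2 * a ^ 2 / (b * c * d * e * f))
   = P (q * a) * P (q / \<kappa>) * (F_term 1 q a b c d e f + F_term 1 q a b c e d f
       + F_term 1 q a b c f e d)"
    unfolding \<kappa>_def y_def
    by (rule three_term[OF nz assms(9,10) th[unfolded \<kappa>_def y_def] assms(13-15)])
  have "q / \<kappa> = q * a / (b * c)" using nz by (simp add: \<kappa>_def)
  moreover have "F_term n q a b c d e f + F_term n q a b c e d f + F_term n q a b c f e d
    = C * (F_term 1 q a b c d e f + F_term 1 q a b c e d f + F_term 1 q a b c f e d)"
    by (simp add: F mult_ac distrib_left)
  moreover have "P (q * a / b) * P (q * a / c) * P (q * a / d) * P (q * a / e) * P (q * a / f) \<noteq> 0"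
    using assms(12) by simp
  ultimately show ?thesis
    unfolding thetas using main th C(1) by (simp add: qpochs_inf_def field_simps)
qed

end
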